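(* For each integer $n\ge 1$ let $\mu^n=\{1,2,4,\ldots,2n,2n+1\}$ (that is, $\{1\}\cup\{2j:1\le j\le n\}\cup\{2n+1\}$). Then $\mu^n$ has no direct predecessor; i.e. there is no Gabriel-Roiter measure $\mu$ of which $\mu^n$ is a direct successor.
   Context: Let $k$ be an algebraically closed field and $Q$ the quiver with vertices $1,2,3$, one arrow $1\to 2$ and two arrows $2\to 3$. A module is a finite-dimensional representation of $Q$ over $k$; $|M|$ denotes the length of $M$ (equivalently its total dimension). Order on subsets of $\mathbb{N}_1=\{1,2,3,\ldots\}$: for $I\ne J$ put $I<J$ if the smallest element of $(I\setminus J)\cup(J\setminus I)$ belongs to $J$. The Gabriel-Roiter measure $\mu(M)$ of a nonzero module $M$ is the maximum, in this order, of the sets $\{|M_1|,\ldots,|M_t|\}$ over all chains $M_1\subsetneq M_2\subsetneq\cdots\subsetneq M_t$ of indecomposable submodules of $M$. A set is called a Gabriel-Roiter measure if it equals $\mu(M)$ for some indecomposable module $M$. For Gabriel-Roiter measures $\mu,\mu'$: $\mu'$ is a direct successor of $\mu$ (and $\mu$ a direct predecessor of $\mu'$) if $\mu<\mu'$ and there is no Gabriel-Roiter measure $\mu''$ with $\mu<\mu''<\mu'$. *)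

theory Defs
  imports
    "HOL-Computational_Algebra.Polynomial"
    "HOL-Library.Function_Algebras"
begin

text \<open>
  All vector spaces are finite-dimensional subspaces of the \<open>k\<close>-vector space of sequences
  \<open>nat \<Rightarrow> k\<close> with pointwise operations. This space has infinite dimension, so every
  finite-dimensional representation is isomorphic to one of this form.
\<close>

definition fscale :: "'k::field \<Rightarrow> (nat \<Rightarrow> 'k) \<Rightarrow> (nat \<Rightarrow> 'k)" where
  "fscale c v = (\<lambda>i. c * v i)"

global_interpretation seqs: vector_space "fscale :: 'k::field \<Rightarrow> (nat \<Rightarrow> 'k) \<Rightarrow> (nat \<Rightarrow> 'k)"
  by unfold_locales (auto simp: fscale_def algebra_simps fun_eq_iff)

definition findim :: "(nat \<Rightarrow> 'k::field) set \<Rightarrow> bool" where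
  "findim V \<longleftrightarrow> (\<exists>B. finite B \<and> V \<subseteq> seqs.span B)"

definition linear_map_on ::
    "(nat \<Rightarrow> 'k::field) set \<Rightarrow> (nat \<Rightarrow> 'k) set \<Rightarrow> ((nat \<Rightarrow> 'k) \<Rightarrow> (nat \<Rightarrow> 'k)) \<Rightarrow> bool" where
  "linear_map_on V W f \<longleftrightarrow>
     (\<forall>x\<in>V. f x \<in> W) \<and>
     (\<forall>x\<in>V. \<forall>y\<in>V. f (x + y) = f x + f y) \<and>
     (\<forall>c. \<forall>x\<in>V. f (fscale c x) = fscale c (f x))"


subsection \<open>Representations of the quiver\<close>

datatype vertex = V1 | V2 | V3

datatype arrow = A12 | A23 | B23

fun source :: "arrow \<Rightarrow> vertex" where
  "source A12 = V1" | "source A23 = V2" | "source B23 = V2"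

fun target :: "arrow \<Rightarrow> vertex" where
  "target A12 = V2" | "target A23 = V3" | "target B23 = V3"

text \<open>The values of \<open>act M a\<close> outside \<open>vspace M (source a)\<close> are irrelevant.\<close>

record 'k rep =
  vspace :: "vertex \<Rightarrow> (nat \<Rightarrow> 'k) set"
  act :: "arrow \<Rightarrow> (nat \<Rightarrow> 'k) \<Rightarrow> (nat \<Rightarrow> 'k)"

definition quiver_rep :: "'k::field rep \<Rightarrow> bool" where
  "quiver_rep M \<longleftrightarrow>
     (\<forall>i. seqs.subspace (vspace M i) \<and> findim (vspace M i)) \<and>
     (\<forall>a. linear_map_on (vspace M (source a)) (vspace M (target a)) (act M a))"

text \<open>
  A submodule is given by its family of subspaces, so that \<open>\<subseteq>\<close> and \<open>\<subset>\<close> of submodules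
  are the pointwise orders \<open>\<le>\<close> and \<open><\<close> on \<open>vertex \<Rightarrow> (nat \<Rightarrow> k) set\<close>; \<open>subrep M U\<close> is the
  submodule as a representation in its own right.
\<close>

definition submodules :: "'k::field rep \<Rightarrow> (vertex \<Rightarrow> (nat \<Rightarrow> 'k) set) set" where
  "submodules M = {U. (\<forall>i. seqs.subspace (U i)) \<and> U \<le> vspace M \<and>
                      (\<forall>a. act M a ` U (source a) \<subseteq> U (target a))}"

definition subrep :: "'k::field rep \<Rightarrow> (vertex \<Rightarrow> (nat \<Rightarrow> 'k) set) \<Rightarrow> 'k rep" where
  "subrep M U = M\<lparr>vspace := U\<rparr>"

definition zero_sub :: "vertex \<Rightarrow> (nat \<Rightarrow> 'k::field) set" where
  "zero_sub = (\<lambda>_. {0})"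

definition direct_sum_of ::
    "'k::field rep \<Rightarrow> (vertex \<Rightarrow> (nat \<Rightarrow> 'k) set) \<Rightarrow> (vertex \<Rightarrow> (nat \<Rightarrow> 'k) set) \<Rightarrow> bool" where
  "direct_sum_of M U W \<longleftrightarrow>
     U \<in> submodules M \<and> W \<in> submodules M \<and>
     (\<forall>i. U i \<inter> W i = {0} \<and> vspace M i = {u + w |u w. u \<in> U i \<and> w \<in> W i})"

definition indecomposable :: "'k::field rep \<Rightarrow> bool" where
  "indecomposable M \<longleftrightarrow>
     quiver_rep M \<and> vspace M \<noteq> zero_sub \<and>
     \<not> (\<exists>U W. direct_sum_of M U W \<and> U \<noteq> zero_sub \<and> W \<noteq> zero_sub)"

text \<open>
  The length of \<open>M\<close>: the largest \<open>t\<close> such that there is a chain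
  \<open>U\<^sub>0 \<subset> U\<^sub>1 \<subset> \<dots> \<subset> U\<^sub>t\<close> of submodules. See \<open>rep_length_eq_dim\<close> below.
\<close>

definition rep_length :: "'k::field rep \<Rightarrow> nat" where
  "rep_length M =
     Max {t. \<exists>Us. length Us = Suc t \<and> set Us \<subseteq> submodules M \<and> sorted_wrt (<) Us}"


subsection \<open>The Gabriel-Roiter measure\<close>

definition gr_less :: "nat set \<Rightarrow> nat set \<Rightarrow> bool" where
  "gr_less I J \<longleftrightarrow> I \<noteq> J \<and> (LEAST x. x \<in> (I - J) \<union> (J - I)) \<in> J"

definition gr_sets :: "'k::field rep \<Rightarrow> nat set set" where
  "gr_sets M =
     {(\<lambda>U. rep_length (subrep M U)) ` set Us |Us.
        Us \<noteq> [] \<and> sorted_wrt (<) Us \<and>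
        (\<forall>U\<in>set Us. U \<in> submodules M \<and> indecomposable (subrep M U))}"

definition gabriel_roiter :: "'k::field rep \<Rightarrow> nat set" where
  "gabriel_roiter M =
     (THE I. I \<in> gr_sets M \<and> (\<forall>J\<in>gr_sets M. J \<noteq> I \<longrightarrow> gr_less J I))"

definition gr_measure :: "'k::field itself \<Rightarrow> nat set \<Rightarrow> bool" where
  "gr_measure _ I \<longleftrightarrow> (\<exists>M::'k rep. indecomposable M \<and> I = gabriel_roiter M)"

text \<open>
  \<open>direct_successor k I' I\<close>: \<open>I'\<close> is a direct successor of \<open>I\<close>;
  \<open>direct_predecessor k I I'\<close>: \<open>I\<close> is a direct predecessor of \<open>I'\<close>.
\<close>

definition direct_successor :: "'k::field itself \<Rightarrow> nat set \<Rightarrow> nat set \<Rightarrow> bool" where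
  "direct_successor k I' I \<longleftrightarrow>
     gr_measure k I \<and> gr_measure k I' \<and> gr_less I I' \<and>
     \<not> (\<exists>I''. gr_measure k I'' \<and> gr_less I I'' \<and> gr_less I'' I')"

abbreviation direct_predecessor :: "'k::field itself \<Rightarrow> nat set \<Rightarrow> nat set \<Rightarrow> bool" where
  "direct_predecessor k I I' \<equiv> direct_successor k I' I"

definition mu_set :: "nat \<Rightarrow> nat set" where
  "mu_set n = {1} \<union> {2 * j |j. 1 \<le> j \<and> j \<le> n} \<union> {2 * n + 1}"



subsection \<open>The length is the total dimension\<close>

lemma findim_mono: "findim W \<Longrightarrow> U \<subseteq> W \<Longrightarrow> findim U"
  unfolding findim_def by blast

lemma dim_psubset_findim:
  assumes "seqs.subspace U" "findim W" "U \<subset> W"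
  shows "seqs.dim U < seqs.dim W"
proof -
  obtain A where A: "A \<subseteq> U" "seqs.independent A" "U \<subseteq> seqs.span A" "card A = seqs.dim U"
    using seqs.basis_exists by metis
  obtain B where B: "A \<subseteq> B" "B \<subseteq> W" "seqs.independent B" "W \<subseteq> seqs.span B"
    using seqs.maximal_independent_subset_extend[of A W] A assms(3) by blast
  obtain F where "finite F" "W \<subseteq> seqs.span F" using assms(2) unfolding findim_def by blast
  then have "finite B" using seqs.independent_span_bound[of F B] B by blast
  moreover have "A \<noteq> B"
    using assms(1,3) A(1) B(4) seqs.span_minimal[of A U] by blast
  ultimately have "card A < card B" using B(1) by (simp add: psubset_card_mono psubset_eq)
  then show ?thesis using A(4) seqs.basis_card_eq_dim[OF B(2,4,3)] by simp
qed

lemma ex_hyperplane: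
  assumes "seqs.subspace W" "findim W" "W \<noteq> {0}"
  shows "\<exists>H. seqs.subspace H \<and> H \<subseteq> W \<and> Suc (seqs.dim H) = seqs.dim W"
proof -
  obtain B where B: "B \<subseteq> W" "seqs.independent B" "W \<subseteq> seqs.span B" "card B = seqs.dim W"
    using seqs.basis_exists by metis
  obtain F where "finite F" "W \<subseteq> seqs.span F" using assms(2) unfolding findim_def by blast
  then have fin: "finite B" using seqs.independent_span_bound[of F B] B by blast
  have "B \<noteq> {}" using B(3) assms(1,3) seqs.subspace_0 by fastforce
  then obtain b where b: "b \<in> B" by blast
  have "seqs.dim (seqs.span (B - {b})) = card (B - {b})"
    by (rule seqs.dim_span_eq_card_independent) (meson B(2) Diff_subset seqs.independent_mono)
  moreover have "Suc (card (B - {b})) = card B" using fin b by (rule card_Suc_Diff1)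
  moreover have "seqs.span (B - {b}) \<subseteq> W"
    using B(1) assms(1) by (intro seqs.span_minimal) auto
  ultimately show ?thesis using B(4) seqs.subspace_span by metis
qed

definition total_dim :: "(vertex \<Rightarrow> (nat \<Rightarrow> 'k::field) set) \<Rightarrow> nat" where
  "total_dim U = seqs.dim (U V1) + seqs.dim (U V2) + seqs.dim (U V3)"

lemma all_vertex: "(\<forall>i. P i) \<longleftrightarrow> P V1 \<and> P V2 \<and> P V3"
  by (metis vertex.exhaust)

lemma all_arrow: "(\<forall>a. P a) \<longleftrightarrow> P A12 \<and> P A23 \<and> P B23"
  by (metis arrow.exhaust)

lemma quiver_rep_subrep:
  assumes M: "quiver_rep M" and U: "U \<in> submodules M"
  shows "quiver_rep (subrep M U)"
proof -
  have le: "U i \<subseteq> vspace M i" for i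
    using U unfolding submodules_def le_fun_def by blast
  have "seqs.subspace (U i)" "findim (U i)" for i
    using M U le[of i] findim_mono unfolding quiver_rep_def submodules_def by blast+
  moreover have "linear_map_on (U (source a)) (U (target a)) (act M a)" for a
  proof -
    have "linear_map_on (vspace M (source a)) (vspace M (target a)) (act M a)"
      using M unfolding quiver_rep_def by blast
    moreover have "act M a ` U (source a) \<subseteq> U (target a)"
      using U unfolding submodules_def by blast
    ultimately show ?thesis
      using le[of "source a"] unfolding linear_map_on_def by blast
  qed
  ultimately show ?thesis unfolding quiver_rep_def subrep_def by simp
qed

lemma submodules_sub:
  "U \<in> submodules M \<Longrightarrow> submodules (subrep M U) = {W \<in> submodules M. W \<le> U}"
  unfolding submodules_def subrep_def by (auto dest: order.trans)

lemma space_in_submodules: "quiver_rep M \<Longrightarrow> vspace M \<in> submodules M"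
  unfolding quiver_rep_def submodules_def linear_map_on_def by blast

lemma total_dim_mono:
  assumes "quiver_rep M" "U \<in> submodules M" "W \<in> submodules M" "U < W"
  shows "total_dim U < total_dim W"
proof -
  have le: "U i \<subseteq> W i" for i using assms(4) by (auto simp: less_fun_def le_fun_def)
  have st: "seqs.dim (U i) < seqs.dim (W i)" if "U i \<noteq> W i" for i
  proof (rule dim_psubset_findim)
    show "seqs.subspace (U i)" using assms(2) unfolding submodules_def by blast
    have "W i \<subseteq> vspace M i" using assms(3) unfolding submodules_def le_fun_def by blast
    then show "findim (W i)" using assms(1) findim_mono unfolding quiver_rep_def by blast
    show "U i \<subset> W i" using that le by blast
  qed
  have wk: "seqs.dim (U i) \<le> seqs.dim (W i)" for i
    using st[of i] by (cases "U i = W i") auto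
  obtain i where "U i \<noteq> W i" using assms(4) by (auto simp: less_le fun_eq_iff)
  then have "seqs.dim (U i) < seqs.dim (W i)" by (rule st)
  then show ?thesis unfolding total_dim_def
    using wk[of V1] wk[of V2] wk[of V3] by (cases i) auto
qed

lemma chain_length_le:
  assumes "quiver_rep M" "set Us \<subseteq> submodules M" "sorted_wrt (<) Us" "Us \<noteq> []"
  shows "length Us \<le> Suc (total_dim (last Us))"
  using assms(2-4)
proof (induction Us rule: rev_induct)
  case (snoc U Us)
  show ?case
  proof (cases "Us = []")
    case False
    have "last Us < U" using snoc.prems(2) False by (auto simp: sorted_wrt_append)
    then have "total_dim (last Us) < total_dim U"
      using total_dim_mono[OF assms(1), of "last Us" U] snoc.prems(1) last_in_set[OF False] by auto
    moreover have "length Us \<le> Suc (total_dim (last Us))"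
      using snoc False by (auto simp: sorted_wrt_append)
    ultimately show ?thesis by simp
  qed simp
qed simp

lemma ex_maximal_submodule:
  assumes M: "quiver_rep M" and nz: "vspace M \<noteq> zero_sub"
  shows "\<exists>U\<in>submodules M. U < vspace M \<and> Suc (total_dim U) = total_dim (vspace M)"
proof -
  have sp: "seqs.subspace (vspace M i)" "findim (vspace M i)" for i
    using M unfolding quiver_rep_def by auto
  have act: "act M a x \<in> vspace M (target a)" if "x \<in> vspace M (source a)" for a x
    using M that unfolding quiver_rep_def linear_map_on_def by blast
  have act0: "act M a 0 = 0" for a
    using M sp(1)[THEN seqs.subspace_0] unfolding quiver_rep_def linear_map_on_def
    by (metis seqs.scale_zero_left)
  have "\<exists>i. vspace M i \<noteq> {0} \<and> (\<forall>a. target a = i \<longrightarrow> vspace M (source a) = {0})"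
  proof -
    have "\<exists>i. vspace M i \<noteq> {0}" using nz unfolding zero_sub_def by auto
    then consider "vspace M V1 \<noteq> {0}" | "vspace M V1 = {0}" "vspace M V2 \<noteq> {0}"
      | "vspace M V1 = {0}" "vspace M V2 = {0}" "vspace M V3 \<noteq> {0}"
      by (metis vertex.exhaust)
    then show ?thesis
    proof cases
      case 1
      then show ?thesis by (intro exI[of _ V1]) (simp add: all_arrow)
    next
      case 2
      then show ?thesis by (intro exI[of _ V2]) (simp add: all_arrow)
    next
      case 3
      then show ?thesis by (intro exI[of _ V3]) (simp add: all_arrow)
    qed
  qed
  then obtain i where i: "vspace M i \<noteq> {0}" "\<And>a. target a = i \<Longrightarrow> vspace M (source a) = {0}" by blast
  obtain H where H: "seqs.subspace H" "H \<subseteq> vspace M i" "Suc (seqs.dim H) = seqs.dim (vspace M i)"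
    using ex_hyperplane[OF sp i(1)] by blast
  let ?U = "(vspace M)(i := H)"
  have "act M a ` ?U (source a) \<subseteq> ?U (target a)" for a
  proof (cases "target a = i")
    case True
    then have "?U (source a) \<subseteq> {0}" using i(2)[OF True] H(2) by (auto split: if_splits)
    then show ?thesis using act0 True seqs.subspace_0[OF H(1)] by auto
  next
    case False
    then show ?thesis using act H(2) by (auto split: if_splits)
  qed
  then have U: "?U \<in> submodules M"
    using sp H unfolding submodules_def by (auto simp: le_fun_def)
  moreover have "?U \<noteq> vspace M" using H(3) by (metis fun_upd_same n_not_Suc_n)
  then have "?U < vspace M" using U unfolding submodules_def by (auto simp: less_le)
  moreover have "Suc (total_dim ?U) = total_dim (vspace M)"
    unfolding total_dim_def using H(3) by (cases i) auto
  ultimately show ?thesis by blast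
qed

lemma ex_composition_series:
  assumes "quiver_rep M"
  shows "\<exists>Us. length Us = Suc (total_dim (vspace M)) \<and> set Us \<subseteq> submodules M \<and>
              sorted_wrt (<) Us \<and> last Us = vspace M"
  using assms
proof (induction "total_dim (vspace M)" arbitrary: M)
  case 0
  then show ?case using space_in_submodules by (intro exI[of _ "[vspace M]"]) auto
next
  case (Suc n)
  have "vspace M \<noteq> zero_sub"
  proof
    assume "vspace M = zero_sub"
    moreover have "total_dim (zero_sub :: vertex \<Rightarrow> (nat \<Rightarrow> 'a) set) = 0"
      unfolding total_dim_def zero_sub_def using seqs.dim_le_card[of "{0}" "{}"] by simp
    ultimately show False using Suc.hyps(2) by simp
  qed
  then obtain U where U: "U \<in> submodules M" "U < vspace M" "Suc (total_dim U) = total_dim (vspace M)"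
    using ex_maximal_submodule Suc.prems by blast
  have [simp]: "vspace (subrep M U) = U" by (simp add: subrep_def)
  obtain Us where Us: "length Us = Suc (total_dim U)" "set Us \<subseteq> submodules (subrep M U)"
      "sorted_wrt (<) Us" "last Us = U"
    using Suc.hyps(1)[of "subrep M U"] U Suc.hyps(2) quiver_rep_subrep[OF Suc.prems U(1)] by auto
  have "set Us \<subseteq> {W \<in> submodules M. W \<le> U}" using Us(2) submodules_sub[OF U(1)] by simp
  then have "set (Us @ [vspace M]) \<subseteq> submodules M \<and> sorted_wrt (<) (Us @ [vspace M])"
    using Us(3) U(2) space_in_submodules[OF Suc.prems] by (auto simp: sorted_wrt_append)
  then show ?case using Us(1) U(3) by (intro exI[of _ "Us @ [vspace M]"]) auto
qed

theorem rep_length_eq_dim: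
  assumes M: "quiver_rep M"
  shows "rep_length M = seqs.dim (vspace M V1) + seqs.dim (vspace M V2) + seqs.dim (vspace M V3)"
proof -
  let ?T = "{t. \<exists>Us. length Us = Suc t \<and> set Us \<subseteq> submodules M \<and> sorted_wrt (<) Us}"
  have le: "t \<le> total_dim (vspace M)" if t: "t \<in> ?T" for t
  proof -
    obtain Us where Us: "length Us = Suc t" "set Us \<subseteq> submodules M" "sorted_wrt (<) Us"
      using t by blast
    then have ne: "Us \<noteq> []" by auto
    then have l: "last Us \<in> submodules M" using Us(2) by auto
    then have "last Us \<le> vspace M" unfolding submodules_def by auto
    then have "total_dim (last Us) \<le> total_dim (vspace M)"
      using total_dim_mono[OF M l space_in_submodules[OF M]] by (auto simp: order.order_iff_strict)
    then show ?thesis using chain_length_le[OF M Us(2,3) ne] Us(1) by simp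
  qed
  then have "finite ?T" by (meson finite_nat_set_iff_bounded_le)
  moreover have "total_dim (vspace M) \<in> ?T" using ex_composition_series[OF M] by blast
  ultimately have "Max ?T = total_dim (vspace M)" using le by (intro Max_eqI) auto
  then show ?thesis unfolding rep_length_def total_dim_def by simp
qed


subsection \<open>The Gabriel-Roiter measure of a nonzero module exists\<close>

lemma gr_less_iff:
  "gr_less I J \<longleftrightarrow> (\<exists>x. x \<in> J \<and> x \<notin> I \<and> (\<forall>y<x. y \<in> I \<longleftrightarrow> y \<in> J))"
proof
  assume *: "gr_less I J"
  then have "\<exists>x. x \<in> (I - J) \<union> (J - I)" unfolding gr_less_def by blast
  from LeastI_ex[OF this] have
    "(LEAST x. x \<in> (I - J) \<union> (J - I)) \<in> J - I"
    using * unfolding gr_less_def by blast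
  moreover have "y \<in> I \<longleftrightarrow> y \<in> J" if "y < (LEAST x. x \<in> (I - J) \<union> (J - I))" for y
    using not_less_Least[OF that] by blast
  ultimately show "\<exists>x. x \<in> J \<and> x \<notin> I \<and> (\<forall>y<x. y \<in> I \<longleftrightarrow> y \<in> J)" by blast
next
  assume "\<exists>x. x \<in> J \<and> x \<notin> I \<and> (\<forall>y<x. y \<in> I \<longleftrightarrow> y \<in> J)"
  then obtain x where x: "x \<in> J" "x \<notin> I" "\<forall>y<x. y \<in> I \<longleftrightarrow> y \<in> J" by blast
  have "(LEAST x. x \<in> (I - J) \<union> (J - I)) = x"
    using x by (intro Least_equality) (auto simp: not_less[symmetric])
  then show "gr_less I J" using x unfolding gr_less_def by auto
qed

lemma gr_less_irrefl: "\<not> gr_less I I"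
  by (simp add: gr_less_def)

lemma gr_less_trans: "gr_less I J \<Longrightarrow> gr_less J K \<Longrightarrow> gr_less I K"
proof -
  assume "gr_less I J" "gr_less J K"
  then obtain x y where
    x: "x \<in> J" "x \<notin> I" "\<forall>z<x. z \<in> I \<longleftrightarrow> z \<in> J" and
    y: "y \<in> K" "y \<notin> J" "\<forall>z<y. z \<in> J \<longleftrightarrow> z \<in> K"
    unfolding gr_less_iff by blast
  then show "gr_less I K" unfolding gr_less_iff
    by (cases x y rule: linorder_cases) (metis order.strict_trans)+
qed

lemma gr_less_linear: "gr_less I J \<or> I = J \<or> gr_less J I"
proof (cases "I = J")
  case False
  then have "\<exists>x. x \<in> (I - J) \<union> (J - I)" by blast
  from LeastI_ex[OF this] show ?thesis
    using False unfolding gr_less_def by (auto simp: Un_commute)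
qed auto

lemma finite_gr_max:
  assumes "finite S" "S \<noteq> {}"
  shows "\<exists>I\<in>S. \<forall>J\<in>S. J \<noteq> I \<longrightarrow> gr_less J I"
  using assms
proof (induction rule: finite_ne_induct)
  case (insert K S)
  then obtain I where "I \<in> S" "\<forall>J\<in>S. J \<noteq> I \<longrightarrow> gr_less J I" by blast
  then show ?case using gr_less_linear[of K I] gr_less_trans by (metis insert_iff)
qed auto

lemma ex_indecomposable_submodule:
  assumes M: "quiver_rep M" and nz: "vspace M \<noteq> zero_sub"
  shows "\<exists>U\<in>submodules M. indecomposable (subrep M U)"
proof -
  have ex: "vspace M \<in> submodules M \<and> vspace M \<noteq> zero_sub"
    using space_in_submodules[OF M] nz by simp
  then obtain U where U: "U \<in> submodules M" "U \<noteq> zero_sub"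
    and min: "\<And>W. W \<in> submodules M \<Longrightarrow> W \<noteq> zero_sub \<Longrightarrow> total_dim U \<le> total_dim W"
    using ex_has_least_nat[of "\<lambda>U. U \<in> submodules M \<and> U \<noteq> zero_sub" "vspace M" total_dim] by blast
  have False if d: "direct_sum_of (subrep M U) A B" "A \<noteq> zero_sub" "B \<noteq> zero_sub" for A B
  proof -
    have sub: "A \<in> submodules M" "A \<le> U" "B \<in> submodules M" "B \<le> U"
      using d(1) submodules_sub[OF U(1)] unfolding direct_sum_of_def by auto
    have "A = U" "B = U"
      using min total_dim_mono[OF M _ U(1)] sub d(2,3) by (metis leD order.order_iff_strict)+
    moreover have "A i \<inter> B i = {0}" for i using d(1) unfolding direct_sum_of_def by blast
    ultimately have "U = zero_sub" unfolding zero_sub_def by auto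
    then show False using U(2) by simp
  qed
  then have "indecomposable (subrep M U)"
    using quiver_rep_subrep[OF M U(1)] U(2) unfolding indecomposable_def
    by (auto simp: subrep_def)
  then show ?thesis using U(1) by blast
qed

theorem gabriel_roiter_is_max:
  assumes M: "quiver_rep M" and nz: "vspace M \<noteq> zero_sub"
  shows "gabriel_roiter M \<in> gr_sets M"
    and "\<And>J. J \<in> gr_sets M \<Longrightarrow> J \<noteq> gabriel_roiter M \<Longrightarrow> gr_less J (gabriel_roiter M)"
proof -
  have "gr_sets M \<subseteq> Pow {..total_dim (vspace M)}"
  proof -
    have "rep_length (subrep M U) \<le> total_dim (vspace M)" if U: "U \<in> submodules M" for U
    proof -
      have "U \<le> vspace M" using U unfolding submodules_def by auto
      then have "total_dim U \<le> total_dim (vspace M)"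
        using total_dim_mono[OF M U space_in_submodules[OF M]]
        by (auto simp: order.order_iff_strict)
      then show ?thesis
        using rep_length_eq_dim[OF quiver_rep_subrep[OF M U]]
        by (simp add: subrep_def total_dim_def)
    qed
    then show ?thesis unfolding gr_sets_def by auto
  qed
  then have "finite (gr_sets M)" by (rule finite_subset) simp
  moreover have "gr_sets M \<noteq> {}"
  proof -
    obtain U where "U \<in> submodules M" "indecomposable (subrep M U)"
      using ex_indecomposable_submodule[OF M nz] by blast
    then have "(\<lambda>U. rep_length (subrep M U)) ` set [U] \<in> gr_sets M"
      unfolding gr_sets_def by (intro CollectI exI[of _ "[U]"]) auto
    then show ?thesis by blast
  qed
  ultimately obtain I where I: "I \<in> gr_sets M" "\<forall>J\<in>gr_sets M. J \<noteq> I \<longrightarrow> gr_less J I"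
    using finite_gr_max by blast
  have "gabriel_roiter M = I" unfolding gabriel_roiter_def
  proof (rule the_equality)
    fix K assume K: "K \<in> gr_sets M \<and> (\<forall>J\<in>gr_sets M. J \<noteq> K \<longrightarrow> gr_less J K)"
    show "K = I"
    proof (rule ccontr)
      assume "K \<noteq> I"
      then have "gr_less K I" "gr_less I K" using K I by auto
      then show False using gr_less_trans gr_less_irrefl by blast
    qed
  qed (use I in blast)
  then show "gabriel_roiter M \<in> gr_sets M"
    and "\<And>J. J \<in> gr_sets M \<Longrightarrow> J \<noteq> gabriel_roiter M \<Longrightarrow> gr_less J (gabriel_roiter M)"
    using I by auto
qed

end

(*
  Write Q_j for the preinjective Kronecker module of dimension vector (0, j + 1, j), and Z_j for the
  modules (1, j, j) obtained from a regular module R[j] of a homogeneous tube by mapping the first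
  vertex onto a generator. An indecomposable module of total dimension at least 3 has measure
  below mu^n if and only if there are no nonzero homomorphisms to it from Q_j and Z_j, j <= n. This
  condition is closed under submodules and extensions.

  If N satisfies it, then the maps (lam b1 - b2) alpha are injective for all lam, and over an
  algebraically closed field they cannot be surjective either. This makes it possible to write down
  a nonsplit extension M of a torsion-free module by N. By Gabriel's main property, a proper
  non-split overmodule M of N has an indecomposable submodule of measure larger than that of N, and
  this measure is still below mu^n. So no measure below mu^n can be a direct predecessor.
*)
theory Submission
  imports Defs
begin

text \<open>Why Q_j and Z_j suffice: mu^n contains 1 and all even numbers up to 2n, so a set of
  positive lengths that is not below mu^n begins with mu^j for some 1 <= j <= n. Only chains with
  the lengths of mu^j must be excluded, and each of them is governed by one Jordan chain of the
  pencil.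

  Why the extension does not split: put D_i = lam_i b1 - b2. The quotient has to be torsion-free
  too; hence simple regular modules with distinct parameters are joined along a hyperplane at the
  first vertex. A splitting gives m in N_2 with D_j m = z and D_i m in D_i alpha N_1 for all i < j.
  By finite dimension j can be chosen so that the conditions for i < j imply the one for i = j; a z
  outside D_j alpha N_1 is then contradictory. This needs infinitely many parameters.

  Small modules are an obstacle: the simple modules at the first two vertices and the indecomposable
  (1, 1, 0) have measure at most {1, 2} without being torsion-free. A torsion-free module with
  measure at least {1, 2} takes their place.\<close>

subsection \<open>Linear algebra in the space of sequences\<close>

type_synonym 'k vec = "nat \<Rightarrow> 'k"

abbreviation lin :: "('k::field vec \<Rightarrow> 'k vec) \<Rightarrow> bool" where
  "lin \<equiv> Vector_Spaces.linear fscale fscale"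

global_interpretation seqs_pair: vector_space_pair
  "fscale :: 'k::field \<Rightarrow> 'k vec \<Rightarrow> 'k vec" "fscale :: 'k \<Rightarrow> 'k vec \<Rightarrow> 'k vec"
  by unfold_locales

lemma linI: "(\<And>x y. f (x + y) = f x + f y) \<Longrightarrow> (\<And>c x. f (fscale c x) = fscale c (f x)) \<Longrightarrow> lin f"
  unfolding Vector_Spaces.linear_iff using seqs.vector_space_axioms by blast

lemma lin_ident: "lin (\<lambda>x. x)"
  by (rule linI) auto

lemmas lin_simps = seqs_pair.linear_add seqs_pair.linear_diff seqs_pair.linear_scale seqs_pair.linear_0

lemma lin_on_subset: "linear_map_on V W f \<Longrightarrow> U \<subseteq> V \<Longrightarrow> linear_map_on U W f"
  unfolding linear_map_on_def by blast

lemma lin_on_mem: "linear_map_on V W f \<Longrightarrow> x \<in> V \<Longrightarrow> f x \<in> W"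
  unfolding linear_map_on_def by blast

lemma lin_on_add: "linear_map_on V W f \<Longrightarrow> x \<in> V \<Longrightarrow> y \<in> V \<Longrightarrow> f (x + y) = f x + f y"
  unfolding linear_map_on_def by blast

lemma lin_on_scale: "linear_map_on V W f \<Longrightarrow> x \<in> V \<Longrightarrow> f (fscale c x) = fscale c (f x)"
  unfolding linear_map_on_def by blast

lemma lin_on_0:
  assumes "linear_map_on V W f" "seqs.subspace V"
  shows "f 0 = 0"
  using lin_on_scale[OF assms(1) seqs.subspace_0[OF assms(2)], of 0] by simp

lemma lin_on_diff:
  assumes "linear_map_on V W f" "seqs.subspace V" "x \<in> V" "y \<in> V"
  shows "f (x - y) = f x - f y"
proof -
  have "x - y \<in> V" using assms(2-4) by (rule seqs.subspace_diff)
  then have "f (x - y + y) = f (x - y) + f y" by (rule lin_on_add[OF assms(1) _ assms(4)])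
  then show ?thesis by simp
qed

lemma lin_on_image:
  assumes "linear_map_on V W f" "seqs.subspace V"
  shows "seqs.subspace (f ` V)"
proof -
  have "f x + f y \<in> f ` V" if "x \<in> V" "y \<in> V" for x y
    using lin_on_add[OF assms(1) that] seqs.subspace_add[OF assms(2) that] by (metis imageI)
  moreover have "fscale c (f x) \<in> f ` V" if "x \<in> V" for c x
    using lin_on_scale[OF assms(1) that, of c] seqs.subspace_scale[OF assms(2) that, of c]
    by (metis imageI)
  moreover have "0 \<in> f ` V" using lin_on_0[OF assms] seqs.subspace_0[OF assms(2)] by (metis imageI)
  ultimately show ?thesis unfolding seqs.subspace_def by blast
qed

lemma lin_on_extend:
  assumes "linear_map_on V W f" "seqs.subspace V"
  shows "\<exists>g. lin g \<and> (\<forall>x\<in>V. g x = f x)"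
proof -
  obtain B where B: "B \<subseteq> V" "seqs.independent B" "V \<subseteq> seqs.span B"
    using seqs.basis_exists by metis
  obtain g where g: "lin g" "\<forall>x\<in>B. g x = f x"
    using seqs_pair.linear_independent_extend[OF B(2)] by blast
  have "seqs.subspace {x \<in> V. g x = f x}"
    using assms g(1) lin_on_0[OF assms]
    unfolding seqs.subspace_def linear_map_on_def by (auto simp: lin_simps)
  then have "seqs.span B \<subseteq> {x \<in> V. g x = f x}" using B(1) g(2) by (intro seqs.span_minimal) auto
  then show ?thesis using g(1) B(3) by blast
qed

section \<open>Dimensions, complements and projections\<close>

lemma dim_lin_image:
  assumes "lin g" "seqs.subspace U" "inj_on g U"
  shows "seqs.dim (g ` U) = seqs.dim U"
proof -
  obtain B where B: "B \<subseteq> U" "seqs.independent B" "U \<subseteq> seqs.span B" "card B = seqs.dim U"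
    using seqs.basis_exists by metis
  have U: "seqs.span B = U" using B assms(2) seqs.span_minimal[of B U] by blast
  have "seqs.independent (g ` B)"
    using seqs_pair.linear_independent_injective_image assms(1,3) B(2) U by blast
  moreover have "g ` U = seqs.span (g ` B)" using seqs_pair.linear_span_image[OF assms(1)] U by metis
  moreover have "card (g ` B) = card B" using assms(3) B(1) by (meson card_image inj_on_subset)
  ultimately show ?thesis using B(4) by (simp add: seqs.dim_eq_card_independent)
qed

lemma dim_lin_on_image:
  assumes "linear_map_on V W f" "seqs.subspace V" "inj_on f V"
  shows "seqs.dim (f ` V) = seqs.dim V"
proof -
  obtain g where g: "lin g" "\<forall>x\<in>V. g x = f x" using lin_on_extend assms by blast
  have "f ` V = g ` V" using g(2) by auto
  moreover have "inj_on g V" using g(2) assms(3) by (simp add: inj_on_def)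
  ultimately show ?thesis using dim_lin_image[OF g(1) assms(2)] by simp
qed

text \<open>Bases of \<open>A\<close> and \<open>C\<close> are jointly independent because the two
  spaces meet in 0. They extend to a basis \<open>D\<close> of \<open>B\<close>, and
  \<open>H\<close> is spanned by the members of \<open>D\<close> outside the basis of
  \<open>A\<close>. Prescribing a part \<open>C\<close> of the complement later makes families of
  complements stable under the arrows.\<close>

lemma complement_over:
  assumes "seqs.subspace A" "seqs.subspace B" "seqs.subspace C" "A \<subseteq> B" "C \<subseteq> B" "A \<inter> C = {0}"
  shows "\<exists>H. seqs.subspace H \<and> C \<subseteq> H \<and> H \<subseteq> B \<and> A \<inter> H = {0} \<and> (\<forall>b\<in>B. \<exists>a\<in>A. \<exists>h\<in>H. b = a + h)"
proof -
  obtain BA where BA: "BA \<subseteq> A" "seqs.independent BA" "A \<subseteq> seqs.span BA"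
    using seqs.basis_exists by metis
  have spA: "seqs.span BA = A" using BA assms(1) seqs.span_minimal[of BA A] by blast
  obtain BC where BC: "BC \<subseteq> C" "seqs.independent BC" "C \<subseteq> seqs.span BC"
    using seqs.basis_exists by metis
  have spC: "seqs.span BC = C" using BC assms(3) seqs.span_minimal[of BC C] by blast
  obtain g where g: "lin g" "\<forall>x\<in>BA. g x = x" using seqs_pair.linear_independent_extend[OF BA(2), of "\<lambda>x. x"] by blast
  have ind: "seqs.independent (BA \<union> BC)"
  proof (rule ccontr)
    assume "\<not> ?thesis"
    then obtain t u where t: "finite t" "t \<subseteq> BA \<union> BC" "(\<Sum>v\<in>t. fscale (u v) v) = 0" "\<exists>v\<in>t. u v \<noteq> 0"
      unfolding seqs.dependent_explicit by blast
    have dis: "(t \<inter> BA) \<inter> (t - BA) = {}" by blast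
    have "(\<Sum>v\<in>t \<inter> BA. fscale (u v) v) + (\<Sum>v\<in>t - BA. fscale (u v) v) = 0"
      using t(1,3) by (subst sum.union_disjoint[symmetric]) (auto simp: Int_Diff_Un)
    then have eq: "(\<Sum>v\<in>t \<inter> BA. fscale (u v) v) = - (\<Sum>v\<in>t - BA. fscale (u v) v)"
      by (simp add: eq_neg_iff_add_eq_0)
    have inA: "(\<Sum>v\<in>t \<inter> BA. fscale (u v) v) \<in> A"
      using BA(1) assms(1) by (intro seqs.subspace_sum seqs.subspace_scale) auto
    have inC: "(\<Sum>v\<in>t - BA. fscale (u v) v) \<in> C"
      using BC(1) t(2) assms(3) by (intro seqs.subspace_sum seqs.subspace_scale) auto
    have z1: "(\<Sum>v\<in>t \<inter> BA. fscale (u v) v) = 0"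
      using inA inC eq assms(3,6) seqs.subspace_neg[OF assms(3) inC] by (metis IntI singletonD)
    then have z2: "(\<Sum>v\<in>t - BA. fscale (u v) v) = 0" using eq by simp
    have "\<forall>v\<in>t \<inter> BA. u v = 0" "\<forall>v\<in>t - BA. u v = 0"
      using seqs.independentD[OF BA(2) _ _ z1] seqs.independentD[OF BC(2) _ _ z2] t(1,2) by auto
    then show False using t(4) by blast
  qed
  obtain D where D: "BA \<union> BC \<subseteq> D" "D \<subseteq> B" "seqs.independent D" "B \<subseteq> seqs.span D"
  proof -
    have "BA \<union> BC \<subseteq> B" using BA(1) BC(1) assms(4,5) by blast
    from seqs.maximal_independent_subset_extend[OF this ind] that show ?thesis by blast
  qed
  let ?H = "seqs.span (D - BA)"
  \<comment> \<open>A coordinate projection that is the identity on \<open>A\<close> and zero on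
    \<open>?H\<close>; it shows that they meet only in 0.\<close>
  obtain p where p: "lin p" "\<forall>x\<in>D. p x = (if x \<in> BA then x else 0)"
    using seqs_pair.linear_independent_extend[OF D(3), of "\<lambda>x. if x \<in> BA then x else 0"] by blast
  have pA: "p x = x" if "x \<in> A" for x
    by (rule seqs_pair.linear_eq_on[OF p(1) lin_ident, of x BA]) (use that spA p(2) D(1) in auto)
  have pH: "p x = 0" if "x \<in> ?H" for x
    by (rule seqs_pair.linear_eq_0_on_span[OF p(1) _ that]) (use p(2) in auto)
  have "BC \<inter> BA = {}"
  proof -
    have "x \<noteq> 0" if "x \<in> BA" for x using that BA(2) seqs.dependent_zero by metis
    then show ?thesis using BA(1) BC(1) assms(6) by blast
  qed
  then have "C \<subseteq> ?H" using spC D(1) by (metis Diff_mono Diff_triv Un_subset_iff order_refl seqs.span_mono)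
  moreover have "?H \<subseteq> B" using D(2) assms(2) by (intro seqs.span_minimal) auto
  moreover have "A \<inter> ?H = {0}" using pA pH assms(1) seqs.subspace_0 seqs.span_zero by fastforce
  moreover have "\<forall>b\<in>B. \<exists>a\<in>A. \<exists>h\<in>?H. b = a + h"
  proof
    fix b assume "b \<in> B"
    moreover have "D = BA \<union> (D - BA)" using D(1) by blast
    ultimately have "b \<in> seqs.span (BA \<union> (D - BA))" using D(4) by auto
    then show "\<exists>a\<in>A. \<exists>h\<in>?H. b = a + h" unfolding seqs.span_Un spA by blast
  qed
  ultimately show ?thesis using seqs.subspace_span by blast
qed

lemma complement_exists:
  assumes "seqs.subspace A" "seqs.subspace B" "A \<subseteq> B"
  shows "\<exists>H. seqs.subspace H \<and> H \<subseteq> B \<and> A \<inter> H = {0} \<and> (\<forall>b\<in>B. \<exists>a\<in>A. \<exists>h\<in>H. b = a + h)"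
proof -
  have "{0} \<subseteq> B" "A \<inter> {0} = {0}" using assms seqs.subspace_0 by blast+
  then show ?thesis using complement_over[OF assms(1,2) seqs.subspace_single_0 assms(3)] by blast
qed

text \<open>A complement of \<open>A\<close> containing \<open>B\<close> is taken in the whole
  sequence space, so that the projection along it is linear everywhere.\<close>

lemma projection_exists:
  assumes "seqs.subspace A" "seqs.subspace B" "A \<inter> B = {0}"
  shows "\<exists>p. lin p \<and> (\<forall>a\<in>A. p a = a) \<and> (\<forall>b\<in>B. p b = 0)"
proof -
  obtain H where H: "seqs.subspace H" "B \<subseteq> H" "A \<inter> H = {0}" "\<forall>b. \<exists>a\<in>A. \<exists>h\<in>H. b = a + h"
    using complement_over[OF assms(1) seqs.subspace_UNIV assms(2) _ _ assms(3)] by auto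
  have uniq: "a = a'" if "a + h = a' + h'" "a \<in> A" "a' \<in> A" "h \<in> H" "h' \<in> H" for a a' h h'
  proof -
    have "a - a' = h' - h" using that(1) by (simp add: algebra_simps)
    moreover have "a - a' \<in> A" "h' - h \<in> H" using that assms(1) H(1) by (auto intro: seqs.subspace_diff)
    ultimately have "a - a' \<in> A \<inter> H" by simp
    then show ?thesis using H(3) by simp
  qed
  obtain p where p: "\<And>x. p x \<in> A \<and> (\<exists>h\<in>H. x = p x + h)" using H(4) by metis
  then obtain q where q: "\<And>x. q x \<in> H" "\<And>x. x = p x + q x" by metis
  have pI: "p x = a" if "x = a + h" "a \<in> A" "h \<in> H" for x a h
    using uniq[of "p x" "q x" a h] p q that by metis
  have "lin p"
  proof (rule linI)
    fix x y
    have "x + y = (p x + p y) + (q x + q y)" by (metis (no_types) q(2) add.assoc add.left_commute)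
    then show "p (x + y) = p x + p y"
      using p q(1) assms(1) H(1) by (intro pI) (auto intro: seqs.subspace_add)
  next
    fix c x
    have "fscale c x = fscale c (p x) + fscale c (q x)" by (metis q(2) seqs.scale_right_distrib)
    then show "p (fscale c x) = fscale c (p x)"
      using p q(1) assms(1) H(1) by (intro pI) (auto intro: seqs.subspace_scale)
  qed
  moreover have "\<forall>a\<in>A. p a = a" using pI[of _ _ 0] seqs.subspace_0[OF H(1)] by simp
  moreover have "\<forall>b\<in>B. p b = 0" using pI[of _ 0] H(2) seqs.subspace_0[OF assms(1)] by auto
  ultimately show ?thesis by blast
qed

lemma dim_pos:
  assumes "seqs.subspace U" "findim U" "U \<noteq> {0}"
  shows "0 < seqs.dim U"
proof -
  have "{0} \<subset> U" using assms(1,3) seqs.subspace_0 by blast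
  then show ?thesis using dim_psubset_findim[OF seqs.subspace_single_0 assms(2)] by fastforce
qed

lemma dim_le_findim:
  assumes "seqs.subspace U" "findim W" "U \<subseteq> W"
  shows "seqs.dim U \<le> seqs.dim W"
  using dim_psubset_findim[OF assms(1,2)] assms(3) by (metis less_le psubsetI order_refl)

lemma dim_zero: "seqs.dim {0 :: 'k::field vec} = 0"
  using seqs.dim_le_card[of "{0}" "{}"] by simp

lemma dim_line: "v \<noteq> 0 \<Longrightarrow> seqs.dim (seqs.span {v}) = 1"
  using seqs.dim_span_eq_card_independent[of "{v}"] by simp

lemma span_insert_eq:
  assumes "seqs.subspace U"
  shows "seqs.span (insert w U) = {u + fscale c w |u c. u \<in> U}"
proof -
  have U: "seqs.span U = U" using assms by simp
  have "x = (x - fscale k w) + fscale k w" for x k by simp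
  then show ?thesis unfolding seqs.span_insert U by (metis (no_types, opaque_lifting) add_diff_cancel_right')
qed

lemma indep_sequence:
  assumes "\<And>l. l < m \<Longrightarrow> v l \<notin> seqs.span (v ` {..<l})"
  shows "seqs.dim (seqs.span (v ` {..<m})) = m"
proof -
  have "seqs.independent (v ` {..<m}) \<and> card (v ` {..<m}) = m"
    using assms
  proof (induction m)
    case (Suc m)
    then have v: "v m \<notin> seqs.span (v ` {..<m})" by simp
    have "v m \<notin> v ` {..<m}"
    proof
      assume "v m \<in> v ` {..<m}"
      from seqs.span_base[OF this] v show False by contradiction
    qed
    then show ?case using Suc v by (simp add: lessThan_Suc seqs.independent_insertI)
  qed (simp add: seqs.independent_empty)
  then show ?thesis by (simp add: seqs.dim_eq_card_independent)
qed

subsection \<open>Submodules and homomorphisms\<close>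

lemma subrep_simps [simp]:
  "vspace (subrep M U) = U" "act (subrep M U) = act M" "subrep (subrep M U) W = subrep M W"
  by (simp_all add: subrep_def)

lemma submoduleI:
  assumes "\<And>i. seqs.subspace (U i)" "\<And>i. U i \<subseteq> vspace M i"
    "\<And>a x. x \<in> U (source a) \<Longrightarrow> act M a x \<in> U (target a)"
  shows "U \<in> submodules M"
  using assms unfolding submodules_def le_fun_def by blast

lemma sub_subspace: "U \<in> submodules M \<Longrightarrow> seqs.subspace (U i)"
  unfolding submodules_def by blast

lemma sub_le: "U \<in> submodules M \<Longrightarrow> U i \<subseteq> vspace M i"
  unfolding submodules_def le_fun_def by blast

lemma sub_act: "U \<in> submodules M \<Longrightarrow> x \<in> U (source a) \<Longrightarrow> act M a x \<in> U (target a)"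
  unfolding submodules_def by blast

lemma rep_subspace: "quiver_rep M \<Longrightarrow> seqs.subspace (vspace M i)"
  unfolding quiver_rep_def by blast

lemma rep_findim: "quiver_rep M \<Longrightarrow> findim (vspace M i)"
  unfolding quiver_rep_def by blast

lemma rep_lin: "quiver_rep M \<Longrightarrow> linear_map_on (vspace M (source a)) (vspace M (target a)) (act M a)"
  unfolding quiver_rep_def by blast

lemma rep_act: "quiver_rep M \<Longrightarrow> x \<in> vspace M (source a) \<Longrightarrow> act M a x \<in> vspace M (target a)"
  using rep_lin lin_on_mem by blast

lemma rep_act_0: "quiver_rep M \<Longrightarrow> act M a 0 = 0"
  using lin_on_0[OF rep_lin rep_subspace] by blast

lemma sub_findim: "quiver_rep M \<Longrightarrow> U \<in> submodules M \<Longrightarrow> findim (U i)"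
  by (rule findim_mono[OF rep_findim sub_le])

lemma sub_0: "U \<in> submodules M \<Longrightarrow> 0 \<in> U i"
  using sub_subspace seqs.subspace_0 by blast

lemma zero_sub_submodule: "quiver_rep M \<Longrightarrow> zero_sub \<in> submodules M"
  by (rule submoduleI) (auto simp: zero_sub_def rep_act_0 rep_subspace seqs.subspace_0)

lemma zero_sub_le: "U \<in> submodules M \<Longrightarrow> zero_sub \<le> U"
  unfolding zero_sub_def le_fun_def using sub_0 by blast

lemma not_zero_sub: "U \<in> submodules M \<Longrightarrow> U \<noteq> zero_sub \<longleftrightarrow> (\<exists>i. \<exists>x\<in>U i. x \<noteq> 0)"
proof -
  assume U: "U \<in> submodules M"
  have "U \<noteq> zero_sub \<longleftrightarrow> (\<exists>i. U i \<noteq> {0})" unfolding zero_sub_def fun_eq_iff by blast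
  moreover have "U i \<noteq> {0} \<longleftrightarrow> (\<exists>x\<in>U i. x \<noteq> 0)" for i using sub_0[OF U, of i] by blast
  ultimately show ?thesis by simp
qed

lemma rep_length_subrep: "quiver_rep M \<Longrightarrow> U \<in> submodules M \<Longrightarrow> rep_length (subrep M U) = total_dim U"
  using rep_length_eq_dim[OF quiver_rep_subrep] by (simp add: total_dim_def)

lemma total_dim_zero: "total_dim zero_sub = 0"
  unfolding total_dim_def zero_sub_def by (simp add: dim_zero)

text \<open>The summands are submodules of the ambient \<open>M\<close>, so that decompositions of
  different submodules \<open>U\<close> can be compared without passing through
  \<open>subrep\<close>.\<close>

definition splits ::
    "'k::field rep \<Rightarrow> (vertex \<Rightarrow> 'k vec set) \<Rightarrow> (vertex \<Rightarrow> 'k vec set) \<Rightarrow> (vertex \<Rightarrow> 'k vec set) \<Rightarrow> bool" where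
  "splits M U A B \<longleftrightarrow> A \<in> submodules M \<and> B \<in> submodules M \<and> A \<le> U \<and> B \<le> U \<and>
     (\<forall>i. \<forall>x. x \<in> A i \<longrightarrow> x \<in> B i \<longrightarrow> x = 0) \<and> (\<forall>i. \<forall>x\<in>U i. \<exists>a\<in>A i. \<exists>b\<in>B i. x = a + b)"

lemma splits_sym: "splits M U A B \<Longrightarrow> splits M U B A"
  unfolding splits_def by (metis add.commute)

lemma direct_sum_of_iff_splits:
  assumes "U \<in> submodules M"
  shows "direct_sum_of (subrep M U) A B \<longleftrightarrow> splits M U A B"
proof
  assume "direct_sum_of (subrep M U) A B"
  then show "splits M U A B"
    unfolding direct_sum_of_def splits_def submodules_sub[OF assms] by fastforce
next
  assume s: "splits M U A B"
  have "A i \<inter> B i = {0}" for i using s sub_0 unfolding splits_def by blast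
  moreover have "a + b \<in> U i" if "a \<in> A i" "b \<in> B i" for a b i
    using that s seqs.subspace_add[OF sub_subspace[OF assms]] unfolding splits_def le_fun_def by blast
  ultimately show "direct_sum_of (subrep M U) A B"
    using s unfolding direct_sum_of_def splits_def submodules_sub[OF assms] by fastforce
qed

lemma indecomposable_subrep_iff:
  assumes "quiver_rep M" "U \<in> submodules M"
  shows "indecomposable (subrep M U) \<longleftrightarrow>
    U \<noteq> zero_sub \<and> (\<forall>A B. splits M U A B \<longrightarrow> A = zero_sub \<or> B = zero_sub)"
  unfolding indecomposable_def using quiver_rep_subrep[OF assms] direct_sum_of_iff_splits[OF assms(2)]
  by auto

lemma subrep_space: "subrep M (vspace M) = M"
  by (simp add: subrep_def)

lemma indecomposable_iff:
  assumes "quiver_rep M"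
  shows "indecomposable M \<longleftrightarrow>
    vspace M \<noteq> zero_sub \<and> (\<forall>A B. splits M (vspace M) A B \<longrightarrow> A = zero_sub \<or> B = zero_sub)"
  using indecomposable_subrep_iff[OF assms space_in_submodules[OF assms]] by (simp add: subrep_space)

text \<open>Each component is linear on the whole sequence space. By \<open>lin_on_extend\<close>
  this loses no homomorphism, and a restriction to a submodule is literally the same
  function.\<close>

definition rep_hom :: "'k::field rep \<Rightarrow> 'k rep \<Rightarrow> (vertex \<Rightarrow> 'k vec \<Rightarrow> 'k vec) \<Rightarrow> bool" where
  "rep_hom X Y f \<longleftrightarrow> (\<forall>i. lin (f i) \<and> f i ` vspace X i \<subseteq> vspace Y i) \<and>
     (\<forall>a. \<forall>x\<in>vspace X (source a). f (target a) (act X a x) = act Y a (f (source a) x))"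

definition inj_sub :: "(vertex \<Rightarrow> 'k::field vec set) \<Rightarrow> (vertex \<Rightarrow> 'k vec \<Rightarrow> 'k vec) \<Rightarrow> bool" where
  "inj_sub U f \<longleftrightarrow> (\<forall>i. \<forall>x\<in>U i. f i x = 0 \<longrightarrow> x = 0)"

definition img :: "(vertex \<Rightarrow> 'k vec \<Rightarrow> 'k vec) \<Rightarrow> (vertex \<Rightarrow> 'k::field vec set) \<Rightarrow> vertex \<Rightarrow> 'k vec set" where
  "img f U = (\<lambda>i. f i ` U i)"

section \<open>Images and preimages of submodules, decompositions as pairs of homomorphisms\<close>

lemma hom_lin: "rep_hom X Y f \<Longrightarrow> lin (f i)"
  unfolding rep_hom_def by blast

lemma hom_mem: "rep_hom X Y f \<Longrightarrow> x \<in> vspace X i \<Longrightarrow> f i x \<in> vspace Y i"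
  unfolding rep_hom_def by blast

lemma hom_act: "rep_hom X Y f \<Longrightarrow> x \<in> vspace X (source a) \<Longrightarrow> f (target a) (act X a x) = act Y a (f (source a) x)"
  unfolding rep_hom_def by blast

lemma hom_restrict: "rep_hom (subrep X W) Y f \<Longrightarrow> U \<le> W \<Longrightarrow> rep_hom (subrep X U) Y f"
  unfolding rep_hom_def le_fun_def by simp blast

lemma hom_comp: "rep_hom X Y f \<Longrightarrow> rep_hom Y Z g \<Longrightarrow> rep_hom X Z (\<lambda>i. g i \<circ> f i)"
  unfolding rep_hom_def using Vector_Spaces.linear_compose by (fastforce simp: image_subset_iff)

lemma hom_id: "rep_hom X X (\<lambda>i x. x)"
  unfolding rep_hom_def using lin_ident by simp

lemma img_submodule:
  assumes "rep_hom X Y f" "U \<in> submodules X"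
  shows "img f U \<in> submodules Y"
proof (rule submoduleI)
  show "seqs.subspace (img f U i)" for i
    unfolding img_def by (rule seqs_pair.linear_subspace_image[OF hom_lin[OF assms(1)] sub_subspace[OF assms(2)]])
  show "img f U i \<subseteq> vspace Y i" for i
    unfolding img_def using hom_mem[OF assms(1)] sub_le[OF assms(2)] by blast
  fix a y assume "y \<in> img f U (source a)"
  then obtain x where x: "x \<in> U (source a)" "y = f (source a) x" unfolding img_def by blast
  then have "act Y a y = f (target a) (act X a x)"
    using hom_act[OF assms(1)] sub_le[OF assms(2)] by fastforce
  then show "act Y a y \<in> img f U (target a)"
    unfolding img_def using sub_act[OF assms(2) x(1)] by blast
qed

lemma preimage_submodule:
  assumes "quiver_rep X" "rep_hom X Y f" "W \<in> submodules Y"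
  shows "(\<lambda>i. {x \<in> vspace X i. f i x \<in> W i}) \<in> submodules X"
proof (rule submoduleI)
  show "seqs.subspace {x \<in> vspace X i. f i x \<in> W i}" for i
    using sub_subspace[OF assms(3), of i] rep_subspace[OF assms(1), of i]
    unfolding seqs.subspace_def by (auto simp: lin_simps[OF hom_lin[OF assms(2)]])
qed (use hom_act[OF assms(2)] sub_act[OF assms(3)] rep_act[OF assms(1)] in auto)

lemma inj_sub_inj_on:
  assumes "rep_hom (subrep X U) Y f" "U \<in> submodules X" "inj_sub U f"
  shows "inj_on (f i) (U i)"
proof (rule inj_onI)
  fix x y assume xy: "x \<in> U i" "y \<in> U i" "f i x = f i y"
  then have "f i (x - y) = 0" by (simp add: lin_simps[OF hom_lin[OF assms(1)]])
  moreover have "x - y \<in> U i" using xy sub_subspace[OF assms(2)] by (simp add: seqs.subspace_diff)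
  ultimately show "x = y" using assms(3) unfolding inj_sub_def by fastforce
qed

lemma total_dim_img:
  assumes "rep_hom (subrep X U) Y f" "U \<in> submodules X" "inj_sub U f"
  shows "total_dim (img f U) = total_dim U"
  using dim_lin_image[OF hom_lin[OF assms(1)] sub_subspace[OF assms(2)] inj_sub_inj_on[OF assms]]
  unfolding total_dim_def img_def by simp

text \<open>The preimages in \<open>U\<close> of two complementary summands of the image are
  complementary, by injectivity.\<close>

lemma indecomposable_img:
  assumes X: "quiver_rep X" and Y: "quiver_rep Y" and U: "U \<in> submodules X"
    and f: "rep_hom (subrep X U) Y f" "inj_sub U f" and ind: "indecomposable (subrep X U)"
  shows "indecomposable (subrep Y (img f U))"
proof -
  have U': "U \<in> submodules (subrep X U)" using U by (simp add: submodules_sub)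
  have fU: "img f U \<in> submodules Y" by (rule img_submodule[OF f(1) U'])
  have nz: "U \<noteq> zero_sub" using ind indecomposable_subrep_iff[OF X U] by blast
  then obtain i x where x: "x \<in> U i" "x \<noteq> 0" using not_zero_sub[OF U] by blast
  then have "f i x \<in> img f U i" "f i x \<noteq> 0" using f(2) unfolding img_def inj_sub_def by blast+
  then have nz': "img f U \<noteq> zero_sub" using not_zero_sub[OF fU] by blast
  have "A = zero_sub \<or> B = zero_sub" if s: "splits Y (img f U) A B" for A B
  proof -
    let ?A = "\<lambda>i. {x \<in> U i. f i x \<in> A i}" and ?B = "\<lambda>i. {x \<in> U i. f i x \<in> B i}"
    have AB: "A \<in> submodules Y" "B \<in> submodules Y" "A \<le> img f U" "B \<le> img f U"
      using s unfolding splits_def by auto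
    have sub: "?A \<in> submodules X" "?B \<in> submodules X"
      using preimage_submodule[OF quiver_rep_subrep[OF X U] f(1) AB(1)]
        preimage_submodule[OF quiver_rep_subrep[OF X U] f(1) AB(2)] submodules_sub[OF U] by auto
    have "splits X U ?A ?B"
      unfolding splits_def
    proof (intro conjI allI impI ballI sub)
      fix i x assume "x \<in> ?A i" "x \<in> ?B i"
      then show "x = 0" using s f(2) unfolding splits_def inj_sub_def by blast
    next
      fix i x assume x: "x \<in> U i"
      then have "f i x \<in> img f U i" unfolding img_def by blast
      then obtain a b where ab: "a \<in> A i" "b \<in> B i" "f i x = a + b"
        using s unfolding splits_def by blast
      obtain a' b' where a': "a' \<in> U i" "a = f i a'" and b': "b' \<in> U i" "b = f i b'"
        using ab(1,2) AB(3,4) unfolding le_fun_def img_def by blast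
      have "f i x = f i (a' + b')" using ab(3) a' b' by (simp add: lin_simps[OF hom_lin[OF f(1)]])
      moreover have "a' + b' \<in> U i" using a' b' sub_subspace[OF U] by (simp add: seqs.subspace_add)
      ultimately have "x = a' + b'" using inj_sub_inj_on[OF f(1) U f(2), of i] x by (meson inj_onD)
      then show "\<exists>a\<in>?A i. \<exists>b\<in>?B i. x = a + b" using a' b' ab by blast
    qed (auto simp: le_fun_def)
    then have "?A = zero_sub \<or> ?B = zero_sub" using ind indecomposable_subrep_iff[OF X U] by blast
    moreover have "A = zero_sub" if z: "(\<lambda>i. {x \<in> U i. f i x \<in> A i}) = zero_sub" "A \<in> submodules Y" "A \<le> img f U" for A
    proof (rule ccontr)
      assume "A \<noteq> zero_sub"
      then obtain i y where y: "y \<in> A i" "y \<noteq> 0" using not_zero_sub[OF z(2)] by blast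
      then obtain x where "x \<in> U i" "y = f i x" using z(3) unfolding le_fun_def img_def by blast
      then have "x \<in> {x \<in> U i. f i x \<in> A i}" "x \<noteq> 0" using y by (auto simp: lin_simps[OF hom_lin[OF f(1)]])
      moreover have "{x \<in> U i. f i x \<in> A i} = {0}" using z(1) unfolding zero_sub_def by (rule fun_cong)
      ultimately show False by blast
    qed
    ultimately show ?thesis using AB by blast
  qed
  then show ?thesis using indecomposable_subrep_iff[OF Y fU] nz' by blast
qed

text \<open>Turns a decomposition into maps that can be composed with a given homomorphism. The
  formula \<open>x = p i x + q i x\<close> makes the two composites jointly injective wherever the
  given map is injective, while their images become smaller.\<close>

lemma splits_projections:
  assumes Yr: "quiver_rep Y" and C: "C \<in> submodules Y" and s: "splits Y C A B"
  shows "\<exists>p q. rep_hom (subrep Y C) Y p \<and> rep_hom (subrep Y C) Y q \<and>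
    (\<forall>i. \<forall>x\<in>C i. x = p i x + q i x) \<and> img p C = A \<and> img q C = B"
proof -
  have ex: "\<exists>p. rep_hom (subrep Y C) Y p \<and> (\<forall>i. \<forall>a\<in>A i. p i a = a) \<and> (\<forall>i. \<forall>b\<in>B i. p i b = 0) \<and> img p C = A"
    if s: "splits Y C A B" for A B
  proof -
    have AB: "A \<in> submodules Y" "B \<in> submodules Y" "A \<le> C" "B \<le> C"
      "\<And>i. A i \<inter> B i = {0}" "\<And>i x. x \<in> C i \<Longrightarrow> \<exists>a\<in>A i. \<exists>b\<in>B i. x = a + b"
      using s sub_0 unfolding splits_def by blast+
    have "\<forall>i. \<exists>p. lin p \<and> (\<forall>a\<in>A i. p a = a) \<and> (\<forall>b\<in>B i. p b = 0)"
      using projection_exists[OF sub_subspace[OF AB(1)] sub_subspace[OF AB(2)] AB(5)] by blast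
    then obtain p where p: "\<And>i. lin (p i)" "\<And>i a. a \<in> A i \<Longrightarrow> p i a = a" "\<And>i b. b \<in> B i \<Longrightarrow> p i b = 0"
      by metis
    have pI: "p i (a + b) = a" if "a \<in> A i" "b \<in> B i" for i a b
      using that p(2,3) by (simp add: lin_simps[OF p(1)])
    have mem: "p i x \<in> A i" if "x \<in> C i" for i x using AB(6)[OF that] pI by auto
    have "rep_hom (subrep Y C) Y p"
      unfolding rep_hom_def
    proof (intro conjI allI ballI)
      fix i show "p i ` vspace (subrep Y C) i \<subseteq> vspace Y i" using mem sub_le[OF AB(1)] by auto
    next
      fix a x assume "x \<in> vspace (subrep Y C) (source a)"
      then have xC: "x \<in> C (source a)" by simp
      then obtain u v where uv: "u \<in> A (source a)" "v \<in> B (source a)" "x = u + v" using AB(6) by blast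
      show "p (target a) (act (subrep Y C) a x) = act Y a (p (source a) x)"
        using uv(3) pI[OF uv(1,2)] pI[OF sub_act[OF AB(1) uv(1)] sub_act[OF AB(2) uv(2)]]
          lin_on_add[OF rep_lin[OF Yr]] uv(1,2) AB(1,2) sub_le[of _ Y] by (metis subrep_simps(2) subsetD)
    qed (rule p(1))
    moreover have "img p C = A"
    proof (rule ext, rule set_eqI)
      fix i x show "x \<in> img p C i \<longleftrightarrow> x \<in> A i"
        using mem[of _ i] p(2)[of x i] AB(3) unfolding img_def le_fun_def by (metis image_iff subsetD)
    qed
    ultimately show ?thesis using p by blast
  qed
  obtain p where p: "rep_hom (subrep Y C) Y p" "\<forall>i. \<forall>a\<in>A i. p i a = a" "\<forall>i. \<forall>b\<in>B i. p i b = 0" "img p C = A"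
    using ex[OF s] by blast
  obtain q where q: "rep_hom (subrep Y C) Y q" "\<forall>i. \<forall>b\<in>B i. q i b = b" "\<forall>i. \<forall>a\<in>A i. q i a = 0" "img q C = B"
    using ex[OF splits_sym[OF s]] by blast
  have "x = p i x + q i x" if x: "x \<in> C i" for i x
  proof -
    obtain a b where "a \<in> A i" "b \<in> B i" "x = a + b" using s x unfolding splits_def by blast
    then show ?thesis using p q by (simp add: lin_simps[OF hom_lin[OF p(1)]] lin_simps[OF hom_lin[OF q(1)]])
  qed
  then show ?thesis using p q by blast
qed

lemma splits_total_dim:
  assumes "quiver_rep Y" "C \<in> submodules Y" "splits Y C A B" "B \<noteq> zero_sub"
  shows "total_dim A < total_dim C"
proof -
  have AB: "A \<in> submodules Y" "B \<in> submodules Y" "A \<le> C" "B \<le> C" using assms(3) unfolding splits_def by auto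
  have "A \<noteq> C"
  proof
    assume "A = C"
    obtain i x where x: "x \<in> B i" "x \<noteq> 0" using assms(4) not_zero_sub[OF AB(2)] by blast
    then have "x \<in> A i" using \<open>A = C\<close> AB(4) unfolding le_fun_def by blast
    then show False using x assms(3) unfolding splits_def by blast
  qed
  then show ?thesis using total_dim_mono[OF assms(1) AB(1) assms(2)] AB(3) by simp
qed

text \<open>Rank-nullity at each vertex: a complement of the kernel has the same image and is mapped
  injectively, and at some vertex it is proper.\<close>

lemma total_dim_img_less:
  assumes X: "quiver_rep X" and U: "U \<in> submodules X" and f: "rep_hom (subrep X U) Y f" "\<not> inj_sub U f"
  shows "total_dim (img f U) < total_dim U"
proof -
  have le: "seqs.dim (f i ` U i) \<le> seqs.dim (U i) \<and>
      ((\<exists>x\<in>U i. x \<noteq> 0 \<and> f i x = 0) \<longrightarrow> seqs.dim (f i ` U i) < seqs.dim (U i))" for i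
  proof -
    let ?K = "{x \<in> U i. f i x = 0}"
    have l: "lin (f i)" by (rule hom_lin[OF f(1)])
    have Us: "seqs.subspace (U i)" by (rule sub_subspace[OF U])
    have fd: "findim (U i)" by (rule sub_findim[OF X U])
    have K: "seqs.subspace ?K" using Us unfolding seqs.subspace_def by (auto simp: lin_simps[OF l])
    obtain H where H: "seqs.subspace H" "H \<subseteq> U i" "?K \<inter> H = {0}" "\<forall>x\<in>U i. \<exists>k\<in>?K. \<exists>h\<in>H. x = k + h"
      using complement_exists[OF K Us] by blast
    have "f i ` U i \<subseteq> f i ` H"
    proof
      fix y assume "y \<in> f i ` U i"
      then obtain x where "x \<in> U i" "y = f i x" by blast
      moreover from this obtain k h where "k \<in> ?K" "h \<in> H" "x = k + h" using H(4) by blast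
      ultimately show "y \<in> f i ` H" by (simp add: lin_simps[OF l])
    qed
    then have eq: "f i ` U i = f i ` H" using H(2) by blast
    have "inj_on (f i) H"
    proof (rule inj_onI)
      fix x y assume xy: "x \<in> H" "y \<in> H" "f i x = f i y"
      then have "x - y \<in> H" using H(1) by (simp add: seqs.subspace_diff)
      moreover from this have "x - y \<in> ?K" using xy H(2) by (auto simp: lin_simps[OF l])
      ultimately have "x - y \<in> {0}" using H(3) by blast
      then show "x = y" by simp
    qed
    then have d: "seqs.dim (f i ` U i) = seqs.dim H" using eq dim_lin_image[OF l H(1)] by simp
    show ?thesis
    proof (intro conjI impI)
      show "seqs.dim (f i ` U i) \<le> seqs.dim (U i)" using d dim_le_findim[OF H(1) fd H(2)] by simp
      assume "\<exists>x\<in>U i. x \<noteq> 0 \<and> f i x = 0"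
      then have "H \<subset> U i" using H(2,3) by blast
      then show "seqs.dim (f i ` U i) < seqs.dim (U i)" using d dim_psubset_findim[OF H(1) fd] by simp
    qed
  qed
  obtain i where "\<exists>x\<in>U i. x \<noteq> 0 \<and> f i x = 0" using f(2) unfolding inj_sub_def by blast
  then have "seqs.dim (f i ` U i) < seqs.dim (U i)" using le by blast
  then show ?thesis unfolding total_dim_def img_def using le[of V1] le[of V2] le[of V3]
    by (cases i) (auto intro: add_less_le_mono add_le_less_mono add_mono)
qed

subsection \<open>Chains of indecomposable submodules\<close>

text \<open>Starting with the zero submodule and the empty set, which contributes no length, gives
  inductions along a chain a trivial base case. Only the top of the chain and the set of its lengths
  are recorded.\<close>

inductive gr_chain :: "'k::field rep \<Rightarrow> (vertex \<Rightarrow> 'k vec set) \<Rightarrow> nat set \<Rightarrow> bool" for M where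
  gr_chain_nil: "gr_chain M zero_sub {}"
| gr_chain_step: "gr_chain M U I \<Longrightarrow> U < W \<Longrightarrow> W \<in> submodules M \<Longrightarrow> indecomposable (subrep M W) \<Longrightarrow>
    gr_chain M W (insert (total_dim W) I)"

lemma gr_chain_sub: "gr_chain M U I \<Longrightarrow> quiver_rep M \<Longrightarrow> U \<in> submodules M"
  by (induction rule: gr_chain.induct) (auto simp: zero_sub_submodule)

lemma gr_chain_le:
  assumes "gr_chain M U I" "quiver_rep M"
  shows "\<forall>i\<in>I. 0 < i \<and> i \<le> total_dim U"
  using assms
proof (induction rule: gr_chain.induct)
  case (gr_chain_step U I W)
  then have "total_dim U < total_dim W" using total_dim_mono gr_chain_sub by blast
  then show ?case using gr_chain_step by fastforce
qed auto

lemma gr_chain_inv: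
  assumes "gr_chain M W J" "quiver_rep M" "J \<noteq> {}"
  obtains U I where "gr_chain M U I" "U < W" "W \<in> submodules M" "indecomposable (subrep M W)"
    "J = insert (total_dim W) I" "\<forall>i\<in>I. i < total_dim W" "total_dim U < total_dim W"
  using assms(1)
proof (cases rule: gr_chain.cases)
  case (gr_chain_step U I)
  then have "total_dim U < total_dim W" using total_dim_mono gr_chain_sub assms(2) by blast
  then show ?thesis using that[of U I] gr_chain_step gr_chain_le[OF gr_chain_step(2) assms(2)] by fastforce
qed (use assms in auto)

text \<open>Lengths increase strictly along a chain, so cutting it off at the member of length
  \<open>i\<close> leaves exactly the lengths up to \<open>i\<close>.\<close>

lemma gr_chain_initial:
  assumes "gr_chain M U I" "quiver_rep M" "i \<in> I"
  shows "\<exists>V. gr_chain M V (I \<inter> {..i}) \<and> total_dim V = i \<and> indecomposable (subrep M V)"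
  using assms
proof (induction rule: gr_chain.induct)
  case (gr_chain_step U I W)
  then have "total_dim U < total_dim W" using total_dim_mono gr_chain_sub by blast
  then have less: "\<forall>i\<in>I. i < total_dim W" using gr_chain_le gr_chain_step by fastforce
  show ?case
  proof (cases "i = total_dim W")
    case True
    then have "insert (total_dim W) I \<inter> {..i} = insert (total_dim W) I" using less by auto
    then show ?thesis using gr_chain.gr_chain_step[OF gr_chain_step.hyps(1-4)] True gr_chain_step.hyps(4) by auto
  next
    case False
    then have "i \<in> I" "i < total_dim W" using gr_chain_step less by auto
    then have "insert (total_dim W) I \<inter> {..i} = I \<inter> {..i}" by auto
    then show ?thesis using gr_chain_step.IH gr_chain_step.prems \<open>i \<in> I\<close> by simp
  qed
qed auto

lemma gr_sets_iff:
  assumes M: "quiver_rep M"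
  shows "I \<in> gr_sets M \<longleftrightarrow> I \<noteq> {} \<and> (\<exists>U. gr_chain M U I)"
proof
  assume "I \<in> gr_sets M"
  then obtain Us where Us: "Us \<noteq> []" "sorted_wrt (<) Us"
      "\<forall>U\<in>set Us. U \<in> submodules M \<and> indecomposable (subrep M U)"
    and I: "I = (\<lambda>U. rep_length (subrep M U)) ` set Us"
    unfolding gr_sets_def by blast
  have "gr_chain M (last Us) ((\<lambda>U. rep_length (subrep M U)) ` set Us)"
    using Us
  proof (induction Us rule: rev_induct)
    case (snoc W Us)
    have W: "W \<in> submodules M" "indecomposable (subrep M W)" using snoc.prems by auto
    have len: "rep_length (subrep M W) = total_dim W" by (rule rep_length_subrep[OF M W(1)])
    show ?case
    proof (cases "Us = []")
      case True
      have "zero_sub < W" using W zero_sub_le[OF W(1)] indecomposable_subrep_iff[OF M W(1)] by (simp add: less_le) metis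
      then show ?thesis using gr_chain_step[OF gr_chain_nil _ W] len True by simp
    next
      case False
      then have "last Us < W" using snoc.prems(2) by (auto simp: sorted_wrt_append)
      moreover have "gr_chain M (last Us) ((\<lambda>U. rep_length (subrep M U)) ` set Us)"
        using snoc False by (auto simp: sorted_wrt_append)
      ultimately show ?thesis using gr_chain_step[OF _ _ W] len by simp
    qed
  qed simp
  then show "I \<noteq> {} \<and> (\<exists>U. gr_chain M U I)" using I Us(1) by auto
next
  assume "I \<noteq> {} \<and> (\<exists>U. gr_chain M U I)"
  then obtain U where ch: "gr_chain M U I" and ne: "I \<noteq> {}" by blast
  from ch have "I = {} \<and> U = zero_sub \<or> (\<exists>Us. Us \<noteq> [] \<and> sorted_wrt (<) Us \<and> last Us = U \<and>
      I = (\<lambda>U. rep_length (subrep M U)) ` set Us \<and> (\<forall>U\<in>set Us. U \<le> last Us) \<and>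
      (\<forall>U\<in>set Us. U \<in> submodules M \<and> indecomposable (subrep M U)))"
  proof (induction rule: gr_chain.induct)
    case (gr_chain_step U I W)
    have len: "rep_length (subrep M W) = total_dim W" by (rule rep_length_subrep[OF M gr_chain_step(3)])
    from gr_chain_step.IH show ?case
    proof
      assume "I = {} \<and> U = zero_sub"
      then show ?thesis using gr_chain_step len by (intro disjI2 exI[of _ "[W]"]) auto
    next
      assume "\<exists>Us. Us \<noteq> [] \<and> sorted_wrt (<) Us \<and> last Us = U \<and>
      I = (\<lambda>U. rep_length (subrep M U)) ` set Us \<and> (\<forall>U\<in>set Us. U \<le> last Us) \<and>
      (\<forall>U\<in>set Us. U \<in> submodules M \<and> indecomposable (subrep M U))"
      then obtain Us where Us: "Us \<noteq> []" "sorted_wrt (<) Us" "last Us = U"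
        "I = (\<lambda>U. rep_length (subrep M U)) ` set Us" "\<forall>U\<in>set Us. U \<le> last Us"
        "\<forall>U\<in>set Us. U \<in> submodules M \<and> indecomposable (subrep M U)" by blast
      then have "\<forall>V\<in>set Us. V < W" using gr_chain_step(2) by (metis order.strict_trans1)
      then show ?thesis using gr_chain_step Us len
        by (intro disjI2 exI[of _ "Us @ [W]"]) (auto simp: sorted_wrt_append)
    qed
  qed auto
  then show "I \<in> gr_sets M" using ne unfolding gr_sets_def by blast
qed

lemma gr_chain_img:
  assumes "gr_chain X U I" "quiver_rep X" "quiver_rep Y" "rep_hom (subrep X U) Y f" "inj_sub U f"
  shows "gr_chain Y (img f U) I"
  using assms
proof (induction rule: gr_chain.induct)
  case gr_chain_nil
  have "lin (f i)" for i using hom_lin[OF gr_chain_nil(3)] .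
  then have "img f zero_sub = zero_sub" unfolding img_def zero_sub_def using seqs_pair.linear_0 by fastforce
  then show ?case by (simp add: gr_chain.gr_chain_nil)
next
  case (gr_chain_step U I W)
  have U: "U \<in> submodules X" using gr_chain_sub gr_chain_step by blast
  have le: "U \<le> W" using gr_chain_step(2) by simp
  have fU: "rep_hom (subrep X U) Y f" "inj_sub U f"
    using hom_restrict[OF gr_chain_step.prems(3) le] gr_chain_step.prems(4) le
    unfolding inj_sub_def le_fun_def by blast+
  have imW: "img f W \<in> submodules Y"
    using img_submodule[OF gr_chain_step.prems(3)] gr_chain_step(3) by (simp add: submodules_sub)
  have dim: "total_dim (img f W) = total_dim W" "total_dim (img f U) = total_dim U"
    using total_dim_img gr_chain_step fU U by blast+
  moreover have "total_dim U < total_dim W" using total_dim_mono gr_chain_step U by blast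
  ultimately have "img f U \<noteq> img f W" by auto
  moreover have "img f U \<le> img f W" using le unfolding img_def le_fun_def by blast
  ultimately have "img f U < img f W" by simp
  then show ?case
    using gr_chain.gr_chain_step[OF gr_chain_step.IH[OF gr_chain_step.prems(1,2) fU] _ imW]
      indecomposable_img[OF gr_chain_step.prems(1,2) gr_chain_step(3) gr_chain_step.prems(3,4) gr_chain_step(4)]
      dim by simp
qed

subsection \<open>Gabriel's main property\<close>

text \<open>Induction along a chain. If neither map were injective, a map with smallest possible image
  among those that are injective on the previous member of the chain has an indecomposable image,
  which prolongs that part of the chain with a length that is too small.\<close>

lemma gr_chain_jointly_injective:
  assumes X: "quiver_rep X" and Y: "quiver_rep Y" and chain: "gr_chain X U I"
    and "rep_hom (subrep X U) Y g1" "rep_hom (subrep X U) Y g2"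
    and "\<And>i x. x \<in> U i \<Longrightarrow> g1 i x = 0 \<Longrightarrow> g2 i x = 0 \<Longrightarrow> x = 0"
    and "\<And>J y. J \<in> gr_sets Y \<Longrightarrow> y \<in> J \<Longrightarrow> y < total_dim U \<Longrightarrow> y \<notin> I \<Longrightarrow>
          \<forall>z<y. z \<in> J \<longleftrightarrow> z \<in> I \<Longrightarrow> False"
  shows "inj_sub U g1 \<or> inj_sub U g2"
  using chain assms(4-)
proof (induction arbitrary: g1 g2 rule: gr_chain.induct)
  case gr_chain_nil
  then show ?case by (simp add: inj_sub_def zero_sub_def)
next
  case (gr_chain_step U I W)
  note bound = gr_chain_step.prems(4)
  have U: "U \<in> submodules X" using gr_chain_sub gr_chain_step(1) X by blast
  have W: "W \<in> submodules X" by fact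
  have le: "U \<le> W" using gr_chain_step(2) by simp
  have dUW: "total_dim U < total_dim W" using total_dim_mono[OF X U W] gr_chain_step(2) by blast
  have lessI: "\<forall>i\<in>I. i \<le> total_dim U" using gr_chain_le[OF gr_chain_step(1) X] by blast
  have W': "W \<in> submodules (subrep X W)" using W by (simp add: submodules_sub)
  have IH: "inj_sub U h1 \<or> inj_sub U h2"
    if h: "rep_hom (subrep X W) Y h1" "rep_hom (subrep X W) Y h2"
      "\<And>i x. x \<in> U i \<Longrightarrow> h1 i x = 0 \<Longrightarrow> h2 i x = 0 \<Longrightarrow> x = 0" for h1 h2
  proof (rule gr_chain_step.IH[OF hom_restrict[OF h(1) le] hom_restrict[OF h(2) le] h(3)])
    fix J y assume J: "J \<in> gr_sets Y" "y \<in> J" "y < total_dim U" "y \<notin> I" "\<forall>z<y. z \<in> J \<longleftrightarrow> z \<in> I"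
    show False by (rule bound[OF J(1,2)]) (use J dUW in auto)
  qed
  show ?case
  proof (rule ccontr)
    assume "\<not> ?thesis"
    then have ni: "\<not> inj_sub W g1" "\<not> inj_sub W g2" by auto
    \<comment> \<open>Injectivity on \<open>U\<close> says nothing if \<open>U\<close> is zero;
      therefore a nonzero image is demanded separately.\<close>
    define P where "P g \<longleftrightarrow> rep_hom (subrep X W) Y g \<and> inj_sub U g \<and> \<not> inj_sub W g \<and> img g W \<noteq> zero_sub" for g
    have "\<exists>g. P g"
    proof (cases "U = zero_sub")
      case True
      obtain i x where x: "x \<in> W i" "x \<noteq> 0"
        using gr_chain_step(4) indecomposable_subrep_iff[OF X W] not_zero_sub[OF W] by blast
      then obtain g where g: "g \<in> {g1, g2}" "g i x \<noteq> 0" using gr_chain_step.prems(3) by blast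
      then have hg: "rep_hom (subrep X W) Y g" using gr_chain_step.prems by blast
      have "img g W \<noteq> zero_sub" using not_zero_sub[OF img_submodule[OF hg W']] g x unfolding img_def by blast
      moreover have "inj_sub U g" using True unfolding inj_sub_def zero_sub_def by blast
      ultimately show ?thesis using hg ni g unfolding P_def by blast
    next
      case False
      have "inj_sub U g1 \<or> inj_sub U g2"
        using IH[OF gr_chain_step.prems(1,2)] gr_chain_step.prems(3) le unfolding le_fun_def by blast
      then obtain g where g: "g \<in> {g1, g2}" "inj_sub U g" by blast
      then have hg: "rep_hom (subrep X W) Y g" using gr_chain_step.prems by blast
      obtain i x where x: "x \<in> U i" "x \<noteq> 0" using False not_zero_sub[OF U] by blast
      then have "g i x \<in> img g W i" "g i x \<noteq> 0" using g(2) le unfolding inj_sub_def img_def le_fun_def by blast+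
      then have "img g W \<noteq> zero_sub" using not_zero_sub[OF img_submodule[OF hg W']] by blast
      then show ?thesis using hg ni g unfolding P_def by blast
    qed
    then obtain g where g: "P g" and min: "\<And>h. P h \<Longrightarrow> total_dim (img g W) \<le> total_dim (img h W)"
      using ex_has_least_nat[of P _ "\<lambda>g. total_dim (img g W)"] by metis
    let ?C = "img g W"
    have hg: "rep_hom (subrep X W) Y g" "inj_sub U g" "\<not> inj_sub W g" "?C \<noteq> zero_sub"
      using g unfolding P_def by auto
    have C: "?C \<in> submodules Y" by (rule img_submodule[OF hg(1) W'])
    have indC: "indecomposable (subrep Y ?C)"
      unfolding indecomposable_subrep_iff[OF Y C]
    proof (intro conjI allI impI hg(4))
      fix A B assume s: "splits Y ?C A B"
      show "A = zero_sub \<or> B = zero_sub"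
      proof (rule ccontr)
        assume "\<not> ?thesis"
        then have nz: "A \<noteq> zero_sub" "B \<noteq> zero_sub" by auto
        obtain p q where pq: "rep_hom (subrep Y ?C) Y p" "rep_hom (subrep Y ?C) Y q"
          "\<And>i x. x \<in> ?C i \<Longrightarrow> x = p i x + q i x" "img p ?C = A" "img q ?C = B"
          using splits_projections[OF Y C s] by blast
        have hgC: "rep_hom (subrep X W) (subrep Y ?C) g"
          using hg(1) unfolding rep_hom_def img_def by auto
        let ?h1 = "\<lambda>i. p i \<circ> g i" and ?h2 = "\<lambda>i. q i \<circ> g i"
        have h: "rep_hom (subrep X W) Y ?h1" "rep_hom (subrep X W) Y ?h2"
          using hom_comp[OF hgC pq(1)] hom_comp[OF hgC pq(2)] .
        have "inj_sub U ?h1 \<or> inj_sub U ?h2"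
        proof (rule IH[OF h])
          fix i x assume x: "x \<in> U i" "?h1 i x = 0" "?h2 i x = 0"
          then have "g i x \<in> ?C i" using le unfolding img_def le_fun_def by blast
          then have "g i x = 0" using pq(3)[of "g i x" i] x by simp
          then show "x = 0" using hg(2) x unfolding inj_sub_def by blast
        qed
        \<comment> \<open>A composite with one projection that is still injective on
          \<open>U\<close> has the proper summand \<open>D\<close> as image, against the minimality
          of \<open>g\<close>.\<close>
        moreover have False if "inj_sub U (\<lambda>i. r i \<circ> g i)" "img r ?C = D" "splits Y ?C D E"
          "D \<noteq> zero_sub" "E \<noteq> zero_sub" "rep_hom (subrep Y ?C) Y r" for r D E
        proof -
          have im: "img (\<lambda>i. r i \<circ> g i) W = D" using that(2) unfolding img_def by (simp add: image_comp fun_eq_iff)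
          have "\<not> inj_sub W (\<lambda>i. r i \<circ> g i)"
            using hg(3) seqs_pair.linear_0[OF hom_lin[OF that(6)]] unfolding inj_sub_def o_def by metis
          then have "P (\<lambda>i. r i \<circ> g i)"
            unfolding P_def using that(1,4) im hom_comp[OF hgC that(6)] by simp
          then have "total_dim ?C \<le> total_dim D" using min im by metis
          then show False using splits_total_dim[OF Y C that(3,5)] by simp
        qed
        ultimately show False using nz pq(1,2,4,5) s splits_sym[OF s] by blast
      qed
    qed
    have gU: "img g U \<le> ?C" using le unfolding img_def le_fun_def by blast
    have chU: "gr_chain Y (img g U) I"
      by (rule gr_chain_img[OF gr_chain_step(1) X Y hom_restrict[OF hg(1) le] hg(2)])
    show False
    proof (cases "img g U = ?C")
      \<comment> \<open>If \<open>U\<close> already covers the image, the kernel of \<open>g\<close>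
        in \<open>W\<close> is a complement of \<open>U\<close>, although \<open>W\<close> is
        indecomposable.\<close>
      case True
      let ?K = "\<lambda>i. {x \<in> W i. g i x \<in> zero_sub i}"
      have K: "?K \<in> submodules X"
        using preimage_submodule[OF quiver_rep_subrep[OF X W] hg(1) zero_sub_submodule[OF Y]] submodules_sub[OF W]
        by auto
      have "splits X W U ?K"
        unfolding splits_def
      proof (intro conjI allI impI ballI U K le)
        fix i x assume "x \<in> U i" "x \<in> ?K i"
        then show "x = 0" using hg(2) unfolding inj_sub_def zero_sub_def by blast
      next
        fix i x assume x: "x \<in> W i"
        then have "g i x \<in> img g U i" unfolding True unfolding img_def by blast
        then obtain u where u: "u \<in> U i" "g i x = g i u" unfolding img_def by blast
        moreover have "u \<in> W i" using u(1) le unfolding le_fun_def by blast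
        ultimately have "x - u \<in> ?K i"
          using x seqs.subspace_diff[OF sub_subspace[OF W]]
          unfolding zero_sub_def by (auto simp: lin_simps[OF hom_lin[OF hg(1)]])
        moreover have "x = u + (x - u)" by simp
        ultimately show "\<exists>a\<in>U i. \<exists>b\<in>?K i. x = a + b" using u(1) by blast
      qed (auto simp: le_fun_def)
      then have "U = zero_sub \<or> ?K = zero_sub"
        using gr_chain_step(4) indecomposable_subrep_iff[OF X W] by blast
      moreover have "U \<noteq> zero_sub"
      proof
        assume "U = zero_sub"
        then have "img g U = zero_sub" unfolding img_def zero_sub_def
          by (auto simp: seqs_pair.linear_0[OF hom_lin[OF hg(1)]])
        then show False using True hg(4) by simp
      qed
      moreover have "?K \<noteq> zero_sub"
        unfolding not_zero_sub[OF K] using hg(3) unfolding inj_sub_def zero_sub_def by blast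
      ultimately show False by blast
    next
      case False
      then have less: "img g U < ?C" using gU by simp
      \<comment> \<open>The image lengthens the chain of \<open>img g U\<close>, and its length lies
        strictly between those of \<open>U\<close> and \<open>W\<close>. This is the situation that
        the last hypothesis forbids.\<close>
      let ?J = "insert (total_dim ?C) I"
      have J: "?J \<in> gr_sets Y" unfolding gr_sets_iff[OF Y] using gr_chain.gr_chain_step[OF chU less C indC] by blast
      have "total_dim (img g U) < total_dim ?C"
        using total_dim_mono[OF Y gr_chain_sub[OF chU Y] C less] .
      moreover have "total_dim (img g U) = total_dim U"
        by (rule total_dim_img[OF hom_restrict[OF hg(1) le] U hg(2)])
      ultimately have gt: "total_dim U < total_dim ?C" by simp
      have lt: "total_dim ?C < total_dim W" by (rule total_dim_img_less[OF X W hg(1,3)])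
      show False
        by (rule bound[OF J, of "total_dim ?C"]) (use gt lt lessI in fastforce)+
    qed
  qed
qed

text \<open>If no larger set existed, then among the endomorphisms of \<open>M\<close> that are
  injective on the copy of \<open>X\<close>, one with smallest image would have an indecomposable
  image, by \<open>gr_chain_jointly_injective\<close>. Either that image equals the image of
  \<open>X\<close>, and the kernel splits the embedding, or it prolongs the chain that ends in
  \<open>X\<close>, which gives a larger set after all.\<close>

theorem gr_less_of_nonsplit:
  assumes X: "quiver_rep X" "indecomposable X" and M: "quiver_rep M"
    and f: "rep_hom X M f" "inj_sub (vspace X) f"
    and nonsplit: "\<And>K. \<not> splits M (vspace M) (img f (vspace X)) K"
  shows "\<exists>J\<in>gr_sets M. gr_less (gabriel_roiter X) J"
proof (rule ccontr)
  assume no: "\<not> ?thesis"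
  let ?I = "gabriel_roiter X" and ?V = "vspace X" and ?W = "vspace M"
  have V: "?V \<in> submodules X" by (rule space_in_submodules[OF X(1)])
  have W: "?W \<in> submodules M" by (rule space_in_submodules[OF M])
  have nz: "?V \<noteq> zero_sub" using X(2) unfolding indecomposable_def by blast
  have I: "?I \<in> gr_sets X" "\<And>J. J \<in> gr_sets X \<Longrightarrow> \<not> gr_less ?I J"
    using gabriel_roiter_is_max[OF X(1) nz] gr_less_trans gr_less_irrefl by blast+
  obtain U where U: "gr_chain X U ?I" "?I \<noteq> {}" using I(1) gr_sets_iff[OF X(1)] by blast
  have chain_less: "gr_less I (insert d I)" if "\<forall>i\<in>I. i < d" for I d
    unfolding gr_less_iff using that by auto
  have sU: "U \<in> submodules X" by (rule gr_chain_sub[OF U(1) X(1)])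
  \<comment> \<open>A chain realising the maximum must end in \<open>X\<close> itself, since
    otherwise \<open>X\<close> could be appended.\<close>
  have "U = ?V"
  proof (rule ccontr)
    assume "U \<noteq> ?V"
    then have less: "U < ?V" using sU unfolding submodules_def by (auto simp: less_le)
    have "gr_chain X ?V (insert (total_dim ?V) ?I)"
      using gr_chain_step[OF U(1) less V] X(2) by (simp add: subrep_space)
    then have "insert (total_dim ?V) ?I \<in> gr_sets X" unfolding gr_sets_iff[OF X(1)] by blast
    moreover have "total_dim U < total_dim ?V" by (rule total_dim_mono[OF X(1) sU V less])
    then have "gr_less ?I (insert (total_dim ?V) ?I)"
      using gr_chain_le[OF U(1) X(1)] by (intro chain_less) auto
    ultimately show False using I(2) by blast
  qed
  then have chX: "gr_chain X ?V ?I" using U(1) by simp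
  define P where "P e \<longleftrightarrow> rep_hom M M e \<and> inj_sub ?V (\<lambda>i. e i \<circ> f i)" for e
  have "P (\<lambda>i x. x)" using hom_id f(2) unfolding P_def by (simp add: o_def)
  then obtain e where e: "P e" and min: "\<And>h. P h \<Longrightarrow> total_dim (img e ?W) \<le> total_dim (img h ?W)"
    using ex_has_least_nat[of P _ "\<lambda>g. total_dim (img g ?W)"] by metis
  have he: "rep_hom M M e" "inj_sub ?V (\<lambda>i. e i \<circ> f i)" using e unfolding P_def by auto
  let ?C = "img e ?W" and ?h = "\<lambda>i. e i \<circ> f i"
  have C: "?C \<in> submodules M" by (rule img_submodule[OF he(1) W])
  have hh: "rep_hom X M ?h" by (rule hom_comp[OF f(1) he(1)])
  have hC: "img ?h ?V \<le> ?C"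
    using hom_mem[OF f(1)] unfolding img_def le_fun_def by auto
  have imh: "img ?h ?V \<in> submodules M" by (rule img_submodule[OF hh V])
  have nzC: "?C \<noteq> zero_sub"
  proof -
    obtain i x where x: "x \<in> ?V i" "x \<noteq> 0" using nz not_zero_sub[OF V] by blast
    then have "?h i x \<noteq> 0" "?h i x \<in> ?C i" using he(2) hC unfolding inj_sub_def le_fun_def img_def by blast+
    then show ?thesis using not_zero_sub[OF C] by blast
  qed
  have heC: "rep_hom M (subrep M ?C) e" using he(1) unfolding rep_hom_def img_def by auto
  have indC: "indecomposable (subrep M ?C)"
    unfolding indecomposable_subrep_iff[OF M C]
  proof (intro conjI allI impI nzC)
    fix A B assume s: "splits M ?C A B"
    show "A = zero_sub \<or> B = zero_sub"
    proof (rule ccontr)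
      assume "\<not> ?thesis"
      then have nz: "A \<noteq> zero_sub" "B \<noteq> zero_sub" by auto
      obtain p q where pq: "rep_hom (subrep M ?C) M p" "rep_hom (subrep M ?C) M q"
        "\<And>i x. x \<in> ?C i \<Longrightarrow> x = p i x + q i x" "img p ?C = A" "img q ?C = B"
        using splits_projections[OF M C s] by blast
      have hhC: "rep_hom X (subrep M ?C) ?h" by (rule hom_comp[OF f(1) heC])
      have h: "rep_hom X M (\<lambda>i. p i \<circ> ?h i)" "rep_hom X M (\<lambda>i. q i \<circ> ?h i)"
        using hom_comp[OF hhC pq(1)] hom_comp[OF hhC pq(2)] .
      have "inj_sub ?V (\<lambda>i. p i \<circ> ?h i) \<or> inj_sub ?V (\<lambda>i. q i \<circ> ?h i)"
      proof (rule gr_chain_jointly_injective[OF X(1) M chX])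
        fix i x assume x: "x \<in> ?V i" "(p i \<circ> ?h i) x = 0" "(q i \<circ> ?h i) x = 0"
        then have "?h i x \<in> ?C i" using hC unfolding img_def le_fun_def by blast
        then have "?h i x = 0" using pq(3)[of "?h i x" i] x by simp
        then show "x = 0" using he(2) x unfolding inj_sub_def by blast
      next
        \<comment> \<open>Such a \<open>J\<close> has its first difference from the measure of
          \<open>X\<close> at \<open>y\<close>, so it would be larger.\<close>
        fix J y assume "J \<in> gr_sets M" "y \<in> J" "y \<notin> ?I" "\<forall>z<y. z \<in> J \<longleftrightarrow> z \<in> ?I"
        then show False using no unfolding gr_less_iff by blast
      qed (use h in \<open>simp_all add: subrep_space\<close>)
      moreover have False if "inj_sub ?V (\<lambda>i. r i \<circ> ?h i)" "img r ?C = D" "splits M ?C D E"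
        "E \<noteq> zero_sub" "rep_hom (subrep M ?C) M r" for r D E
      proof -
        have "(\<lambda>i. r i \<circ> ?h i) = (\<lambda>i. (r i \<circ> e i) \<circ> f i)" by (simp add: o_assoc)
        then have "P (\<lambda>i. r i \<circ> e i)"
          unfolding P_def using that(1) hom_comp[OF heC that(5)] by simp
        moreover have "img (\<lambda>i. r i \<circ> e i) ?W = D" using that(2) unfolding img_def by (simp add: image_comp fun_eq_iff)
        ultimately have "total_dim ?C \<le> total_dim D" using min by metis
        then show False using splits_total_dim[OF M C that(3,4)] by simp
      qed
      ultimately show False using nz pq(1,2,4,5) s splits_sym[OF s] by blast
    qed
  qed
  have chh: "gr_chain M (img ?h ?V) ?I"
    using gr_chain_img[OF chX X(1) M, of ?h] hh he(2) by (simp add: subrep_space)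
  show False
  proof (cases "img ?h ?V = ?C")
    case True
    \<comment> \<open>The kernel of \<open>e\<close>; it is complementary to the image of
      \<open>f\<close> because \<open>e\<close> maps that image isomorphically onto its own
      image.\<close>
    let ?K = "\<lambda>i. {x \<in> ?W i. e i x \<in> zero_sub i}"
    have K: "?K \<in> submodules M" by (rule preimage_submodule[OF M he(1) zero_sub_submodule[OF M]])
    have fV: "img f ?V \<in> submodules M" by (rule img_submodule[OF f(1) V])
    have "splits M ?W (img f ?V) ?K"
      unfolding splits_def
    proof (intro conjI allI impI ballI fV K)
      fix i x assume "x \<in> img f ?V i" "x \<in> ?K i"
      then obtain v where "v \<in> ?V i" "x = f i v" "e i (f i v) = 0" unfolding img_def zero_sub_def by blast
      moreover from this have "v = 0" using he(2) unfolding inj_sub_def by simp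
      ultimately show "x = 0" by (simp add: seqs_pair.linear_0[OF hom_lin[OF f(1)]])
    next
      fix i x assume x: "x \<in> ?W i"
      then have "e i x \<in> img ?h ?V i" unfolding True unfolding img_def by blast
      then obtain v where v: "v \<in> ?V i" "e i x = e i (f i v)" unfolding img_def by auto
      then have "x - f i v \<in> ?K i"
        using x hom_mem[OF f(1) v(1)] seqs.subspace_diff[OF rep_subspace[OF M]]
        unfolding zero_sub_def by (auto simp: lin_simps[OF hom_lin[OF he(1)]])
      moreover have "f i v \<in> img f ?V i" using v(1) unfolding img_def by blast
      moreover have "x = f i v + (x - f i v)" by simp
      ultimately show "\<exists>a\<in>img f ?V i. \<exists>b\<in>?K i. x = a + b" by blast
    next
      show "img f ?V \<le> ?W" using fV sub_le unfolding le_fun_def by blast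
    qed (auto simp: le_fun_def)
    then show False using nonsplit by blast
  next
    case False
    then have less: "img ?h ?V < ?C" using hC by simp
    have "insert (total_dim ?C) ?I \<in> gr_sets M"
      unfolding gr_sets_iff[OF M] using gr_chain_step[OF chh less C indC] by blast
    moreover have "gr_less ?I (insert (total_dim ?C) ?I)"
      using gr_chain_le[OF chh M] total_dim_mono[OF M imh C less] by (intro chain_less) auto
    ultimately show False using no by blast
  qed
qed

subsection \<open>The pencil of maps spanned by the two arrows\<close>

lemma lin_on_inj:
  assumes "linear_map_on V W f" "seqs.subspace V" "\<And>x. x \<in> V \<Longrightarrow> f x = 0 \<Longrightarrow> x = 0"
  shows "inj_on f V"
proof (rule inj_onI)
  fix x y assume xy: "x \<in> V" "y \<in> V" "f x = f y"
  then have "f (x - y) = 0" using lin_on_diff[OF assms(1,2)] by simp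
  then have "x - y = 0" using assms(3) xy seqs.subspace_diff[OF assms(2)] by blast
  then show "x = y" by simp
qed

lemma span_image_subset:
  assumes "linear_map_on V W f" "seqs.subspace V" "seqs.subspace R" "S \<subseteq> V" "\<And>x. x \<in> S \<Longrightarrow> f x \<in> R"
    and "x \<in> seqs.span S"
  shows "f x \<in> R"
proof -
  have "seqs.subspace {x \<in> V. f x \<in> R}"
    using assms(2,3) lin_on_0[OF assms(1,2)] assms(1)
    unfolding seqs.subspace_def linear_map_on_def by auto
  then have "seqs.span S \<subseteq> {x \<in> V. f x \<in> R}" using assms(4,5) by (intro seqs.span_minimal) auto
  then show ?thesis using assms(6) by blast
qed

text \<open>Homogeneous coordinates treat all points of the projective line of parameters alike,
  infinity included. The two arrows b1 and b2 are the members (1, 0) and (0, 1).\<close>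

definition pen :: "'k::field rep \<Rightarrow> 'k \<Rightarrow> 'k \<Rightarrow> 'k vec \<Rightarrow> 'k vec" where
  "pen M p q v = fscale p (act M A23 v) + fscale q (act M B23 v)"

lemma pen_subrep [simp]: "pen (subrep M U) = pen M"
  by (simp add: pen_def fun_eq_iff)

lemma pen_lin:
  assumes "quiver_rep M"
  shows "linear_map_on (vspace M V2) (vspace M V3) (pen M p q)"
  using rep_lin[OF assms, of A23] rep_lin[OF assms, of B23] rep_subspace[OF assms, of V3]
  unfolding linear_map_on_def pen_def
  by (auto simp: seqs.scale_right_distrib seqs.subspace_add seqs.subspace_scale mult.commute)

lemma sub_pen: "U \<in> submodules M \<Longrightarrow> x \<in> U V2 \<Longrightarrow> pen M p q x \<in> U V3"
  unfolding pen_def using sub_act[of U M x A23] sub_act[of U M x B23] sub_subspace[of U M V3]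
  by (simp add: seqs.subspace_add seqs.subspace_scale)

lemma sub_alpha: "U \<in> submodules M \<Longrightarrow> x \<in> U V1 \<Longrightarrow> act M A12 x \<in> U V2"
  using sub_act[of U M x A12] by simp

lemma pen_combine:
  "fscale a (pen M p q v) + fscale b (pen M r s v) = pen M (a * p + b * r) (a * q + b * s) v"
  unfolding pen_def by (simp add: seqs.scale_right_distrib seqs.scale_left_distrib algebra_simps)

lemma pen_change_basis:
  assumes "p * s \<noteq> q * r"
  shows "\<exists>a b. \<forall>M v. pen M c d v = fscale a (pen M p q v) + fscale b (pen M r s v)"
proof -
  let ?D = "p * s - q * r"
  have D: "?D \<noteq> 0" using assms by simp
  \<comment> \<open>Cramer's rule.\<close>
  let ?a = "(c * s - d * r) / ?D" and ?b = "(d * p - c * q) / ?D"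
  have "?a * p + ?b * r = (c * ?D) / ?D" "?a * q + ?b * s = (d * ?D) / ?D"
    by (simp_all add: add_divide_distrib[symmetric] algebra_simps)
  then have "?a * p + ?b * r = c" "?a * q + ?b * s = d" using D by simp_all
  then show ?thesis unfolding pen_combine by metis
qed

lemma act_eq_pen: "act M A23 v = pen M 1 0 v" "act M B23 v = pen M 0 1 v"
  unfolding pen_def by simp_all

lemma pen_mem:
  assumes "p * s \<noteq> q * r" "seqs.subspace R" "pen M p q v \<in> R" "pen M r s v \<in> R"
  shows "pen M c d v \<in> R"
  using pen_change_basis[OF assms(1), of c d] assms(2-4)
  by (metis seqs.subspace_add seqs.subspace_scale)

lemma submodule_penI:
  assumes "p * s \<noteq> q * r" "\<And>i. seqs.subspace (U i)" "\<And>i. U i \<subseteq> vspace M i"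
    "\<And>x. x \<in> U V1 \<Longrightarrow> act M A12 x \<in> U V2"
    "\<And>x. x \<in> U V2 \<Longrightarrow> pen M p q x \<in> U V3" "\<And>x. x \<in> U V2 \<Longrightarrow> pen M r s x \<in> U V3"
  shows "U \<in> submodules M"
proof (rule submoduleI[OF assms(2,3)])
  fix a x assume "x \<in> U (source a)"
  then show "act M a x \<in> U (target a)"
    using assms(4)[of x] pen_mem[OF assms(1,2) assms(5,6)[of x]]
    by (cases a) (auto simp: act_eq_pen)
qed

text \<open>Write g for \<open>pen M p q\<close> and d for \<open>pen M r s\<close>. Level
  \<open>i\<close> arises from 0 by applying \<open>i\<close> times the linear relation "preimage
  under g of the image under d"; it collects the end vectors of Jordan chains of length
  \<open>i\<close>. For bijective d it is the kernel of the \<open>i\<close>-th power of d^(-1)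
  g.\<close>

primrec kset :: "'k::field rep \<Rightarrow> 'k \<Rightarrow> 'k \<Rightarrow> 'k \<Rightarrow> 'k \<Rightarrow> nat \<Rightarrow> 'k vec set" where
  "kset M p q r s 0 = {0}"
| "kset M p q r s (Suc i) = {w \<in> vspace M V2. \<exists>u\<in>kset M p q r s i. pen M p q w = pen M r s u}"

lemma kset_subspace:
  assumes M: "quiver_rep M"
  shows "seqs.subspace (kset M p q r s i) \<and> kset M p q r s i \<subseteq> vspace M V2"
proof (induction i)
  case 0
  then show ?case using rep_subspace[OF M, of V2] by (simp add: seqs.subspace_0 seqs.subspace_single_0)
next
  case (Suc i)
  let ?K = "kset M p q r s i"
  have K: "seqs.subspace ?K" "?K \<subseteq> vspace M V2" using Suc by auto
  have V: "seqs.subspace (vspace M V2)" by (rule rep_subspace[OF M])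
  have "seqs.subspace (kset M p q r s (Suc i))"
    unfolding seqs.subspace_def
  proof (intro conjI ballI allI)
    show "0 \<in> kset M p q r s (Suc i)"
      using lin_on_0[OF pen_lin[OF M] V] seqs.subspace_0[OF V] seqs.subspace_0[OF K(1)] by auto
  next
    fix x y assume "x \<in> kset M p q r s (Suc i)" "y \<in> kset M p q r s (Suc i)"
    then obtain u w where x: "x \<in> vspace M V2" "u \<in> ?K" "pen M p q x = pen M r s u"
      and y: "y \<in> vspace M V2" "w \<in> ?K" "pen M p q y = pen M r s w" by auto
    have "pen M p q (x + y) = pen M r s (u + w)"
      using lin_on_add[OF pen_lin[OF M]] x y K(2) by (metis subsetD)
    then show "x + y \<in> kset M p q r s (Suc i)"
      using x y seqs.subspace_add[OF V] seqs.subspace_add[OF K(1)] by auto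
  next
    fix c x assume "x \<in> kset M p q r s (Suc i)"
    then obtain u where x: "x \<in> vspace M V2" "u \<in> ?K" "pen M p q x = pen M r s u" by auto
    have "pen M p q (fscale c x) = pen M r s (fscale c u)"
      using lin_on_scale[OF pen_lin[OF M]] x K(2) by (metis subsetD)
    then show "fscale c x \<in> kset M p q r s (Suc i)"
      using x seqs.subspace_scale[OF V] seqs.subspace_scale[OF K(1)] by auto
  qed
  then show ?case by auto
qed

lemma kset_Suc_mono: "quiver_rep M \<Longrightarrow> kset M p q r s i \<subseteq> kset M p q r s (Suc i)"
proof (induction i)
  case 0
  then show ?case using kset_subspace[of M p q r s "Suc 0"] seqs.subspace_0 by auto
qed auto

lemma kset_mono: "quiver_rep M \<Longrightarrow> i \<le> j \<Longrightarrow> kset M p q r s i \<subseteq> kset M p q r s j"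
  by (rule lift_Suc_mono_le[of "kset M p q r s"]) (auto dest: kset_Suc_mono simp del: kset.simps)

lemma kset_subrep:
  assumes "U \<in> submodules M"
  shows "kset (subrep M U) p q r s i \<subseteq> kset M p q r s i"
  by (induction i) (use sub_le[OF assms, of V2] in auto)

text \<open>Torsion-freeness: the two conditions say that there are no nonzero homomorphisms from the
  preinjective Kronecker modules of dimension vector \<open>(0, j + 1, j)\<close>, \<open>j \<le> n\<close>, respectively from
  the modules \<open>(1, j, j)\<close>, \<open>j \<le> n\<close>, that have a Gabriel-Roiter measure \<open>mu_set j\<close>.\<close>

definition mu_free :: "nat \<Rightarrow> 'k::field rep \<Rightarrow> bool" where
  "mu_free n M \<longleftrightarrow> (\<forall>p q r s. p * s \<noteq> q * r \<longrightarrow>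
     (\<forall>w\<in>kset M p q r s (Suc n). pen M r s w = 0 \<longrightarrow> w = 0) \<and>
     (\<forall>x\<in>vspace M V1. act M A12 x \<in> kset M p q r s n \<longrightarrow> x = 0))"

lemma mu_free_subrep: "mu_free n M \<Longrightarrow> U \<in> submodules M \<Longrightarrow> mu_free n (subrep M U)"
  unfolding mu_free_def using kset_subrep[of U M] sub_le[of U M V1] by (simp del: kset.simps) blast

subsection \<open>Modules spanned by Jordan chains\<close>

text \<open>Entries from \<open>m\<close> on are unconstrained, so a chain is continued by a
  function update at \<open>m\<close>. Linear independence is kept as a separate assumption.\<close>

definition jordan_seq ::
    "'k::field rep \<Rightarrow> 'k \<Rightarrow> 'k \<Rightarrow> 'k \<Rightarrow> 'k \<Rightarrow> (nat \<Rightarrow> 'k vec) \<Rightarrow> nat \<Rightarrow> bool" where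
  "jordan_seq M p q r s e m \<longleftrightarrow> (\<forall>l<m. e l \<in> vspace M V2) \<and> (0 < m \<longrightarrow> pen M p q (e 0) = 0) \<and>
     (\<forall>l. Suc l < m \<longrightarrow> pen M p q (e (Suc l)) = pen M r s (e l))"

text \<open>One shape for all modules needed. If the vectors are independent, zero \<open>T\<close>
  gives the regular module R[m] when d is injective on their span, and the preinjective Q_(m-1) when
  d kills just the last vector; a line \<open>T\<close> mapped onto a generator gives Z_m. Images
  under d suffice at \<open>V3\<close>, since g shifts the chain by one place
  (\<open>jordan_shift\<close>).\<close>

definition chain_mod ::
    "'k::field rep \<Rightarrow> 'k \<Rightarrow> 'k \<Rightarrow> 'k vec set \<Rightarrow> (nat \<Rightarrow> 'k vec) \<Rightarrow> nat \<Rightarrow> vertex \<Rightarrow> 'k vec set" where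
  "chain_mod M r s T e m i = (case i of V1 \<Rightarrow> T | V2 \<Rightarrow> seqs.span (e ` {..<m})
     | V3 \<Rightarrow> pen M r s ` seqs.span (e ` {..<m}))"

lemma chain_mod_simps [simp]:
  "chain_mod M r s T e m V1 = T" "chain_mod M r s T e m V2 = seqs.span (e ` {..<m})"
  "chain_mod M r s T e m V3 = pen M r s ` seqs.span (e ` {..<m})"
  by (simp_all add: chain_mod_def)

lemma jordan_seq_mono: "jordan_seq M p q r s e m \<Longrightarrow> k \<le> m \<Longrightarrow> jordan_seq M p q r s e k"
  unfolding jordan_seq_def by auto

lemma jordan_span:
  assumes "quiver_rep M" "jordan_seq M p q r s e m"
  shows "seqs.span (e ` {..<m}) \<subseteq> vspace M V2"
  using assms rep_subspace[OF assms(1), of V2] unfolding jordan_seq_def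
  by (intro seqs.span_minimal) auto

lemma jordan_shift:
  assumes M: "quiver_rep M" and e: "jordan_seq M p q r s e (Suc m)" and x: "x \<in> seqs.span (e ` {..<Suc m})"
  shows "pen M p q x \<in> pen M r s ` seqs.span (e ` {..<m})"
proof (rule span_image_subset[OF pen_lin[OF M] rep_subspace[OF M] _ _ _ x])
  have sub: "seqs.span (e ` {..<m}) \<subseteq> vspace M V2"
    by (rule jordan_span[OF M jordan_seq_mono[OF e]]) simp
  show R: "seqs.subspace (pen M r s ` seqs.span (e ` {..<m}))"
    using lin_on_image[OF lin_on_subset[OF pen_lin[OF M] sub]] seqs.subspace_span by blast
  show "e ` {..<Suc m} \<subseteq> vspace M V2" using e unfolding jordan_seq_def by auto
  fix y assume "y \<in> e ` {..<Suc m}"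
  then obtain l where l: "l < Suc m" "y = e l" by blast
  show "pen M p q y \<in> pen M r s ` seqs.span (e ` {..<m})"
  proof (cases l)
    case 0
    then show ?thesis using e l seqs.subspace_0[OF R] unfolding jordan_seq_def by auto
  next
    case (Suc l')
    then have "pen M p q y = pen M r s (e l')" using e l unfolding jordan_seq_def by auto
    moreover have "e l' \<in> seqs.span (e ` {..<m})" using l Suc by (intro seqs.span_base) auto
    ultimately show ?thesis by blast
  qed
qed

lemma chain_mod_submodule:
  assumes M: "quiver_rep M" and det: "p * s \<noteq> q * r" and e: "jordan_seq M p q r s e m"
    and T: "seqs.subspace T" "T \<subseteq> vspace M V1" "\<And>x. x \<in> T \<Longrightarrow> act M A12 x \<in> seqs.span (e ` {..<m})"
  shows "chain_mod M r s T e m \<in> submodules M"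
proof (rule submodule_penI[OF det])
  have sub: "seqs.span (e ` {..<m}) \<subseteq> vspace M V2" by (rule jordan_span[OF M e])
  have R: "seqs.subspace (pen M r s ` seqs.span (e ` {..<m}))"
    using lin_on_image[OF lin_on_subset[OF pen_lin[OF M] sub]] seqs.subspace_span by blast
  show "seqs.subspace (chain_mod M r s T e m i)" for i
    using T(1) R by (cases i) auto
  show "chain_mod M r s T e m i \<subseteq> vspace M i" for i
    using T(2) sub lin_on_mem[OF pen_lin[OF M]] by (cases i) auto
  show "pen M p q x \<in> chain_mod M r s T e m V3" if x: "x \<in> chain_mod M r s T e m V2" for x
  proof (cases m)
    case 0
    then have "x = 0" using x by simp
    then show ?thesis using R seqs.subspace_0 lin_on_0[OF pen_lin[OF M] rep_subspace[OF M]] by auto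
  next
    case (Suc k)
    have "seqs.span (e ` {..<k}) \<subseteq> seqs.span (e ` {..<m})" using Suc by (intro seqs.span_mono) auto
    then show ?thesis using jordan_shift[OF M, of p q r s e k x] e x Suc by auto
  qed
qed (use T(3) in auto)

text \<open>If the last nonzero coefficient c belonged to a vector e_k with k > 0, then the
  vanishing of g would read d (z + c e_(k-1)) = 0 with z in the span of earlier vectors, against
  injectivity of d and independence. Injectivity is assumed only on the first \<open>m\<close> of
  the \<open>Suc m\<close> vectors, so that the preinjective case is covered, where d kills the last
  one.\<close>

lemma jordan_kernel:
  assumes M: "quiver_rep M" and e: "jordan_seq M p q r s e (Suc m)"
    and indep: "\<And>l. l < Suc m \<Longrightarrow> e l \<notin> seqs.span (e ` {..<l})"
    and inj: "\<And>x. x \<in> seqs.span (e ` {..<m}) \<Longrightarrow> pen M r s x = 0 \<Longrightarrow> x = 0"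
    and "x \<in> seqs.span (e ` {..<k})" "k \<le> Suc m" "pen M p q x = 0"
  shows "x \<in> seqs.span {e 0}"
  using assms(5-)
proof (induction k arbitrary: x)
  case 0
  then have "x \<in> {0}" by simp
  then show ?case using seqs.span_zero by (metis singletonD)
next
  case (Suc k)
  have "x \<in> seqs.span (insert (e k) (e ` {..<k}))" using Suc.prems(1) by (simp add: lessThan_Suc)
  then obtain c where "x - fscale c (e k) \<in> seqs.span (e ` {..<k})" using seqs.span_insert by blast
  then obtain y where y: "y \<in> seqs.span (e ` {..<k})" "x = y + fscale c (e k)"
    by (metis diff_add_cancel)
  show ?case
  proof (cases "k = 0 \<or> c = 0")
    case True
    then show ?thesis using y Suc seqs.span_base[of "e 0" "{e 0}"] by (auto simp: seqs.span_scale)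
  next
    case False
    then obtain j where j: "k = Suc j" and c: "c \<noteq> 0" using not0_implies_Suc by blast
    have ek: "e k \<in> vspace M V2" "e j \<in> vspace M V2" "pen M p q (e k) = pen M r s (e j)"
      using e Suc.prems(2) j unfolding jordan_seq_def by auto
    have ej: "jordan_seq M p q r s e (Suc j)" using jordan_seq_mono[OF e] Suc.prems(2) j by simp
    obtain z where z: "z \<in> seqs.span (e ` {..<j})" "pen M p q y = pen M r s z"
      using jordan_shift[OF M ej] y(1) j by blast
    have zV: "z \<in> vspace M V2" using jordan_span[OF M jordan_seq_mono[OF ej, of j]] z(1) by auto
    have yV: "y \<in> vspace M V2" using jordan_span[OF M jordan_seq_mono[OF e, of k]] y(1) Suc.prems(2) by auto
    have cV: "fscale c (e j) \<in> vspace M V2" "fscale c (e k) \<in> vspace M V2"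
      using ek seqs.subspace_scale[OF rep_subspace[OF M]] by auto
    have "0 = pen M p q y + fscale c (pen M p q (e k))"
      using Suc.prems(3) unfolding y(2) lin_on_add[OF pen_lin[OF M] yV cV(2)] lin_on_scale[OF pen_lin[OF M] ek(1)]
      by (rule sym)
    also have "\<dots> = pen M r s (z + fscale c (e j))"
      unfolding ek(3) z(2) lin_on_add[OF pen_lin[OF M] zV cV(1)] lin_on_scale[OF pen_lin[OF M] ek(2)] ..
    finally have "pen M r s (z + fscale c (e j)) = 0" by simp
    moreover have "z + fscale c (e j) \<in> seqs.span (e ` {..<m})"
    proof (intro seqs.span_add seqs.span_scale)
      have "e ` {..<j} \<subseteq> e ` {..<m}" using Suc.prems(2) j by (intro image_mono) auto
      then show "z \<in> seqs.span (e ` {..<m})" using z(1) seqs.span_mono by blast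
      show "e j \<in> seqs.span (e ` {..<m})" using Suc.prems(2) j by (intro seqs.span_base) auto
    qed
    ultimately have "z + fscale c (e j) = 0" by (rule inj[rotated])
    then have "fscale c (e j) = - z" by (simp add: eq_neg_iff_add_eq_0 add.commute)
    then have "e j = fscale (inverse c) (- z)" using c
      by (metis seqs.scale_scale seqs.scale_one left_inverse)
    then have "e j \<in> seqs.span (e ` {..<j})" using z(1) by (simp add: seqs.span_neg seqs.span_scale del: seqs.scale_minus_right)
    then show ?thesis using indep[of j] Suc.prems(2) j by simp
  qed
qed

lemma splits_components:
  assumes "splits M U A B" "a \<in> A i" "b \<in> B i" "a + b \<in> A i" "U \<in> submodules M"
  shows "b = 0"
proof -
  have "a + b - a \<in> A i" using assms sub_subspace[of A M] seqs.subspace_diff unfolding splits_def by blast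
  then have "b \<in> A i" by simp
  then show ?thesis using assms unfolding splits_def by blast
qed

text \<open>By \<open>jordan_kernel\<close> the kernel of g is the line of \<open>e 0\<close>, so
  one summand \<open>A\<close> contains \<open>e 0\<close>. Climbing the chain, the component of
  each \<open>e (Suc l)\<close> in the other summand is killed by g, hence lies on that line and in
  \<open>A\<close>, and vanishes. So \<open>A\<close> is everything at \<open>V2\<close> and
  \<open>V3\<close>; at \<open>V1\<close> the other summand is zero because the map is injective on
  \<open>T\<close>.\<close>

lemma chain_mod_indecomposable:
  assumes M: "quiver_rep M" and det: "p * s \<noteq> q * r" and e: "jordan_seq M p q r s e (Suc m)"
    and indep: "\<And>l. l < Suc m \<Longrightarrow> e l \<notin> seqs.span (e ` {..<l})"
    and inj: "\<And>x. x \<in> seqs.span (e ` {..<m}) \<Longrightarrow> pen M r s x = 0 \<Longrightarrow> x = 0"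
    and T: "seqs.subspace T" "T \<subseteq> vspace M V1" "\<And>x. x \<in> T \<Longrightarrow> act M A12 x \<in> seqs.span (e ` {..<Suc m})"
      "\<And>x. x \<in> T \<Longrightarrow> act M A12 x = 0 \<Longrightarrow> x = 0"
  shows "indecomposable (subrep M (chain_mod M r s T e (Suc m)))"
proof -
  let ?C = "chain_mod M r s T e (Suc m)"
  have C: "?C \<in> submodules M" by (rule chain_mod_submodule[OF M det e T(1-3)])
  have e0: "e 0 \<noteq> 0" using indep[of 0] by auto
  have eC: "e l \<in> ?C V2" if "l < Suc m" for l using that by (auto intro: seqs.span_base)
  have CV: "?C V2 \<subseteq> vspace M V2" by (rule sub_le[OF C])
  have nz: "?C \<noteq> zero_sub" using eC[of 0] e0 not_zero_sub[OF C] by blast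
  have main: "B = zero_sub" if s: "splits M ?C A B" and A0: "e 0 \<in> A V2" for A B
  proof -
    have AB: "A \<in> submodules M" "B \<in> submodules M" "A \<le> ?C" "B \<le> ?C"
      using s unfolding splits_def by auto
    have eA: "e l \<in> A V2" if "l < Suc m" for l
      using that
    proof (induction l)
      case (Suc l)
      obtain a b where ab: "a \<in> A V2" "b \<in> B V2" "e (Suc l) = a + b"
        using s eC[OF Suc.prems] unfolding splits_def by blast
      have abV: "a \<in> vspace M V2" "b \<in> vspace M V2" using ab sub_le[OF AB(1)] sub_le[OF AB(2)] by auto
      have "pen M p q a + pen M p q b = pen M r s (e l)"
        using lin_on_add[OF pen_lin[OF M] abV] ab(3) e Suc.prems unfolding jordan_seq_def by metis
      moreover have "pen M r s (e l) \<in> A V3" using Suc sub_pen[OF AB(1)] by simp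
      ultimately have "pen M p q b = 0"
        using splits_components[OF s sub_pen[OF AB(1) ab(1)] sub_pen[OF AB(2) ab(2)] _ C] by metis
      moreover have "b \<in> seqs.span (e ` {..<Suc m})" using ab(2) AB(4) unfolding le_fun_def by (metis chain_mod_simps(2) subsetD)
      ultimately have "b \<in> seqs.span {e 0}" using jordan_kernel[OF M e indep inj] by blast
      moreover have "seqs.span {e 0} \<subseteq> A V2" using A0 sub_subspace[OF AB(1)] by (intro seqs.span_minimal) auto
      ultimately have "b \<in> A V2" by blast
      then have "b = 0" using ab(2) s unfolding splits_def by blast
      then show ?case using ab by simp
    qed (use A0 in simp)
    have "seqs.span (e ` {..<Suc m}) \<subseteq> A V2" using eA sub_subspace[OF AB(1)] by (intro seqs.span_minimal) auto
    then have A23: "?C V2 \<subseteq> A V2" "?C V3 \<subseteq> A V3" using sub_pen[OF AB(1)] by auto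
    have B2: "x = 0" if "x \<in> B V2" for x using that A23 AB(4) s unfolding splits_def le_fun_def by blast
    have B3: "x = 0" if "x \<in> B V3" for x using that A23 AB(4) s unfolding splits_def le_fun_def by blast
    have B1: "x = 0" if x: "x \<in> B V1" for x
    proof -
      have "act M A12 x = 0" using B2 sub_alpha[OF AB(2) x] by blast
      moreover have "x \<in> T" using x AB(4) unfolding le_fun_def by (metis chain_mod_simps(1) subsetD)
      ultimately show ?thesis using T(4) by blast
    qed
    show ?thesis
    proof (rule ccontr)
      assume "B \<noteq> zero_sub"
      then obtain i x where "x \<in> B i" "x \<noteq> 0" using not_zero_sub[OF AB(2)] by blast
      then show False using B1 B2 B3 by (cases i) auto
    qed
  qed
  have "A = zero_sub \<or> B = zero_sub" if s: "splits M ?C A B" for A B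
  proof -
    have AB: "A \<in> submodules M" "B \<in> submodules M" "A \<le> ?C" "B \<le> ?C"
      using s unfolding splits_def by auto
    obtain a b where ab: "a \<in> A V2" "b \<in> B V2" "e 0 = a + b"
      using s eC[of 0] unfolding splits_def by blast
    have abV: "a \<in> vspace M V2" "b \<in> vspace M V2" using ab sub_le[OF AB(1)] sub_le[OF AB(2)] by auto
    have sum: "pen M p q a + pen M p q b = 0"
      using lin_on_add[OF pen_lin[OF M] abV] ab(3) e unfolding jordan_seq_def by (metis zero_less_Suc)
    then have b0: "pen M p q b = 0"
      using splits_components[OF s sub_pen[OF AB(1) ab(1)] sub_pen[OF AB(2) ab(2)] _ C] sub_0[OF AB(1)] by metis
    then have a0: "pen M p q a = 0" using sum by simp
    have mem: "a \<in> seqs.span (e ` {..<Suc m})" "b \<in> seqs.span (e ` {..<Suc m})"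
      using ab AB(3,4) unfolding le_fun_def by (metis chain_mod_simps(2) subsetD)+
    then have "a \<in> seqs.span {e 0}" "b \<in> seqs.span {e 0}"
      using jordan_kernel[OF M e indep inj] a0 b0 by blast+
    then obtain c d where cd: "a = fscale c (e 0)" "b = fscale d (e 0)"
      unfolding seqs.span_singleton by blast
    have line: "e 0 \<in> D V2" if "fscale c (e 0) \<in> D V2" "D \<in> submodules M" "c \<noteq> 0" for D c
    proof -
      have "fscale (inverse c) (fscale c (e 0)) \<in> D V2" using that sub_subspace[OF that(2)] by (metis seqs.subspace_scale)
      then show ?thesis using that(3) by simp
    qed
    have "c \<noteq> 0 \<or> d \<noteq> 0"
    proof (rule ccontr)
      assume "\<not> ?thesis"
      then have "a + b = 0" using cd by simp
      then show False using ab(3) e0 by simp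
    qed
    then have "e 0 \<in> A V2 \<or> e 0 \<in> B V2" using line cd ab AB(1,2) by blast
    then show ?thesis using main[OF s] main[OF splits_sym[OF s]] by blast
  qed
  then show ?thesis using nz indecomposable_subrep_iff[OF M C] by blast
qed

section \<open>Sets of lengths realised by Jordan chains\<close>

lemma chain_mod_total_dim:
  assumes M: "quiver_rep M" and e: "jordan_seq M p q r s e m"
    and indep: "\<And>l. l < m \<Longrightarrow> e l \<notin> seqs.span (e ` {..<l})"
    and inj: "\<And>x. x \<in> seqs.span (e ` {..<m}) \<Longrightarrow> pen M r s x = 0 \<Longrightarrow> x = 0"
  shows "total_dim (chain_mod M r s T e m) = seqs.dim T + 2 * m"
proof -
  have l: "linear_map_on (seqs.span (e ` {..<m})) (vspace M V3) (pen M r s)"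
    by (rule lin_on_subset[OF pen_lin[OF M] jordan_span[OF M e]])
  have "seqs.dim (pen M r s ` seqs.span (e ` {..<m})) = seqs.dim (seqs.span (e ` {..<m}))"
    by (rule dim_lin_on_image[OF l seqs.subspace_span lin_on_inj[OF l seqs.subspace_span inj]])
  then show ?thesis unfolding total_dim_def using indep_sequence[of m e, OF indep] by simp
qed

lemma indecomposable_if_total_dim_1:
  assumes M: "quiver_rep M" and U: "U \<in> submodules M" "total_dim U = 1"
  shows "indecomposable (subrep M U)"
  unfolding indecomposable_subrep_iff[OF M U(1)]
proof (intro conjI allI impI)
  show "U \<noteq> zero_sub" using U(2) total_dim_zero by (metis zero_neq_one)
  fix A B assume s: "splits M U A B"
  show "A = zero_sub \<or> B = zero_sub"
  proof (rule ccontr)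
    assume "\<not> ?thesis"
    then have nz: "A \<noteq> zero_sub" "B \<noteq> zero_sub" by auto
    have A: "A \<in> submodules M" using s unfolding splits_def by blast
    have "total_dim A < 1" using splits_total_dim[OF M U(1) s nz(2)] U(2) by simp
    moreover have "total_dim (zero_sub :: vertex \<Rightarrow> 'a vec set) < total_dim A"
      by (rule total_dim_mono[OF M zero_sub_submodule[OF M] A
            order.not_eq_order_implies_strict[OF nz(1)[symmetric] zero_sub_le[OF A]]])
    ultimately show False by simp
  qed
qed

text \<open>The lengths of the chain formed by the simple module at \<open>V3\<close>, R[1], R[2],
  ..., R[m]; \<open>mu_set m\<close> adds one further member.\<close>

definition even_set :: "nat \<Rightarrow> nat set" where
  "even_set m = {1} \<union> {2 * j |j. 1 \<le> j \<and> j \<le> m}"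

lemma even_set_Suc: "even_set (Suc m) = insert (2 * Suc m) (even_set m)"
proof -
  have "{2 * j |j. 1 \<le> j \<and> j \<le> Suc m} = insert (2 * Suc m) {2 * j |j. 1 \<le> j \<and> j \<le> m}"
    by (auto simp: le_Suc_eq) (metis Suc_leI mult_Suc_right add_2_eq_Suc zero_less_Suc One_nat_def)
  then show ?thesis unfolding even_set_def by auto
qed

lemma mu_set_eq: "mu_set m = insert (2 * m + 1) (even_set m)"
  unfolding mu_set_def even_set_def by auto

lemma gr_chain_jordan:
  assumes M: "quiver_rep M" and det: "p * s \<noteq> q * r" and e: "jordan_seq M p q r s e (Suc m)"
    and indep: "\<And>l. l < Suc m \<Longrightarrow> e l \<notin> seqs.span (e ` {..<l})"
    and inj: "\<And>x. x \<in> seqs.span (e ` {..<Suc m}) \<Longrightarrow> pen M r s x = 0 \<Longrightarrow> x = 0"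
  shows "gr_chain M (chain_mod M r s {0} e (Suc m)) (even_set (Suc m))"
  using e indep inj
proof (induction m)
  have T: "seqs.subspace {0::'a vec}" "{0} \<subseteq> vspace M V1" "act M A12 0 = 0"
    using seqs.subspace_single_0 seqs.subspace_0[OF rep_subspace[OF M]] rep_act_0[OF M] by auto
  {
    fix m assume e: "jordan_seq M p q r s e (Suc m)" "\<And>l. l < Suc m \<Longrightarrow> e l \<notin> seqs.span (e ` {..<l})"
      "\<And>x. x \<in> seqs.span (e ` {..<Suc m}) \<Longrightarrow> pen M r s x = 0 \<Longrightarrow> x = 0"
    have "seqs.span (e ` {..<m}) \<subseteq> seqs.span (e ` {..<Suc m})" by (intro seqs.span_mono) auto
    then have inj': "\<And>x. x \<in> seqs.span (e ` {..<m}) \<Longrightarrow> pen M r s x = 0 \<Longrightarrow> x = 0" using e(3) by blast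
    have "chain_mod M r s {0} e (Suc m) \<in> submodules M"
      by (rule chain_mod_submodule[OF M det e(1) T(1,2)]) (use T(3) seqs.span_zero in auto)
    moreover have "indecomposable (subrep M (chain_mod M r s {0} e (Suc m)))"
      by (rule chain_mod_indecomposable[OF M det e(1,2) inj' T(1,2)]) (use T(3) seqs.span_zero in auto)
    moreover have "total_dim (chain_mod M r s {0} e (Suc m)) = 2 * Suc m"
      using chain_mod_total_dim[OF M e, where T = "{0}"] unfolding dim_zero by linarith
    ultimately have "chain_mod M r s {0} e (Suc m) \<in> submodules M \<and>
        indecomposable (subrep M (chain_mod M r s {0} e (Suc m))) \<and>
        total_dim (chain_mod M r s {0} e (Suc m)) = 2 * Suc m" by blast
  }
  note facts = this
  {
    case 0
    let ?f = "pen M r s (e 0)"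
    \<comment> \<open>The line of d (e 0) at \<open>V3\<close>, the simple submodule that accounts
      for the length 1.\<close>
    let ?S = "\<lambda>i. case i of V1 \<Rightarrow> {0} | V2 \<Rightarrow> {0} | V3 \<Rightarrow> seqs.span {?f}"
    let ?R = "chain_mod M r s {0} e (Suc 0)"
    have R: "?R \<in> submodules M" "indecomposable (subrep M ?R)" "total_dim ?R = 2 * Suc 0"
      using facts[OF 0] by blast+
    have e0: "e 0 \<in> ?R V2" "e 0 \<noteq> 0" using 0(2)[of 0] by (auto intro: seqs.span_base)
    then have f: "?f \<in> ?R V3" "?f \<noteq> 0" using 0(3)[of "e 0"] unfolding chain_mod_simps by blast+
    have le: "?S i \<subseteq> ?R i" for i
    proof (cases i)
      case V3
      have "seqs.span {?f} \<subseteq> ?R V3" using f sub_subspace[OF R(1), of V3] by (intro seqs.span_minimal) auto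
      then show ?thesis using V3 by simp
    qed (auto simp: seqs.span_zero)
    have S: "?S \<in> submodules M"
    proof (rule submoduleI)
      show "seqs.subspace (?S i)" for i by (cases i) (auto simp: seqs.subspace_single_0)
      show "?S i \<subseteq> vspace M i" for i using le sub_le[OF R(1)] by blast
      fix a x assume "x \<in> ?S (source a)"
      then show "act M a x \<in> ?S (target a)" by (cases a) (auto simp: rep_act_0[OF M] seqs.span_zero)
    qed
    have dS: "total_dim ?S = 1" unfolding total_dim_def using dim_line[OF f(2)] by (simp add: dim_zero)
    have iS: "indecomposable (subrep M ?S)" by (rule indecomposable_if_total_dim_1[OF M S dS])
    have "zero_sub \<noteq> ?S" using dS total_dim_zero by (metis zero_neq_one)
    then have "zero_sub < ?S" using zero_sub_le[OF S] by simp
    then have "gr_chain M ?S {1}" using gr_chain_step[OF gr_chain_nil _ S iS] dS by simp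
    moreover have "?S \<noteq> ?R"
    proof
      assume "?S = ?R"
      then have "total_dim ?S = total_dim ?R" by (rule arg_cong)
      then show False using dS R(3) by linarith
    qed
    then have "?S < ?R" using le by (simp add: less_le le_fun_def)
    ultimately have "gr_chain M ?R (insert 2 {1})" using gr_chain_step[OF _ _ R(1,2)] R(3)
      by (metis mult.right_neutral One_nat_def)
    moreover have "even_set (Suc 0) = insert 2 {1}" unfolding even_set_def by auto
    ultimately show ?case by metis
  next
    case (Suc m)
    let ?R = "chain_mod M r s {0} e (Suc (Suc m))" and ?Q = "chain_mod M r s {0} e (Suc m)"
    have span: "seqs.span (e ` {..<Suc m}) \<subseteq> seqs.span (e ` {..<Suc (Suc m)})" by (intro seqs.span_mono) auto
    have pre: "jordan_seq M p q r s e (Suc m)" "\<And>l. l < Suc m \<Longrightarrow> e l \<notin> seqs.span (e ` {..<l})"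
      "\<And>x. x \<in> seqs.span (e ` {..<Suc m}) \<Longrightarrow> pen M r s x = 0 \<Longrightarrow> x = 0"
    proof -
      show "jordan_seq M p q r s e (Suc m)" by (rule jordan_seq_mono[OF Suc.prems(1)]) simp
      show "e l \<notin> seqs.span (e ` {..<l})" if "l < Suc m" for l using Suc.prems(2)[of l] that by simp
      show "x = 0" if "x \<in> seqs.span (e ` {..<Suc m})" "pen M r s x = 0" for x
        using Suc.prems(3) span that by blast
    qed
    have ch: "gr_chain M ?Q (even_set (Suc m))" by (rule Suc.IH[OF pre])
    have "?Q i \<subseteq> ?R i" for i using span by (cases i) auto
    then have "?Q \<le> ?R" by (simp add: le_fun_def)
    moreover have "?Q \<noteq> ?R"
    proof
      assume "?Q = ?R"
      then have "total_dim ?Q = total_dim ?R" by (rule arg_cong)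
      moreover have "total_dim ?Q = 2 * Suc m" using facts[OF pre] by blast
      moreover have "total_dim ?R = 2 * Suc (Suc m)" using facts[OF Suc.prems] by blast
      ultimately have "2 * Suc m = 2 * Suc (Suc m)" by (rule box_equals)
      then show False by simp
    qed
    ultimately have "?Q < ?R" by simp
    then show ?case using gr_chain_step[OF ch] facts[OF Suc.prems] even_set_Suc[of "Suc m"] by metis
  }
qed

lemma kset_sequence:
  assumes M: "quiver_rep M" and "w \<in> kset M p q r s (Suc m)"
  shows "\<exists>e. jordan_seq M p q r s e (Suc m) \<and> e m = w \<and> (\<forall>l\<le>m. e l \<in> kset M p q r s (Suc l))"
  using assms(2)
proof (induction m arbitrary: w)
  case 0
  then have "pen M p q w = pen M r s 0" "w \<in> vspace M V2" by auto
  then have "pen M p q w = 0" using lin_on_0[OF pen_lin[OF M] rep_subspace[OF M]] by metis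
  then show ?case using 0 unfolding jordan_seq_def by (intro exI[of _ "\<lambda>_. w"]) auto
next
  case (Suc m)
  then obtain u where u: "u \<in> kset M p q r s (Suc m)" "pen M p q w = pen M r s u" "w \<in> vspace M V2" by auto
  obtain e where e: "jordan_seq M p q r s e (Suc m)" "e m = u" "\<forall>l\<le>m. e l \<in> kset M p q r s (Suc l)"
    using Suc.IH[OF u(1)] by blast
  have "jordan_seq M p q r s (e(Suc m := w)) (Suc (Suc m))"
    using e(1,2) u unfolding jordan_seq_def by (auto simp: less_Suc_eq)
  moreover have "\<forall>l\<le>Suc m. (e(Suc m := w)) l \<in> kset M p q r s (Suc l)"
    using e(3) Suc.prems by (auto simp del: kset.simps simp: le_Suc_eq)
  moreover have "(e(Suc m := w)) (Suc m) = w" by simp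
  ultimately show ?case by blast
qed

text \<open>If some \<open>e l\<close> lay in level \<open>l\<close>, every later vector would also
  lie one level lower than its index predicts, and finally \<open>w\<close> in level
  \<open>m\<close>. The vectors before \<open>e l\<close> span a subspace of level \<open>l\<close>,
  so independence follows.\<close>

lemma kset_sequence_indep:
  assumes M: "quiver_rep M" and w: "w \<in> kset M p q r s (Suc m)" "w \<notin> kset M p q r s m"
  obtains e where "jordan_seq M p q r s e (Suc m)" "e m = w"
    "\<And>l. l < Suc m \<Longrightarrow> e l \<notin> seqs.span (e ` {..<l})" "\<And>l. l \<le> Suc m \<Longrightarrow> seqs.span (e ` {..<l}) \<subseteq> kset M p q r s l"
proof -
  obtain e where e: "jordan_seq M p q r s e (Suc m)" "e m = w" "\<forall>l\<le>m. e l \<in> kset M p q r s (Suc l)"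
    using kset_sequence[OF M w(1)] by blast
  have span: "seqs.span (e ` {..<l}) \<subseteq> kset M p q r s l" if "l \<le> Suc m" for l
  proof (intro seqs.span_minimal)
    show "seqs.subspace (kset M p q r s l)" using kset_subspace[OF M] by blast
    show "e ` {..<l} \<subseteq> kset M p q r s l"
    proof
      fix x assume "x \<in> e ` {..<l}"
      then obtain j where j: "j < l" "x = e j" by blast
      then have "x \<in> kset M p q r s (Suc j)" using e(3) that by (simp del: kset.simps)
      moreover have "kset M p q r s (Suc j) \<subseteq> kset M p q r s l" using j by (intro kset_mono[OF M]) simp
      ultimately show "x \<in> kset M p q r s l" by blast
    qed
  qed
  have up: "e (l + k) \<in> kset M p q r s (l + k)" if "e l \<in> kset M p q r s l" "l + k \<le> m" for l k
    using that(2)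
  proof (induction k)
    case 0
    then show ?case using that(1) by simp
  next
    case (Suc k)
    then have "e (l + k) \<in> kset M p q r s (l + k)" by simp
    moreover have "pen M p q (e (Suc (l + k))) = pen M r s (e (l + k))" "e (Suc (l + k)) \<in> vspace M V2"
      using e(1) Suc.prems unfolding jordan_seq_def by auto
    ultimately show ?case by auto
  qed
  have "e l \<notin> kset M p q r s l" if "l \<le> m" for l
    using up[of l "m - l"] that e(2) w(2) by auto
  then have "e l \<notin> seqs.span (e ` {..<l})" if "l < Suc m" for l using span[of l] that by auto
  then show ?thesis using that e span by blast
qed

text \<open>The last two hypotheses exclude the instances j = 0, where Q_0 and Z_0 are simple.
  Taking the least level at which freeness fails makes the homomorphism from Q_j or Z_j injective:
  the vectors of the chain are independent and d is injective where needed. The image lies above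
  R[j] and has one more dimension.\<close>

lemma mu_set_in_gr_sets:
  assumes M: "quiver_rep M" and free: "\<not> mu_free n M"
    and alpha: "\<And>x. x \<in> vspace M V1 \<Longrightarrow> act M A12 x = 0 \<Longrightarrow> x = 0"
    and beta: "\<And>v. v \<in> vspace M V2 \<Longrightarrow> act M A23 v = 0 \<Longrightarrow> act M B23 v = 0 \<Longrightarrow> v = 0"
  shows "\<exists>j. 1 \<le> j \<and> j \<le> n \<and> mu_set j \<in> gr_sets M"
proof -
  obtain p q r s where det: "p * s \<noteq> q * r" and
    bad: "(\<exists>w\<in>kset M p q r s (Suc n). pen M r s w = 0 \<and> w \<noteq> 0) \<or>
      (\<exists>x\<in>vspace M V1. act M A12 x \<in> kset M p q r s n \<and> x \<noteq> 0)"
    using free unfolding mu_free_def by (metis (no_types))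
  let ?K = "kset M p q r s"
  have extend: "mu_set (Suc m) \<in> gr_sets M"
    if "gr_chain M U (even_set (Suc m))" "U \<le> W" "W \<in> submodules M" "indecomposable (subrep M W)"
      "total_dim W = 2 * Suc m + 1" "total_dim U = 2 * Suc m" for U W m
  proof -
    have "U < W" using that(2,5,6) by (metis add_cancel_right_right less_le zero_neq_one)
    then show ?thesis unfolding gr_sets_iff[OF M] mu_set_eq using gr_chain_step[OF that(1) _ that(3,4)] that(5) by auto
  qed
  have T0: "seqs.subspace {0::'a vec}" "{0} \<subseteq> vspace M V1" "act M A12 0 = 0"
    using seqs.subspace_single_0 seqs.subspace_0[OF rep_subspace[OF M]] rep_act_0[OF M] by auto
  show ?thesis
  proof (cases "\<exists>w\<in>?K (Suc n). pen M r s w = 0 \<and> w \<noteq> 0")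
    case True
    define i where "i = (LEAST i. \<exists>w\<in>?K i. pen M r s w = 0 \<and> w \<noteq> 0)"
    obtain w where w: "w \<in> ?K i" "pen M r s w = 0" "w \<noteq> 0"
      using LeastI[of "\<lambda>i. \<exists>w\<in>?K i. pen M r s w = 0 \<and> w \<noteq> 0", OF True] unfolding i_def by blast
    have injK: "x = 0" if "x \<in> ?K j" "pen M r s x = 0" "j < i" for x j
      using not_less_Least[of j "\<lambda>i. \<exists>w\<in>?K i. pen M r s w = 0 \<and> w \<noteq> 0"] that unfolding i_def by blast
    have "i \<le> Suc n" unfolding i_def by (rule Least_le[of _ "Suc n"]) (rule True)
    have "i \<noteq> 0" using w by (intro notI) simp
    then obtain m where m: "i = Suc m" using not0_implies_Suc by blast
    \<comment> \<open>A failure at the first level would be a nonzero vector killed by both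
      arrows.\<close>
    have "m \<noteq> 0"
    proof
      assume "m = 0"
      then have "pen M p q w = pen M r s 0" "w \<in> vspace M V2" using w(1) m by auto
      then have "pen M p q w = 0" using lin_on_0[OF pen_lin[OF M] rep_subspace[OF M]] by metis
      then have "pen M c d w = 0" for c d using pen_mem[OF det seqs.subspace_single_0] w(2) by simp
      then show False using beta[of w] w(3) \<open>w \<in> vspace M V2\<close> by (simp add: act_eq_pen)
    qed
    then obtain m' where m': "m = Suc m'" using not0_implies_Suc by blast
    have "w \<notin> ?K m" using injK w m by blast
    then obtain e where e: "jordan_seq M p q r s e (Suc m)" "e m = w"
      "\<And>l. l < Suc m \<Longrightarrow> e l \<notin> seqs.span (e ` {..<l})" "\<And>l. l \<le> Suc m \<Longrightarrow> seqs.span (e ` {..<l}) \<subseteq> ?K l"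
      using kset_sequence_indep[OF M] w(1) m by metis
    have inj: "x = 0" if "x \<in> seqs.span (e ` {..<m})" "pen M r s x = 0" for x
      using injK[of x m] that e(4)[of m] m by auto
    let ?U = "chain_mod M r s {0} e m" and ?W = "chain_mod M r s {0} e (Suc m)"
    have em: "jordan_seq M p q r s e m" by (rule jordan_seq_mono[OF e(1)]) simp
    have ch: "gr_chain M ?U (even_set (Suc m'))"
      using gr_chain_jordan[OF M det, of e m'] em e(3) inj m' by simp
    have span: "seqs.span (e ` {..<m}) \<subseteq> seqs.span (e ` {..<Suc m})" by (intro seqs.span_mono) auto
    then have "?U i \<subseteq> ?W i" for i by (cases i) auto
    then have le: "?U \<le> ?W" by (simp add: le_fun_def)
    have dU: "total_dim ?U = 2 * m"
    proof -
      have "total_dim ?U = seqs.dim {0 :: 'a vec} + 2 * m"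
        by (rule chain_mod_total_dim[OF M em]) (use e(3) inj in auto)
      then show ?thesis using dim_zero by simp
    qed
    \<comment> \<open>The last vector is killed by d, so it adds a dimension at \<open>V2\<close>
      only: the total dimension becomes odd.\<close>
    have im: "?W V3 = ?U V3"
    proof
      show "?U V3 \<subseteq> ?W V3" using span by auto
      have wV: "w \<in> vspace M V2" using e(1,2) unfolding jordan_seq_def by auto
      show "?W V3 \<subseteq> ?U V3"
      proof
        fix y assume "y \<in> ?W V3"
        then obtain x where x: "x \<in> seqs.span (insert w (e ` {..<m}))" "y = pen M r s x"
          using e(2) by (auto simp: lessThan_Suc)
        then obtain c where c: "x - fscale c w \<in> seqs.span (e ` {..<m})" using seqs.span_insert by blast
        then have xV: "x - fscale c w \<in> vspace M V2" using jordan_span[OF M em] by blast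
        have "fscale c w \<in> vspace M V2" using wV seqs.subspace_scale[OF rep_subspace[OF M]] by blast
        have "pen M r s ((x - fscale c w) + fscale c w) = pen M r s (x - fscale c w)"
          unfolding lin_on_add[OF pen_lin[OF M] xV \<open>fscale c w \<in> vspace M V2\<close>]
            lin_on_scale[OF pen_lin[OF M] wV] w(2) seqs.scale_zero_right by (rule add_0_right)
        moreover have "(x - fscale c w) + fscale c w = x" by (rule diff_add_cancel)
        ultimately have "y = pen M r s (x - fscale c w)" using x(2) by metis
        then show "y \<in> ?U V3" using c by simp
      qed
    qed
    have "total_dim ?W = 2 * m + 1"
      using dU im indep_sequence[of "Suc m" e] indep_sequence[of m e] e(3) unfolding total_dim_def by (simp del: lessThan_Suc)
    moreover have "?W \<in> submodules M"
      by (rule chain_mod_submodule[OF M det e(1) T0(1,2)]) (use T0(3) seqs.span_zero in auto)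
    moreover have "indecomposable (subrep M ?W)"
      by (rule chain_mod_indecomposable[OF M det e(1,3) inj T0(1,2)]) (use T0(3) seqs.span_zero in auto)
    ultimately have "mu_set m \<in> gr_sets M" using extend[OF ch le] dU m' by simp
    then show ?thesis using m m' \<open>i \<le> Suc n\<close> by (intro exI[of _ m]) auto
  next
    case False
    then obtain x where x: "x \<in> vspace M V1" "act M A12 x \<in> ?K n" "x \<noteq> 0" using bad by blast
    let ?w = "act M A12 x"
    define i where "i = (LEAST i. ?w \<in> ?K i)"
    have wi: "?w \<in> ?K i" unfolding i_def using x(2) by (rule LeastI)
    have "i \<le> n" unfolding i_def using x(2) by (rule Least_le)
    have "i \<noteq> 0" using wi alpha[OF x(1)] x(3) by (intro notI) simp
    then obtain m where m: "i = Suc m" using not0_implies_Suc by blast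
    have "?w \<notin> ?K m" using not_less_Least[of m "\<lambda>i. ?w \<in> ?K i"] m unfolding i_def by simp
    then obtain e where e: "jordan_seq M p q r s e (Suc m)" "e m = ?w"
      "\<And>l. l < Suc m \<Longrightarrow> e l \<notin> seqs.span (e ` {..<l})" "\<And>l. l \<le> Suc m \<Longrightarrow> seqs.span (e ` {..<l}) \<subseteq> ?K l"
      using kset_sequence_indep[OF M] wi m by metis
    \<comment> \<open>In this case d is injective up to level \<open>Suc n\<close>, hence on the
      whole chain.\<close>
    have "?K (Suc m) \<subseteq> ?K (Suc n)" using kset_mono[OF M] \<open>i \<le> n\<close> m by (simp del: kset.simps)
    then have inj: "x = 0" if "x \<in> seqs.span (e ` {..<Suc m})" "pen M r s x = 0" for x
      using that e(4)[of "Suc m"] False by (auto simp del: kset.simps)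
    have "seqs.span (e ` {..<m}) \<subseteq> seqs.span (e ` {..<Suc m})" by (intro seqs.span_mono) auto
    then have inj': "x = 0" if "x \<in> seqs.span (e ` {..<m})" "pen M r s x = 0" for x using that inj by blast
    let ?T = "seqs.span {x}"
    let ?U = "chain_mod M r s {0} e (Suc m)" and ?W = "chain_mod M r s ?T e (Suc m)"
    have ch: "gr_chain M ?U (even_set (Suc m))" by (rule gr_chain_jordan[OF M det e(1,3) inj])
    have T: "?T \<subseteq> vspace M V1" using x(1) rep_subspace[OF M, of V1] by (intro seqs.span_minimal) auto
    have aT: "act M A12 y \<in> seqs.span (e ` {..<Suc m})" if "y \<in> ?T" for y
    proof -
      obtain c where "y = fscale c x" using \<open>y \<in> ?T\<close> seqs.span_singleton by blast
      then have "act M A12 y = fscale c (e m)" using lin_on_scale[OF rep_lin[OF M, of A12]] x(1) e(2) by simp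
      moreover have "e m \<in> seqs.span (e ` {..<Suc m})" by (intro seqs.span_base) auto
      ultimately show ?thesis by (metis seqs.span_scale)
    qed
    have aT0: "y = 0" if "y \<in> ?T" "act M A12 y = 0" for y using alpha T that by blast
    have W: "?W \<in> submodules M" by (rule chain_mod_submodule[OF M det e(1) seqs.subspace_span T aT])
    have iW: "indecomposable (subrep M ?W)"
      by (rule chain_mod_indecomposable[OF M det e(1,3) inj' seqs.subspace_span T aT aT0])
    have dW: "total_dim ?W = 2 * Suc m + 1" "total_dim ?U = 2 * Suc m"
      using chain_mod_total_dim[OF M e(1,3) inj, where T = ?T] chain_mod_total_dim[OF M e(1,3) inj, where T = "{0}"]
      unfolding dim_zero dim_line[OF x(3)] by linarith+
    have "?U i \<subseteq> ?W i" for i by (cases i) (auto simp: seqs.span_zero)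
    then have "?U \<le> ?W" by (simp add: le_fun_def)
    then have "mu_set (Suc m) \<in> gr_sets M" using extend[OF ch _ W iW dW] by blast
    then show ?thesis using m \<open>i \<le> n\<close> by (intro exI[of _ "Suc m"]) auto
  qed
qed

subsection \<open>Torsion-free modules have small Gabriel-Roiter measure\<close>

lemma mu_free_alpha:
  assumes "quiver_rep M" "mu_free n M" "x \<in> vspace M V1" "act M A12 x = 0"
  shows "x = 0"
proof -
  have "0 \<in> kset M 1 0 0 1 n" using kset_subspace[OF assms(1)] seqs.subspace_0 by blast
  moreover have "(1::'a) * 1 \<noteq> 0 * 0" by simp
  ultimately show ?thesis using assms(2-4) unfolding mu_free_def by metis
qed

lemma mu_free_kset:
  assumes "mu_free n M" "p * s \<noteq> q * r" "w \<in> kset M p q r s (Suc n)" "pen M r s w = 0"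
  shows "w = 0"
  using assms unfolding mu_free_def by blast

lemma mu_free_alpha_kset:
  assumes "mu_free n M" "p * s \<noteq> q * r" "x \<in> vspace M V1" "act M A12 x \<in> kset M p q r s n"
  shows "x = 0"
  using assms unfolding mu_free_def by blast

text \<open>A common kernel vector is the image of a homomorphism from Q_0: it lies in the first
  level for g = b1 and is killed by d = b2.\<close>

lemma mu_free_beta:
  assumes "quiver_rep M" "mu_free n M" "v \<in> vspace M V2" "act M A23 v = 0" "act M B23 v = 0"
  shows "v = 0"
proof -
  have "pen M 1 0 v = pen M 0 1 0"
    using lin_on_0[OF pen_lin[OF assms(1)] rep_subspace[OF assms(1)]] assms(4) by (metis act_eq_pen(1))
  then have "v \<in> kset M 1 0 0 1 (Suc 0)" using assms(3) by simp
  then have "v \<in> kset M 1 0 0 1 (Suc n)" using kset_mono[OF assms(1), of "Suc 0" "Suc n"] by blast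
  moreover have "(1::'a) * 1 \<noteq> 0 * 0" by simp
  moreover have "pen M 0 1 v = 0" using assms(5) by (metis act_eq_pen(2))
  ultimately show ?thesis using mu_free_kset[OF assms(2)] by blast
qed

lemma jordan_span_kset:
  assumes M: "quiver_rep M" and e: "jordan_seq M p q r s e m"
  shows "seqs.span (e ` {..<m}) \<subseteq> kset M p q r s m"
proof (intro seqs.span_minimal)
  show "seqs.subspace (kset M p q r s m)" using kset_subspace[OF M] by blast
  have el: "e l \<in> kset M p q r s (Suc l)" if "l < m" for l
    using that
  proof (induction l)
    case 0
    then have "pen M p q (e 0) = pen M r s 0" "e 0 \<in> vspace M V2"
      using e lin_on_0[OF pen_lin[OF M] rep_subspace[OF M]] unfolding jordan_seq_def by metis+
    then show ?case by simp
  next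
    case (Suc l)
    then have "e l \<in> kset M p q r s (Suc l)" "pen M p q (e (Suc l)) = pen M r s (e l)" "e (Suc l) \<in> vspace M V2"
      using e unfolding jordan_seq_def by (auto simp del: kset.simps)
    then show ?case by (subst kset.simps) blast
  qed
  show "e ` {..<m} \<subseteq> kset M p q r s m"
  proof
    fix x assume "x \<in> e ` {..<m}"
    then obtain l where l: "l < m" "x = e l" by blast
    have "kset M p q r s (Suc l) \<subseteq> kset M p q r s m" using l by (intro kset_mono[OF M]) simp
    then show "x \<in> kset M p q r s m" using el l by blast
  qed
qed

section \<open>Overmodules of a regular module inside a torsion-free module\<close>

lemma codim_one:
  assumes "seqs.subspace A" "seqs.subspace B" "findim B" "A \<subseteq> B" "w \<in> B" "w \<notin> A"
  shows "seqs.dim A < seqs.dim B" "seqs.dim B \<le> Suc (seqs.dim A) \<Longrightarrow> B = seqs.span (insert w A)"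
proof -
  show "seqs.dim A < seqs.dim B" using assms by (intro dim_psubset_findim) auto
  have sub: "seqs.span (insert w A) \<subseteq> B" using assms by (intro seqs.span_minimal) auto
  have "A \<subset> seqs.span (insert w A)" using assms(6) seqs.span_superset[of "insert w A"] by blast
  then have "seqs.dim A < seqs.dim (seqs.span (insert w A))"
    by (rule dim_psubset_findim[OF assms(1) findim_mono[OF assms(3) sub]])
  moreover assume "seqs.dim B \<le> Suc (seqs.dim A)"
  moreover have "seqs.dim (seqs.span (insert w A)) < seqs.dim B" if "seqs.span (insert w A) \<noteq> B"
    using that sub by (intro dim_psubset_findim[OF seqs.subspace_span assms(3)]) auto
  ultimately show "B = seqs.span (insert w A)" by (metis Suc_leI leD order.strict_trans2)
qed

lemma jordan_unshift:
  assumes M: "quiver_rep M" and e: "jordan_seq M p q r s e (Suc m)" and x: "x \<in> seqs.span (e ` {..<m})"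
  shows "pen M r s x \<in> pen M p q ` seqs.span (e ` {..<Suc m})"
proof (rule span_image_subset[OF pen_lin[OF M] rep_subspace[OF M] _ _ _ x])
  show "seqs.subspace (pen M p q ` seqs.span (e ` {..<Suc m}))"
    using lin_on_image[OF lin_on_subset[OF pen_lin[OF M] jordan_span[OF M e]]] seqs.subspace_span by blast
  show "e ` {..<m} \<subseteq> vspace M V2" using e unfolding jordan_seq_def by auto
  fix y assume "y \<in> e ` {..<m}"
  then obtain l where l: "l < m" "y = e l" by blast
  then have "pen M r s y = pen M p q (e (Suc l))" using e unfolding jordan_seq_def by auto
  moreover have "e (Suc l) \<in> seqs.span (e ` {..<Suc m})" using l by (intro seqs.span_base) auto
  ultimately show "pen M r s y \<in> pen M p q ` seqs.span (e ` {..<Suc m})" by blast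
qed

text \<open>On the span of a Jordan chain the first map is nilpotent relative to the second one, so that
  all other members of the pencil have the same image as the second one.\<close>

lemma jordan_other_eigenvalue:
  assumes M: "quiver_rep M" and e: "jordan_seq M p q r s e m" and c: "c \<noteq> 0" and x: "x \<in> seqs.span (e ` {..<m})"
  shows "pen M r s x \<in> pen M (p - c * r) (q - c * s) ` seqs.span (e ` {..<m})"
proof (rule span_image_subset[OF pen_lin[OF M] rep_subspace[OF M] _ _ _ x])
  let ?D = "pen M (p - c * r) (q - c * s)" and ?R = "seqs.span (e ` {..<m})"
  show DR: "seqs.subspace (?D ` ?R)"
    using lin_on_image[OF lin_on_subset[OF pen_lin[OF M] jordan_span[OF M e]]] seqs.subspace_span by blast
  show "e ` {..<m} \<subseteq> vspace M V2" using e unfolding jordan_seq_def by auto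
  have "pen M r s (e l) \<in> ?D ` ?R" if "l < m" for l
    using that
  proof (induction l)
    case 0
    then have e0: "pen M p q (e 0) \<in> ?D ` ?R" using e seqs.subspace_0[OF DR] unfolding jordan_seq_def by auto
    have "e 0 \<in> ?R" using 0 by (intro seqs.span_base) auto
    then have "fscale (inverse c) (pen M p q (e 0) - ?D (e 0)) \<in> ?D ` ?R"
      using e0 by (intro seqs.subspace_scale[OF DR] seqs.subspace_diff[OF DR]) auto
    \<comment> \<open>The third map is g - c d; the equation is solved for d, which is possible as
      \<open>c\<close> is nonzero.\<close>
    moreover have "pen M r s (e 0) = fscale (inverse c) (pen M p q (e 0) - ?D (e 0))"
      using c unfolding pen_def by (simp add: fscale_def fun_eq_iff field_simps)
    ultimately show ?case by simp
  next
    case (Suc l)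
    then have el: "pen M p q (e (Suc l)) \<in> ?D ` ?R" using e unfolding jordan_seq_def by auto
    have "e (Suc l) \<in> ?R" using Suc.prems by (intro seqs.span_base) auto
    then have "fscale (inverse c) (pen M p q (e (Suc l)) - ?D (e (Suc l))) \<in> ?D ` ?R"
      using el by (intro seqs.subspace_scale[OF DR] seqs.subspace_diff[OF DR]) auto
    moreover have "pen M r s (e (Suc l)) = fscale (inverse c) (pen M p q (e (Suc l)) - ?D (e (Suc l)))"
      using c unfolding pen_def by (simp add: fscale_def fun_eq_iff field_simps)
    ultimately show ?case by simp
  qed
  then show "pen M r s y \<in> ?D ` ?R" if "y \<in> e ` {..<m}" for y using that by blast
qed

lemma span_line_mem: "c \<noteq> 0 \<Longrightarrow> fscale c w \<in> R \<Longrightarrow> seqs.subspace R \<Longrightarrow> w \<in> R"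
  using seqs.subspace_scale[of R "fscale c w" "inverse c"] by simp

text \<open>A vector of \<open>Y\<close> that is new at \<open>V2\<close> is corrected by elements
  of \<open>R\<close> and rescaled until it continues the Jordan chain. Whenever this fails, either
  freeness is violated or a complement of \<open>R\<close> splits off. The bound by 2 is an
  inequality in order to exclude overmodules with a single additional dimension as well.\<close>

lemma jordan_extension:
  assumes M: "quiver_rep M" and free: "mu_free n M" and det: "p * s \<noteq> q * r"
    and e: "jordan_seq M p q r s e (Suc m)" and mn: "Suc m \<le> n"
    and R: "R = chain_mod M r s {0} e (Suc m)" "R \<noteq> zero_sub"
    and Y: "Y \<in> submodules M" "indecomposable (subrep M Y)" "R < Y" "total_dim Y \<le> total_dim R + 2"
  shows "\<exists>e'. jordan_seq M p q r s e' (Suc (Suc m)) \<and> Y = chain_mod M r s {0} e' (Suc (Suc m)) \<and>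
    total_dim Y = total_dim R + 2"
proof -
  let ?g = "pen M p q" and ?d = "pen M r s"
  have V2: "seqs.subspace (vspace M V2)" by (rule rep_subspace[OF M])
  have sR: "R \<in> submodules M"
    unfolding R(1)
    by (rule chain_mod_submodule[OF M det e seqs.subspace_single_0])
      (use rep_act_0[OF M] seqs.span_zero seqs.subspace_0[OF rep_subspace[OF M]] in auto)
  have R2: "R V2 = seqs.span (e ` {..<Suc m})" and R1: "R V1 = {0}" and R3: "R V3 = ?d ` R V2"
    unfolding R(1) by simp_all
  have subR: "seqs.subspace (R i)" for i by (rule sub_subspace[OF sR])
  have subY: "seqs.subspace (Y i)" for i by (rule sub_subspace[OF Y(1)])
  have fdY: "findim (Y i)" for i by (rule sub_findim[OF M Y(1)])
  have RY: "R i \<subseteq> Y i" for i using Y(3) by (auto simp: less_le le_fun_def)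
  have YV2: "Y V2 \<subseteq> vspace M V2" by (rule sub_le[OF Y(1)])
  have RK: "R V2 \<subseteq> kset M p q r s (Suc m)" unfolding R2 by (rule jordan_span_kset[OF M e])
  have Kn: "kset M p q r s (Suc m) \<subseteq> kset M p q r s n" by (rule kset_mono[OF M mn])
  have Kn1: "kset M p q r s (Suc (Suc m)) \<subseteq> kset M p q r s (Suc n)" using mn by (intro kset_mono[OF M]) simp
  have diff: "pen M a b (x - y) = pen M a b x - pen M a b y" if "x \<in> Y V2" "y \<in> Y V2" for a b x y
    using that YV2 lin_on_diff[OF pen_lin[OF M] V2] by blast
  have diffY: "x - y \<in> Y V2" if "x \<in> Y V2" "y \<in> Y V2" for x y using subY that seqs.subspace_diff by blast
  have notR: "w - u \<notin> R i" if "w \<notin> R i" "u \<in> R i" for w u i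
    using that seqs.subspace_add[OF subR, of "w - u" i u] by auto
  have nosplit: False if "splits M Y R S" "S \<noteq> zero_sub" for S
    using that Y(2) R(2) indecomposable_subrep_iff[OF M Y(1)] by blast
  \<comment> \<open>Such a \<open>w\<close> lies in level \<open>Suc (Suc m)\<close> and is killed
    by d; since \<open>Suc m\<close> is at most \<open>n\<close>, freeness gives
    \<open>w = 0\<close>.\<close>
  have noQ: "w \<in> R V2" if w: "w \<in> Y V2" "?d w = 0" "?g w \<in> R V3" for w
  proof -
    obtain u where "u \<in> R V2" "?g w = ?d u" using w(3) unfolding R3 by blast
    then have "w \<in> kset M p q r s (Suc (Suc m))" using w(1) YV2 RK by (subst kset.simps) blast
    then have "w = 0" using mu_free_kset[OF free det] Kn1 w(2) by blast
    then show ?thesis using subR[of V2] seqs.subspace_0 by blast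
  qed
  \<comment> \<open>With nothing new at \<open>V2\<close>, freeness leaves nothing at
    \<open>V1\<close>, and a complement of \<open>R V3\<close> in \<open>Y V3\<close> splits
    off.\<close>
  have "Y V2 \<noteq> R V2"
  proof
    assume eq: "Y V2 = R V2"
    have Y1: "x = 0" if "x \<in> Y V1" for x
    proof -
      have "act M A12 x \<in> kset M p q r s n" using sub_alpha[OF Y(1) that] eq RK Kn by blast
      then show ?thesis using mu_free_alpha_kset[OF free det] that sub_le[OF Y(1)] by blast
    qed
    obtain H where H: "seqs.subspace H" "H \<subseteq> Y V3" "R V3 \<inter> H = {0}" "\<forall>y\<in>Y V3. \<exists>a\<in>R V3. \<exists>h\<in>H. y = a + h"
      using complement_exists[OF subR[of V3] subY[of V3] RY] by blast
    define S where "S i = (case i of V1 \<Rightarrow> {0} | V2 \<Rightarrow> {0} | V3 \<Rightarrow> H)" for i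
    have S: "S V1 = {0}" "S V2 = {0}" "S V3 = H" by (simp_all add: S_def)
    have SY: "S i \<subseteq> Y i" for i using H(2) subY[of i] seqs.subspace_0 by (cases i) (auto simp: S)
    have "S \<in> submodules M"
    proof (rule submoduleI)
      show "seqs.subspace (S i)" for i using H(1) by (cases i) (auto simp: S seqs.subspace_single_0)
      show "S i \<subseteq> vspace M i" for i using SY sub_le[OF Y(1)] by blast
      fix a x assume "x \<in> S (source a)"
      then show "act M a x \<in> S (target a)" using seqs.subspace_0[OF H(1)] by (cases a) (auto simp: S rep_act_0[OF M])
    qed
    moreover have "x = 0" if "x \<in> R i" "x \<in> S i" for i x using that H(3) by (cases i) (auto simp: S)
    moreover have "\<exists>a\<in>R i. \<exists>b\<in>S i. x = a + b" if x: "x \<in> Y i" for i x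
    proof (cases i)
      case V1
      then show ?thesis using x Y1 by (auto simp: S R1)
    next
      case V2
      then show ?thesis using x eq by (auto simp: S)
    next
      case V3
      then show ?thesis using x H(4) by (auto simp: S)
    qed
    ultimately have "splits M Y R S" unfolding splits_def le_fun_def using sR RY SY by blast
    then have "S = zero_sub" using nosplit by blast
    then have "H = {0}" using S(3) unfolding zero_sub_def by simp
    then have "Y V3 \<subseteq> R V3" using H(4) by auto
    moreover have "Y V1 \<subseteq> R V1" using Y1 R1 by auto
    ultimately have "Y i \<subseteq> R i" for i using eq by (cases i) auto
    then have "Y \<le> R" by (simp add: le_fun_def)
    then show False using Y(3) by simp
  qed
  then obtain w where w: "w \<in> Y V2" "w \<notin> R V2" using RY by blast
  \<comment> \<open>With nothing new at \<open>V3\<close>, the new vector could be corrected to be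
    killed by d, against \<open>noQ\<close>.\<close>
  have "Y V3 \<noteq> R V3"
  proof
    assume eq: "Y V3 = R V3"
    obtain u where u: "u \<in> R V2" "?d w = ?d u" using sub_pen[OF Y(1) w(1)] eq R3 by blast
    then have uY: "u \<in> Y V2" using RY by blast
    have "?d (w - u) = 0" using diff[OF w(1) uY] u(2) by simp
    moreover have "?g (w - u) \<in> R V3" using sub_pen[OF Y(1) diffY[OF w(1) uY]] unfolding eq .
    ultimately have "w - u \<in> R V2" using noQ diffY[OF w(1) uY] by blast
    then show False using notR w(2) u(1) by blast
  qed
  then obtain f where f: "f \<in> Y V3" "f \<notin> R V3" using RY by blast
  have d2: "seqs.dim (R V2) < seqs.dim (Y V2)" by (rule codim_one(1)[OF subR subY fdY RY w])
  have d3: "seqs.dim (R V3) < seqs.dim (Y V3)" by (rule codim_one(1)[OF subR subY fdY RY f])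
  have d1: "seqs.dim (R V1) \<le> seqs.dim (Y V1)" by (rule dim_le_findim[OF subR fdY RY])
  have dims: "seqs.dim (Y V2) = Suc (seqs.dim (R V2))" "seqs.dim (Y V3) = Suc (seqs.dim (R V3))"
    "seqs.dim (Y V1) = seqs.dim (R V1)" "total_dim Y = total_dim R + 2"
    using d1 d2 d3 Y(4) unfolding total_dim_def by linarith+
  have Y1: "Y V1 = {0}"
    using dims(3) dim_pos[OF subY fdY, of V1] unfolding R1 dim_zero by fastforce
  have Y2: "Y V2 = seqs.span (insert w (R V2))" if "w \<in> Y V2" "w \<notin> R V2" for w
    using codim_one(2)[OF subR subY fdY RY that] dims(1) by simp
  have Y3: "Y V3 = seqs.span (insert w (R V3))" if "w \<in> Y V3" "w \<notin> R V3" for w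
    using codim_one(2)[OF subR subY fdY RY that] dims(2) by simp
  \<comment> \<open>If both images of a new vector \<open>w\<close> lie on one new line,
    \<open>w\<close> and that line form a complement of \<open>R\<close>.\<close>
  have split: False
    if w: "w \<in> Y V2" "w \<notin> R V2" and f: "f \<in> Y V3" "f \<notin> R V3" and gd: "?g w \<in> seqs.span {f}" "?d w \<in> seqs.span {f}" for w f
  proof -
    define S where "S i = (case i of V1 \<Rightarrow> {0} | V2 \<Rightarrow> seqs.span {w} | V3 \<Rightarrow> seqs.span {f})" for i
    have S: "S V1 = {0}" "S V2 = seqs.span {w}" "S V3 = seqs.span {f}" by (simp_all add: S_def)
    have "seqs.span {w} \<subseteq> Y V2" "seqs.span {f} \<subseteq> Y V3"
      using w(1) f(1) by (simp_all add: seqs.span_minimal subY)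
    then have SY: "S i \<subseteq> Y i" for i using subY[of V1] seqs.subspace_0 by (cases i) (auto simp: S)
    have line: "pen M a b x \<in> seqs.span {f}" if "pen M a b w \<in> seqs.span {f}" "x \<in> seqs.span {w}" for a b x
      using span_image_subset[OF pen_lin[OF M] V2 seqs.subspace_span, of "{w}"] that w(1) YV2 by blast
    have "S \<in> submodules M"
    proof (rule submodule_penI[OF det])
      show "seqs.subspace (S i)" for i by (cases i) (auto simp: S seqs.subspace_single_0)
      show "S i \<subseteq> vspace M i" for i using SY sub_le[OF Y(1)] by blast
      show "act M A12 x \<in> S V2" if "x \<in> S V1" for x
        using that rep_act_0[OF M] seqs.span_zero unfolding S by (metis singletonD)
    qed (use line gd in \<open>auto simp: S\<close>)
    moreover have "x = 0" if "x \<in> R i" "x \<in> S i" for i x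
    proof -
      have *: "x = 0" if x: "x \<in> R j" "x \<in> seqs.span {u}" "u \<notin> R j" for j u
      proof -
        obtain c where "x = fscale c u" using x(2) seqs.span_singleton by blast
        then show ?thesis using span_line_mem[OF _ _ subR] x by (metis seqs.scale_zero_left)
      qed
      show ?thesis
      proof (cases i)
        case V1
        then show ?thesis using that R1 by auto
      next
        case V2
        then show ?thesis using *[of V2 w] that w unfolding S by (metis S(2))
      next
        case V3
        then show ?thesis using *[of V3 f] that f by (metis S(3))
      qed
    qed
    moreover have "\<exists>a\<in>R i. \<exists>b\<in>S i. x = a + b" if x: "x \<in> Y i" for i x
    proof -
      have *: "\<exists>a\<in>R j. \<exists>b\<in>seqs.span {u}. x = a + b" if x: "x \<in> seqs.span (insert u (R j))" for j u
      proof -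
        obtain a c where "a \<in> R j" "x = a + fscale c u" using x span_insert_eq[OF subR] by blast
        then show ?thesis using seqs.span_singleton by blast
      qed
      show ?thesis
      proof (cases i)
        case V1
        then show ?thesis using x Y1 by (auto simp: S R1)
      next
        case V2
        then show ?thesis using x Y2[OF w] *[of w V2] S(2) by metis
      next
        case V3
        then show ?thesis using x Y3[OF f] *[of f V3] S(3) by metis
      qed
    qed
    ultimately have "splits M Y R S" unfolding splits_def le_fun_def using sR RY SY by blast
    moreover have "w \<in> S V2" "w \<noteq> 0" using w(2) subR seqs.subspace_0 S(2) seqs.span_base by blast+
    then have "S \<noteq> zero_sub" unfolding zero_sub_def by blast
    ultimately show False using nosplit by blast
  qed
  \<comment> \<open>Otherwise \<open>w\<close> can be corrected to be killed by d, and then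
    \<open>w\<close> and its image under g split off.\<close>
  have dw: "?d w \<notin> R V3"
  proof
    assume "?d w \<in> R V3"
    then obtain u where u: "u \<in> R V2" "?d w = ?d u" unfolding R3 by blast
    then have uY: "u \<in> Y V2" using RY by blast
    let ?w = "w - u"
    have w': "?w \<in> Y V2" "?w \<notin> R V2" using diffY[OF w(1) uY] notR[OF w(2) u(1)] .
    have d0: "?d ?w = 0" using diff[OF w(1) uY] u(2) by simp
    have "?g ?w \<notin> R V3" using noQ[OF w'(1) d0] w'(2) by blast
    then show False
      using split[OF w' sub_pen[OF Y(1) w'(1)]] seqs.span_base[of "?g ?w" "{?g ?w}"] seqs.span_zero d0 by (metis singletonI)
  qed
  have dnot: "?d (w - v) \<notin> R V3" if "v \<in> R V2" for v
  proof -
    have "v \<in> Y V2" "?d v \<in> R V3" using that RY R3 by blast+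
    then show ?thesis using diff[OF w(1)] notR[OF dw] by metis
  qed
  have "?g w \<in> seqs.span (insert (?d w) (R V3))"
    using Y3[OF sub_pen[OF Y(1) w(1)] dw] sub_pen[OF Y(1) w(1)] by metis
  then obtain \<rho> c where \<rho>: "\<rho> \<in> R V3" "?g w = \<rho> + fscale c (?d w)"
    using span_insert_eq[OF subR] by blast
  \<comment> \<open>A nonzero \<open>c\<close> would be a different eigenvalue. Then
    \<open>\<rho>\<close> is the value of g - c d at some \<open>v\<close> in \<open>R V2\<close>,
    and \<open>w - v\<close>, on which g = c d, splits off.\<close>
  have c0: "c = 0"
  proof (rule ccontr)
    assume c: "c \<noteq> 0"
    obtain u where "u \<in> R V2" "\<rho> = ?d u" using \<rho>(1) R3 by blast
    then obtain v where v: "v \<in> R V2" "\<rho> = pen M (p - c * r) (q - c * s) v"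
      using jordan_other_eigenvalue[OF M e c] unfolding R2 by blast
    then have vY: "v \<in> Y V2" using RY by blast
    have "\<rho> = ?g v - fscale c (?d v)"
      unfolding v(2) pen_def by (simp add: fscale_def fun_eq_iff algebra_simps)
    then have "?g (w - v) = fscale c (?d (w - v))"
      unfolding diff[OF w(1) vY] \<rho>(2) by (simp add: fscale_def fun_eq_iff algebra_simps)
    then have "?g (w - v) \<in> seqs.span {?d (w - v)}" using seqs.span_singleton by blast
    then show False
      using split[OF diffY[OF w(1) vY] notR[OF w(2) v(1)] sub_pen[OF Y(1) diffY[OF w(1) vY]] dnot[OF v(1)]]
        seqs.span_base[of "?d (w - v)" "{?d (w - v)}"] by blast
  qed
  then have "?g w = \<rho>" using \<rho>(2) by simp
  then obtain u where u: "u \<in> R V2" "?g w = ?d u" using \<rho>(1) R3 by blast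
  have em: "e m \<in> R V2" unfolding R2 by (intro seqs.span_base) auto
  have "u \<in> seqs.span (insert (e m) (seqs.span (e ` {..<m})))"
    using u(1) unfolding R2 lessThan_Suc image_insert seqs.span_insert seqs.span_span .
  then obtain u1 a where u1: "u1 \<in> seqs.span (e ` {..<m})" "u = u1 + fscale a (e m)"
    using span_insert_eq[OF seqs.subspace_span] by blast
  \<comment> \<open>Since d (e l) = g (e (Suc l)) for \<open>l < m\<close>, all of \<open>u\<close>
    except its multiple of \<open>e m\<close> can be absorbed by correcting
    \<open>w\<close>.\<close>
  obtain v where v: "v \<in> R V2" "?d u1 = ?g v"
    using jordan_unshift[OF M e u1(1)] unfolding R2 by blast
  have vY: "v \<in> Y V2" using v RY by blast
  let ?w = "w - v"
  have w': "?w \<in> Y V2" "?w \<notin> R V2" "?d ?w \<notin> R V3"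
    using diffY[OF w(1) vY] notR[OF w(2) v(1)] dnot[OF v(1)] .
  have u1V: "u1 \<in> vspace M V2" using u1(1) jordan_span[OF M jordan_seq_mono[OF e, of m]] by auto
  have emV: "e m \<in> vspace M V2" using em RY YV2 by blast
  have aem: "fscale a (e m) \<in> vspace M V2" using emV seqs.subspace_scale[OF V2] by blast
  have gw: "?g ?w = fscale a (?d (e m))"
    unfolding diff[OF w(1) vY] u(2) u1(2) lin_on_add[OF pen_lin[OF M] u1V aem] lin_on_scale[OF pen_lin[OF M] emV] v(2)
    by (rule add_diff_cancel_left')
  have a: "a \<noteq> 0"
  proof
    assume "a = 0"
    then have "?g ?w \<in> seqs.span {?d ?w}" using gw seqs.span_zero by (metis seqs.scale_zero_left)
    then show False
      using split[OF w'(1,2) sub_pen[OF Y(1) w'(1)] w'(3)] seqs.span_base[of "?d ?w" "{?d ?w}"] by blast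
  qed
  \<comment> \<open>Normalised so that g z = d (e m): the next vector of the chain.\<close>
  define z where "z = fscale (inverse a) ?w"
  have wz: "?w = fscale a z" unfolding z_def using a by simp
  have z: "z \<in> Y V2" unfolding z_def using w'(1) subY seqs.subspace_scale by blast
  have zR: "z \<notin> R V2" using w'(2) wz subR seqs.subspace_scale by metis
  have zV: "z \<in> vspace M V2" using z YV2 by blast
  have dz: "?d z \<notin> R V3"
    using w'(3) wz lin_on_scale[OF pen_lin[OF M] zV] subR seqs.subspace_scale by metis
  have "?g z = fscale (inverse a) (fscale a (?d (e m)))"
    unfolding z_def gw[symmetric] by (rule lin_on_scale[OF pen_lin[OF M]]) (use w'(1) YV2 in blast)
  then have gz: "?g z = ?d (e m)" using a by simp
  let ?e = "e(Suc m := z)"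
  have J: "jordan_seq M p q r s ?e (Suc (Suc m))"
    using e gz zV unfolding jordan_seq_def by (auto simp: less_Suc_eq)
  have "?e ` {..<Suc m} = e ` {..<Suc m}" by (intro image_cong) auto
  then have ins: "?e ` {..<Suc (Suc m)} = insert z (e ` {..<Suc m})"
    unfolding lessThan_Suc[of "Suc m"] image_insert by simp
  have sp: "seqs.span (?e ` {..<Suc (Suc m)}) = Y V2"
    unfolding ins Y2[OF z zR] R2 seqs.span_insert seqs.span_span ..
  have "Y V3 = ?d ` Y V2"
  proof
    show "?d ` Y V2 \<subseteq> Y V3" using sub_pen[OF Y(1)] by blast
    have "seqs.subspace (?d ` Y V2)" using lin_on_image[OF lin_on_subset[OF pen_lin[OF M] YV2] subY] .
    moreover have "R V3 \<subseteq> ?d ` Y V2" using R3 RY by blast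
    ultimately show "Y V3 \<subseteq> ?d ` Y V2"
      unfolding Y3[OF sub_pen[OF Y(1) z] dz] using z by (intro seqs.span_minimal) auto
  qed
  then have "Y i = chain_mod M r s {0} ?e (Suc (Suc m)) i" for i
    using sp Y1 by (cases i) simp_all
  then show ?thesis using J dims(4) by blast
qed

text \<open>By freeness the first map is injective and the arrows have no common kernel, so the
  dimension vector is (0, 2, 0)-free: either (0, 1, 1), or (0, 0, 2), which decomposes. The
  parameter of the resulting simple regular module is read off from the images of a generator
  \<open>w\<close>.\<close>

lemma jordan_start:
  assumes M: "quiver_rep M" and free: "mu_free n M"
    and Y: "Y \<in> submodules M" "indecomposable (subrep M Y)" "total_dim Y = 2"
  shows "\<exists>p q r s e. p * s \<noteq> q * r \<and> jordan_seq M p q r s e (Suc 0) \<and> Y = chain_mod M r s {0} e (Suc 0)"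
proof -
  have subY: "seqs.subspace (Y i)" for i by (rule sub_subspace[OF Y(1)])
  have fdY: "findim (Y i)" for i by (rule sub_findim[OF M Y(1)])
  have zY: "{0} \<subseteq> Y i" for i using subY seqs.subspace_0 by blast
  have "Y V2 \<noteq> {0}"
  proof
    assume Y2: "Y V2 = {0}"
    have Y1: "Y V1 = {0}"
      using sub_alpha[OF Y(1)] Y2 mu_free_alpha[OF M free] sub_le[OF Y(1)] zY by blast
    have "seqs.dim (Y V3) = 2" using Y(3) unfolding total_dim_def Y1 Y2 dim_zero by simp
    then have "Y V3 \<noteq> {0}" using dim_zero by (metis zero_neq_numeral)
    then obtain f where f: "f \<in> Y V3" "f \<noteq> 0" using zY by blast
    have fY: "seqs.span {f} \<subseteq> Y V3" using f subY by (intro seqs.span_minimal) auto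
    obtain H where H: "seqs.subspace H" "H \<subseteq> Y V3" "seqs.span {f} \<inter> H = {0}"
      "\<forall>y\<in>Y V3. \<exists>a\<in>seqs.span {f}. \<exists>h\<in>H. y = a + h"
      using complement_exists[OF seqs.subspace_span subY fY] by blast
    define S where "S L i = (case i of V1 \<Rightarrow> {0} | V2 \<Rightarrow> {0} | V3 \<Rightarrow> L)" for L :: "'a vec set" and i
    have S: "S L V1 = {0}" "S L V2 = {0}" "S L V3 = L" for L by (simp_all add: S_def)
    have SY: "S L i \<subseteq> Y i" if "L \<subseteq> Y V3" for L i using that zY by (cases i) (auto simp: S)
    have sS: "S L \<in> submodules M" if "seqs.subspace L" "L \<subseteq> Y V3" for L
    proof (rule submoduleI)
      show "seqs.subspace (S L i)" for i using that by (cases i) (auto simp: S seqs.subspace_single_0)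
      show "S L i \<subseteq> vspace M i" for i using SY that sub_le[OF Y(1)] by blast
      fix a x assume "x \<in> S L (source a)"
      then show "act M a x \<in> S L (target a)" using seqs.subspace_0[OF that(1)] by (cases a) (auto simp: S rep_act_0[OF M])
    qed
    have "x = 0" if "x \<in> S (seqs.span {f}) i" "x \<in> S H i" for i x using that H(3) by (cases i) (auto simp: S)
    moreover have "\<exists>a\<in>S (seqs.span {f}) i. \<exists>b\<in>S H i. x = a + b" if x: "x \<in> Y i" for i x
      using x H(4) Y1 Y2 by (cases i) (auto simp: S)
    ultimately have "splits M Y (S (seqs.span {f})) (S H)"
      unfolding splits_def le_fun_def using sS[OF seqs.subspace_span fY] sS[OF H(1,2)] SY[OF fY] SY[OF H(2)] by blast
    then have "S (seqs.span {f}) = zero_sub \<or> S H = zero_sub"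
      using Y(2) indecomposable_subrep_iff[OF M Y(1)] by blast
    then have "seqs.span {f} = {0} \<or> H = {0}" unfolding zero_sub_def by (metis S(3))
    then have "H = {0}" using f(2) seqs.span_base[of f "{f}"] by blast
    then have "Y V3 = seqs.span {f}" using H(4) fY by auto
    then show False using dim_line[OF f(2)] \<open>seqs.dim (Y V3) = 2\<close> by simp
  qed
  then obtain w where w: "w \<in> Y V2" "w \<notin> {0}" using zY by blast
  have wV: "w \<in> vspace M V2" using w(1) sub_le[OF Y(1)] by blast
  let ?a = "act M A23 w" and ?b = "act M B23 w"
  have ab: "?a \<in> Y V3" "?b \<in> Y V3" using sub_act[OF Y(1), of w A23] sub_act[OF Y(1), of w B23] w(1) by auto
  have "?a \<noteq> 0 \<or> ?b \<noteq> 0" using mu_free_beta[OF M free wV] w(2) by blast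
  then obtain f where f: "f \<in> Y V3" "f \<notin> {0}" using ab by blast
  have "seqs.dim {0::'a vec} < seqs.dim (Y V2)" "seqs.dim {0::'a vec} < seqs.dim (Y V3)"
    by (rule codim_one(1)[OF seqs.subspace_single_0 subY fdY zY w], rule codim_one(1)[OF seqs.subspace_single_0 subY fdY zY f])
  then have dims: "seqs.dim (Y V1) = 0" "seqs.dim (Y V2) \<le> Suc (seqs.dim {0::'a vec})" "seqs.dim (Y V3) \<le> Suc (seqs.dim {0::'a vec})"
    using Y(3) unfolding total_dim_def dim_zero by linarith+
  have Y1: "Y V1 = {0}" using dims(1) dim_pos[OF subY fdY, of V1] by fastforce
  have Y2: "Y V2 = seqs.span {w}" using codim_one(2)[OF seqs.subspace_single_0 subY fdY zY w dims(2)] by (simp add: insert_commute)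
  have Y3: "Y V3 = seqs.span {f}" using codim_one(2)[OF seqs.subspace_single_0 subY fdY zY f dims(3)] by (simp add: insert_commute)
  obtain a b where a: "?a = fscale a f" and b: "?b = fscale b f" using ab unfolding Y3 seqs.span_singleton by blast
  have ne: "a \<noteq> 0 \<or> b \<noteq> 0" using \<open>?a \<noteq> 0 \<or> ?b \<noteq> 0\<close> a b by auto
  \<comment> \<open>The images of \<open>w\<close> are \<open>a\<close> and \<open>b\<close> times
    \<open>f\<close>, so the member \<open>(b, - a)\<close> of the pencil kills \<open>w\<close>;
    \<open>(r, s)\<close> completes it to a basis, and this member does not kill
    \<open>w\<close>.\<close>
  obtain r s where det: "b * s \<noteq> (- a) * r"
  proof (cases "a = 0")
    case True
    then show ?thesis using that[of 1 0] ne by simp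
  next
    case False
    then show ?thesis using that[of 0 1] by simp
  qed
  have g: "pen M b (- a) w = 0" unfolding pen_def a b by (simp add: fscale_def fun_eq_iff)
  have d: "pen M r s w = fscale (r * a + s * b) f" unfolding pen_def a b by (simp add: fscale_def fun_eq_iff algebra_simps)
  have c: "r * a + s * b \<noteq> 0"
  proof
    assume "r * a + s * b = 0"
    then have "b * s = - a * r" by (simp add: eq_neg_iff_add_eq_0 algebra_simps)
    then show False using det by simp
  qed
  have J: "jordan_seq M b (- a) r s (\<lambda>_. w) (Suc 0)" unfolding jordan_seq_def using g wV by simp
  have "f \<in> pen M r s ` seqs.span {w}"
  proof -
    have "pen M r s (fscale (inverse (r * a + s * b)) w) = f"
      using lin_on_scale[OF pen_lin[OF M] wV] d c by simp
    then show ?thesis using seqs.span_singleton[of w] by blast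
  qed
  then have "Y V3 \<subseteq> pen M r s ` seqs.span {w}"
    unfolding Y3 using lin_on_image[OF lin_on_subset[OF pen_lin[OF M]] seqs.subspace_span, of "{w}"] Y2 sub_le[OF Y(1), of V2]
    by (intro seqs.span_minimal) auto
  moreover have "pen M r s ` seqs.span {w} \<subseteq> Y V3" using sub_pen[OF Y(1)] Y2 by blast
  moreover have "(\<lambda>_::nat. w) ` {..<Suc 0} = {w}" by auto
  ultimately have "Y i = chain_mod M r s {0} (\<lambda>_. w) (Suc 0) i" for i
    using Y1 Y2 by (cases i) auto
  then show ?thesis using det J by blast
qed

section \<open>Chains with the lengths of mu^j\<close>

lemma insert_max_eq:
  assumes "insert a A = insert b B" "\<forall>x\<in>A. x < a" "\<forall>x\<in>B. x < b"
  shows "a = (b::nat) \<and> A = B"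
proof -
  have "a = b" using assms by (metis insert_iff less_asym)
  moreover have "a \<notin> A" "b \<notin> B" using assms by auto
  ultimately show ?thesis using assms(1) by (metis insert_ident)
qed

lemma even_set_less: "x \<in> even_set m \<Longrightarrow> x < 2 * Suc m"
  unfolding even_set_def by auto

text \<open>In a torsion-free module the lengths determine the chain: the member of length 2 starts
  a Jordan chain (\<open>jordan_start\<close>), and every step by 2 continues it
  (\<open>jordan_extension\<close>).\<close>

lemma gr_chain_even_set:
  assumes M: "quiver_rep M" and free: "mu_free n M"
    and "gr_chain M U (even_set (Suc m))" "Suc m \<le> n"
  shows "\<exists>p q r s e. p * s \<noteq> q * r \<and> jordan_seq M p q r s e (Suc m) \<and> U = chain_mod M r s {0} e (Suc m)"
  using assms(3-)
proof (induction m arbitrary: U)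
  have ne: "even_set (Suc m) \<noteq> {}" for m unfolding even_set_def by blast
  {
    case 0
    obtain U' I' where U: "U \<in> submodules M" "indecomposable (subrep M U)"
      "even_set (Suc 0) = insert (total_dim U) I'" "\<forall>i\<in>I'. i < total_dim U"
      using gr_chain_inv[OF 0(1) M ne] by metis
    have "total_dim U = 2"
      using insert_max_eq[of "total_dim U" I' "2 * Suc 0" "even_set 0"] U(3,4) even_set_Suc[of 0] even_set_less[of _ 0]
      by auto
    then show ?case by (rule jordan_start[OF M free U(1,2)])
  next
    case (Suc m)
    obtain U' I' where U: "gr_chain M U' I'" "U' < U" "U \<in> submodules M" "indecomposable (subrep M U)"
      "even_set (Suc (Suc m)) = insert (total_dim U) I'" "\<forall>i\<in>I'. i < total_dim U"
      using gr_chain_inv[OF Suc.prems(1) M ne] by metis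
    have "insert (total_dim U) I' = insert (2 * Suc (Suc m)) (even_set (Suc m))"
      using U(5) even_set_Suc[of "Suc m"] by simp
    then have eq: "total_dim U = 2 * Suc (Suc m)" "I' = even_set (Suc m)"
      using insert_max_eq[OF _ U(6)] even_set_less by blast+
    obtain p q r s e where e: "p * s \<noteq> q * r" "jordan_seq M p q r s e (Suc m)" "U' = chain_mod M r s {0} e (Suc m)"
      using Suc.IH[of U'] U(1) eq(2) Suc.prems(2) by (metis Suc_leD)
    have "2 * Suc m \<in> I'" unfolding eq(2) even_set_Suc by simp
    then have d: "2 * Suc m \<le> total_dim U'" using gr_chain_le[OF U(1) M] by blast
    then have "U' \<noteq> zero_sub" by (auto simp: total_dim_zero)
    then show ?case
      using jordan_extension[OF M free e(1,2) _ e(3) _ U(3,4,2)] Suc.prems(2) d eq(1) e(1) by fastforce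
  }
qed

text \<open>The member of length 2j comes from a Jordan chain, and the next member would have just
  one more dimension, whereas \<open>jordan_extension\<close> forces two.\<close>

lemma mu_free_no_mu_set:
  assumes M: "quiver_rep M" and free: "mu_free n M" and ch: "gr_chain M W (mu_set j)" and j: "1 \<le> j" "j \<le> n"
  shows False
proof -
  obtain m where m: "j = Suc m" using j(1) by (metis One_nat_def Suc_le_D)
  have ne: "mu_set j \<noteq> {}" unfolding mu_set_def by blast
  obtain U I where U: "gr_chain M U I" "U < W" "W \<in> submodules M" "indecomposable (subrep M W)"
    "mu_set j = insert (total_dim W) I" "\<forall>i\<in>I. i < total_dim W"
    using gr_chain_inv[OF ch M ne] by metis
  have "insert (total_dim W) I = insert (2 * j + 1) (even_set j)" using U(5) mu_set_eq by simp
  moreover have "\<forall>x\<in>even_set j. x < 2 * j + 1" unfolding even_set_def using j(1) by auto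
  ultimately have eq: "total_dim W = 2 * j + 1" "I = even_set (Suc m)"
    using insert_max_eq[OF _ U(6)] m by blast+
  obtain p q r s e where e: "p * s \<noteq> q * r" "jordan_seq M p q r s e (Suc m)" "U = chain_mod M r s {0} e (Suc m)"
    using gr_chain_even_set[OF M free, of U m] U(1) eq(2) j m by blast
  have "2 * Suc m \<in> I" unfolding eq(2) even_set_Suc by simp
  then have d: "2 * Suc m \<le> total_dim U" using gr_chain_le[OF U(1) M] by blast
  then have "U \<noteq> zero_sub" by (auto simp: total_dim_zero)
  then have "total_dim W = total_dim U + 2"
    using jordan_extension[OF M free e(1,2) _ e(3) _ U(3,4,2)] j m d eq(1) by fastforce
  then show False using eq(1) d m by simp
qed

text \<open>If \<open>I\<close> exceeds mu^n, the first difference \<open>x\<close> belongs to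
  \<open>I\<close>. Beyond 2n + 1 it leaves mu^n as a beginning of \<open>I\<close>; below, it is an
  odd number 2j + 1, since mu^n contains 1 and the even numbers up to 2n, and then \<open>I\<close>
  begins with mu^j.\<close>

lemma not_less_mu_set:
  assumes "\<not> gr_less I (mu_set n)" "0 \<notin> I" "1 \<le> n"
  shows "\<exists>j. 1 \<le> j \<and> j \<le> n \<and> I \<inter> {..2 * j + 1} = mu_set j"
proof -
  have top: "mu_set k \<subseteq> {..2 * k + 1}" for k unfolding mu_set_def by auto
  have mem: "x \<in> mu_set k \<longleftrightarrow> x = 1 \<or> x = 2 * k + 1 \<or> (even x \<and> 0 < x \<and> x \<le> 2 * k)" for x k
    unfolding mu_set_def by (auto elim!: evenE)
  have "I = mu_set n \<or> gr_less (mu_set n) I" using assms(1) gr_less_linear by blast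
  then show ?thesis
  proof
    assume "I = mu_set n"
    then show ?thesis using top assms(3) by (intro exI[of _ n]) auto
  next
    assume "gr_less (mu_set n) I"
    then obtain x where x: "x \<in> I" "x \<notin> mu_set n" "\<forall>y<x. y \<in> mu_set n \<longleftrightarrow> y \<in> I"
      unfolding gr_less_iff by blast
    show ?thesis
    proof (cases "x > 2 * n + 1")
      case True
      then have "I \<inter> {..2 * n + 1} = mu_set n" using x(3) top[of n] by fastforce
      then show ?thesis using assms(3) by blast
    next
      case False
      have "x \<noteq> 0" using x(1) assms(2) by metis
      then have "odd x" "x \<noteq> 1" "x < 2 * n + 1" using x(2) False unfolding mem by (auto simp: not_le)
      then obtain j where j: "x = 2 * j + 1" "1 \<le> j" "j < n" by (auto elim!: oddE)
      have "y \<in> I \<inter> {..2 * j + 1} \<longleftrightarrow> y \<in> mu_set j" for y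
      proof (cases "y < x")
        case True
        then show ?thesis using x(3) j unfolding mem by auto
      next
        case False
        then show ?thesis using x(1) j unfolding mem by auto
      qed
      then show ?thesis using j by (intro exI[of _ j]) auto
    qed
  qed
qed

text \<open>A set that is not smaller begins with some mu^j, \<open>j \<le> n\<close>, and cutting
  its chain at 2j + 1 gives a chain excluded by \<open>mu_free_no_mu_set\<close>.\<close>

lemma mu_free_gr_sets_less:
  assumes M: "quiver_rep M" and free: "mu_free n M" and n: "1 \<le> n" and I: "I \<in> gr_sets M"
  shows "gr_less I (mu_set n)"
proof (rule ccontr)
  assume neg: "\<not> ?thesis"
  obtain U where U: "gr_chain M U I" using I gr_sets_iff[OF M] by blast
  have "0 \<notin> I" using gr_chain_le[OF U M] by blast
  then obtain j where j: "1 \<le> j" "j \<le> n" "I \<inter> {..2 * j + 1} = mu_set j"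
    using not_less_mu_set[OF neg _ n] by blast
  have "2 * j + 1 \<in> mu_set j" unfolding mu_set_def by blast
  then have "2 * j + 1 \<in> I" using j(3) by blast
  then obtain V where "gr_chain M V (I \<inter> {..2 * j + 1})" using gr_chain_initial[OF U M] by blast
  then show False using mu_free_no_mu_set[OF M free _ j(1,2)] j(3) by metis
qed

subsection \<open>Eigenvectors over an algebraically closed field\<close>

lemma in_span_sequence:
  fixes l :: nat
  shows "x \<in> seqs.span (v ` {..<l}) \<Longrightarrow> \<exists>c. x = (\<Sum>i<l. fscale (c i) (v i))"
proof (induction l arbitrary: x)
  case (Suc l)
  obtain k where "x - fscale k (v l) \<in> seqs.span (v ` {..<l})"
    using Suc.prems unfolding lessThan_Suc image_insert seqs.span_insert by blast
  then obtain c where c: "x - fscale k (v l) = (\<Sum>i<l. fscale (c i) (v i))" using Suc.IH by blast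
  have "(\<Sum>i<Suc l. fscale ((c(l := k)) i) (v i)) = (\<Sum>i<l. fscale (c i) (v i)) + fscale k (v l)"
    unfolding sum.lessThan_Suc by (intro arg_cong2[where f = plus] sum.cong) auto
  also have "\<dots> = x" unfolding c[symmetric] by (rule diff_add_cancel)
  finally show ?case by metis
qed auto

lemma lin_on_sum:
  assumes "linear_map_on V W f" "seqs.subspace V" "\<And>i. i \<in> S \<Longrightarrow> g i \<in> V"
  shows "f (\<Sum>i\<in>S. g i) = (\<Sum>i\<in>S. f (g i))"
  using assms(3)
proof (induction S rule: infinite_finite_induct)
  case (insert x F)
  have "sum g F \<in> V" using insert.prems by (intro seqs.subspace_sum[OF assms(2)]) auto
  then show ?case using insert lin_on_add[OF assms(1)] by (simp only: sum.insert insert_iff simp_thms)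
qed (simp_all add: lin_on_0[OF assms(1,2)])

text \<open>Let p be a nonzero polynomial of least degree with p(T) x = 0. A root r gives p = (X -
  r) q, and q(T) x is nonzero by minimality, hence an eigenvector. Here \<open>ev p\<close> is p(T)
  x.\<close>

lemma eigenvector_exists:
  fixes V :: "'k::alg_closed_field vec set"
  assumes T: "linear_map_on V V T" and V: "seqs.subspace V" "findim V" "V \<noteq> {0}"
  shows "\<exists>x\<in>V. x \<noteq> 0 \<and> (\<exists>c. T x = fscale c x)"
proof -
  obtain x where x: "x \<in> V" "x \<noteq> 0" using V(1,3) seqs.subspace_0 by blast
  define v where "v i = (T ^^ i) x" for i
  have v: "v i \<in> V" for i unfolding v_def using x(1) lin_on_mem[OF T] by (induction i) auto
  have Tv: "T (v i) = v (Suc i)" for i unfolding v_def by simp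
  define ev where "ev p = (\<Sum>i\<le>degree p. fscale (coeff p i) (v i))" for p
  have evN: "ev p = (\<Sum>i\<le>N. fscale (coeff p i) (v i))" if "degree p \<le> N" for p N
    unfolding ev_def using that by (intro sum.mono_neutral_left) (auto simp: coeff_eq_0)
  have evV: "ev p \<in> V" for p unfolding ev_def using v by (intro seqs.subspace_sum seqs.subspace_scale V(1))
  have ev_factor: "ev ([:-r, 1:] * q) = T (ev q) - fscale r (ev q)" for r q
  proof -
    let ?N = "Suc (degree q)"
    have co: "coeff ([:-r, 1:] * q) i = (case i of 0 \<Rightarrow> 0 | Suc j \<Rightarrow> coeff q j) - r * coeff q i" for i
      by (simp add: coeff_pCons split: nat.split)
    have deg: "degree ([:-r, 1:] * q) \<le> ?N"
      using degree_mult_le[of "[:-r, 1:]" q] by simp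
    have "T (ev q) = (\<Sum>i\<le>degree q. T (fscale (coeff q i) (v i)))"
      unfolding ev_def using v by (intro lin_on_sum[OF T V(1)] seqs.subspace_scale[OF V(1)])
    also have "\<dots> = (\<Sum>i\<le>degree q. fscale (coeff q i) (v (Suc i)))"
      using lin_on_scale[OF T v] Tv by simp
    also have "\<dots> = (\<Sum>i\<le>?N. fscale (case i of 0 \<Rightarrow> 0 | Suc j \<Rightarrow> coeff q j) (v i))"
      unfolding sum.atMost_Suc_shift by simp
    finally have 1: "T (ev q) = (\<Sum>i\<le>?N. fscale (case i of 0 \<Rightarrow> 0 | Suc j \<Rightarrow> coeff q j) (v i))" .
    have 2: "fscale r (ev q) = (\<Sum>i\<le>?N. fscale (r * coeff q i) (v i))"
      unfolding evN[of q ?N, OF le_SucI[OF order_refl]] seqs.scale_sum_right seqs.scale_scale ..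
    show ?thesis
      unfolding evN[OF deg] 1 2 sum_subtractf[symmetric] co seqs.scale_left_diff_distrib ..
  qed
  have "\<exists>l. v l \<in> seqs.span (v ` {..<l})"
  proof (rule ccontr)
    assume "\<not> ?thesis"
    then have "seqs.dim (seqs.span (v ` {..<Suc (seqs.dim V)})) = Suc (seqs.dim V)"
      by (intro indep_sequence) blast
    moreover have "seqs.span (v ` {..<Suc (seqs.dim V)}) \<subseteq> V" using v by (intro seqs.span_minimal V(1)) auto
    ultimately show False using dim_le_findim[OF seqs.subspace_span V(2)] by (metis Suc_n_not_le_n)
  qed
  then obtain l c where c: "v l = (\<Sum>i<l. fscale (c i) (v i))" using in_span_sequence by metis
  \<comment> \<open>The polynomial that expresses the first linear dependence among the iterates of
    \<open>x\<close>.\<close>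
  define p0 where "p0 = monom 1 l - (\<Sum>i<l. monom (c i) i)"
  have co0: "coeff p0 i = (if i = l then 1 else if i < l then - c i else 0)" for i
    unfolding p0_def by (simp add: coeff_sum sum.delta)
  have deg0: "degree p0 \<le> l" by (rule degree_le) (simp add: co0)
  have "ev p0 = (\<Sum>i<l. fscale (coeff p0 i) (v i)) + fscale (coeff p0 l) (v l)"
    unfolding evN[OF deg0] lessThan_Suc_atMost[symmetric] sum.lessThan_Suc ..
  also have "(\<Sum>i<l. fscale (coeff p0 i) (v i)) = (\<Sum>i<l. - fscale (c i) (v i))"
    by (intro sum.cong) (simp_all add: co0)
  also have "fscale (coeff p0 l) (v l) = v l" by (simp add: co0)
  finally have "ev p0 = - v l + v l" unfolding sum_negf c[symmetric] .
  then have "ev p0 = 0" unfolding left_minus .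
  moreover have "coeff p0 l \<noteq> 0" by (simp add: co0)
  then have "p0 \<noteq> 0" by (metis coeff_0)
  ultimately have "\<exists>p. p \<noteq> 0 \<and> ev p = 0" by blast
  then obtain p where p: "p \<noteq> 0" "ev p = 0" and min: "\<And>q. q \<noteq> 0 \<Longrightarrow> ev q = 0 \<Longrightarrow> degree p \<le> degree q"
    using ex_has_least_nat[of "\<lambda>p. p \<noteq> 0 \<and> ev p = 0" _ degree] by metis
  have "degree p > 0"
  proof (rule ccontr)
    assume "\<not> ?thesis"
    then have d: "degree p = 0" by simp
    then have "fscale (coeff p 0) x = 0" using p(2) unfolding ev_def by (simp add: v_def)
    then have "coeff p 0 = 0" using x(2) by simp
    then show False using d p(1) by (metis leading_coeff_0_iff)
  qed
  then obtain r where "poly p r = 0" using alg_closed_imp_poly_has_root by blast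
  then obtain q where q: "p = [:-r, 1:] * q" unfolding poly_eq_0_iff_dvd by blast
  then have "q \<noteq> 0" using p(1) by auto
  then have "degree p = Suc (degree q)" unfolding q by (subst degree_mult_eq) auto
  then have "ev q \<noteq> 0" using min \<open>q \<noteq> 0\<close> by fastforce
  moreover have "T (ev q) = fscale r (ev q)" using ev_factor[of r q] p(2) q by simp
  ultimately show ?thesis using evV by blast
qed

text \<open>Over a finite field, 1 plus the product of all X - a has no root.\<close>

lemma infinite_alg_closed: "infinite (UNIV :: 'k::alg_closed_field set)"
proof
  assume fin: "finite (UNIV :: 'k set)"
  define p where "p = (\<Prod>a\<in>(UNIV :: 'k set). [:-a, 1:])"
  have d: "degree p = card (UNIV :: 'k set)"
    unfolding p_def by (subst degree_prod_eq_sum_degree) auto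
  then have "degree p > 0" using fin by (simp add: card_gt_0_iff)
  then have "degree (p + 1) > 0" by (subst degree_add_eq_left) auto
  then obtain x where "poly (p + 1) x = 0" using alg_closed_imp_poly_has_root by blast
  moreover have "poly p x = 0" unfolding p_def poly_prod using fin by (auto intro!: prod_zero)
  ultimately show False by simp
qed

text \<open>A surjective F = (l b1 - b2) alpha is bijective, as freeness makes it injective. An
  eigenvector of F^(-1) b1 alpha would then be killed by another nonzero member of the pencil
  composed with alpha, which freeness forbids.\<close>

lemma pencil_not_surjective:
  fixes N :: "'k::alg_closed_field rep"
  assumes N: "quiver_rep N" and free: "mu_free n N" and n: "1 \<le> n" and nz: "vspace N V3 \<noteq> {0}"
  shows "\<exists>z\<in>vspace N V3. \<forall>x\<in>vspace N V1. pen N l (-1) (act N A12 x) \<noteq> z"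
proof (rule ccontr)
  assume "\<not> ?thesis"
  then have surj: "\<exists>x\<in>vspace N V1. pen N l (-1) (act N A12 x) = z" if "z \<in> vspace N V3" for z using that by blast
  let ?F = "\<lambda>x. pen N l (-1) (act N A12 x)" and ?G = "\<lambda>x. pen N 1 0 (act N A12 x)"
  have V1: "seqs.subspace (vspace N V1)" by (rule rep_subspace[OF N])
  have al: "linear_map_on (vspace N V1) (vspace N V2) (act N A12)" using rep_lin[OF N, of A12] by simp
  have comp: "linear_map_on (vspace N V1) (vspace N V3) (\<lambda>x. pen N a b (act N A12 x))" for a b
    using al pen_lin[OF N, of a b] unfolding linear_map_on_def by simp
  \<comment> \<open>Exclusion of Z_1: here alpha x lies in level 1, which is contained in level
    \<open>n\<close> because \<open>n\<close> is positive.\<close>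
  have ker: "x = 0" if x: "x \<in> vspace N V1" "pen N p q (act N A12 x) = 0" "p * s \<noteq> q * r" for x p q r s
  proof -
    have "pen N r s 0 = 0" by (rule lin_on_0[OF pen_lin[OF N] rep_subspace[OF N]])
    then have "act N A12 x \<in> kset N p q r s (Suc 0)" using x lin_on_mem[OF al] by simp
    moreover have "kset N p q r s (Suc 0) \<subseteq> kset N p q r s n" using n by (intro kset_mono[OF N]) simp
    ultimately show ?thesis using mu_free_alpha_kset[OF free x(3,1)] by blast
  qed
  have injF: "inj_on ?F (vspace N V1)"
    by (rule lin_on_inj[OF comp V1]) (rule ker[of _ l "-1" 0 1], auto)
  have "\<forall>x. \<exists>y. x \<in> vspace N V1 \<longrightarrow> y \<in> vspace N V1 \<and> ?F y = ?G x"
    using surj lin_on_mem[OF comp] by blast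
  then obtain T where T: "\<And>x. x \<in> vspace N V1 \<Longrightarrow> T x \<in> vspace N V1" "\<And>x. x \<in> vspace N V1 \<Longrightarrow> ?F (T x) = ?G x"
    by metis
  have TI: "T x = y" if "x \<in> vspace N V1" "y \<in> vspace N V1" "?F y = ?G x" for x y
    using inj_onD[OF injF] T that by metis
  have "linear_map_on (vspace N V1) (vspace N V1) T"
    unfolding linear_map_on_def
  proof (intro conjI ballI allI T(1))
    fix x y assume xy: "x \<in> vspace N V1" "y \<in> vspace N V1"
    show "T (x + y) = T x + T y"
      by (rule TI) (use xy T seqs.subspace_add[OF V1] in \<open>simp_all only: lin_on_add[OF comp]\<close>)
  next
    fix c x assume x: "x \<in> vspace N V1"
    show "T (fscale c x) = fscale c (T x)"
      by (rule TI) (use x T seqs.subspace_scale[OF V1] in \<open>simp_all only: lin_on_scale[OF comp]\<close>)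
  qed
  moreover have "vspace N V1 \<noteq> {0}"
  proof
    assume z: "vspace N V1 = {0}"
    have "z = 0" if "z \<in> vspace N V3" for z
      using surj[OF that] z lin_on_0[OF comp V1] by (metis singletonD)
    then show False using nz seqs.subspace_0[OF rep_subspace[OF N]] by blast
  qed
  ultimately obtain x t where x: "x \<in> vspace N V1" "x \<noteq> 0" "T x = fscale t x"
    using eigenvector_exists[OF _ V1 rep_findim[OF N]] by blast
  have "?G x = fscale t (?F x)" using T(2)[OF x(1)] x(3) lin_on_scale[OF comp x(1)] by metis
  then have 0: "pen N (1 - t * l) t (act N A12 x) = 0"
    unfolding pen_def by (simp add: fscale_def fun_eq_iff algebra_simps)
  \<comment> \<open>The coordinates \<open>(1 - t * l, t)\<close> never vanish together; the cases
    only select a complementary pair.\<close>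
  show False
  proof (cases "t = 0")
    case True
    then show False using ker[OF x(1) 0, of 1 0] x(2) by simp
  next
    case False
    then show False using ker[OF x(1) 0, of 0 1] x(2) by simp
  qed
qed

subsection \<open>A nonsplit extension\<close>

text \<open>Interleaving at even and odd positions realises an external direct sum inside the same
  sequence space.\<close>

definition mix :: "'k vec \<Rightarrow> 'k vec \<Rightarrow> 'k vec" where
  "mix v w = (\<lambda>i. if even i then v (i div 2) else w (i div 2))"

definition left :: "'k vec \<Rightarrow> 'k vec" where "left v = (\<lambda>i. v (2 * i))"

definition right :: "'k vec \<Rightarrow> 'k vec" where "right v = (\<lambda>i. v (2 * i + 1))"

lemma left_right_mix [simp]: "left (mix v w) = v" "right (mix v w) = w" "mix (left v) (right v) = v"
  unfolding left_def right_def mix_def by (auto simp: fun_eq_iff elim!: oddE)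

lemma mix_eq_iff [simp]: "mix v w = mix v' w' \<longleftrightarrow> v = v' \<and> w = w'"
  by (metis left_right_mix(1,2))

lemma mix_add: "mix v w + mix v' w' = mix (v + v') (w + w')"
  unfolding mix_def by (auto simp: fun_eq_iff)

lemma mix_diff: "mix v w - mix v' w' = mix (v - v') (w - w')"
  unfolding mix_def by (auto simp: fun_eq_iff)

lemma mix_scale: "fscale c (mix v w) = mix (fscale c v) (fscale c w)"
  unfolding mix_def fscale_def by (auto simp: fun_eq_iff)

lemma mix_zero: "mix 0 0 = (0 :: 'k::field vec)"
  unfolding mix_def by (auto simp: fun_eq_iff)

lemma lin_left: "lin left" and lin_right: "lin right"
  by (rule linI; simp add: left_def right_def fscale_def fun_eq_iff)+

lemma lin_mix: "lin (\<lambda>v. mix v 0)" "lin (\<lambda>w. mix 0 w)"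
  by (rule linI; simp add: mix_add mix_scale)+

definition unit :: "nat \<Rightarrow> 'k::field vec" where
  "unit i = (\<lambda>l. if l = i then 1 else 0)"

text \<open>The quotient of the extension: the direct sum of \<open>y\<close> simple regular Kronecker modules with
  parameters \<open>lam 0, \<dots>, lam (y - 1)\<close>, together with the hyperplane of vectors with coordinate sum
  zero at the first vertex.\<close>

definition hyper_rep :: "(nat \<Rightarrow> 'k::field) \<Rightarrow> nat \<Rightarrow> 'k rep" where
  "hyper_rep lam y = \<lparr>vspace = (\<lambda>i. {x. (\<forall>l\<ge>y. x l = 0) \<and> (i = V1 \<longrightarrow> (\<Sum>l<y. x l) = 0)}),
     act = (\<lambda>a x. case a of A12 \<Rightarrow> x | A23 \<Rightarrow> x | B23 \<Rightarrow> (\<lambda>l. lam l * x l))\<rparr>"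

lemma hyper_rep_space: "x \<in> vspace (hyper_rep lam y) i \<longleftrightarrow> (\<forall>l\<ge>y. x l = 0) \<and> (i = V1 \<longrightarrow> (\<Sum>l<y. x l) = 0)"
  unfolding hyper_rep_def by simp

lemma hyper_rep_act:
  "act (hyper_rep lam y) A12 x = x" "act (hyper_rep lam y) A23 x = x"
  "act (hyper_rep lam y) B23 x = (\<lambda>l. lam l * x l)"
  unfolding hyper_rep_def by simp_all

lemma hyper_rep_pen: "pen (hyper_rep lam y) p q x = (\<lambda>l. (p + q * lam l) * x l)"
  unfolding pen_def hyper_rep_act fscale_def by (simp add: fun_eq_iff algebra_simps)

lemma sum_vec_apply: "(\<Sum>i\<in>S. g i) m = (\<Sum>i\<in>S. g i m :: 'k::comm_monoid_add)"
  by (induction S rule: infinite_finite_induct) auto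

lemma quiver_rep_hyper_rep: "quiver_rep (hyper_rep lam y)"
  unfolding quiver_rep_def
proof (intro conjI allI)
  fix i
  show "seqs.subspace (vspace (hyper_rep lam y) i)"
    unfolding seqs.subspace_def
    by (auto simp: hyper_rep_space fscale_def sum.distrib sum_distrib_left[symmetric])
  have "vspace (hyper_rep lam y) i \<subseteq> seqs.span (unit ` {..<y})"
  proof
    fix x assume x: "x \<in> vspace (hyper_rep lam y) i"
    have "x = (\<Sum>l<y. fscale (x l) (unit l))"
    proof
      fix m
      have "(\<Sum>l<y. fscale (x l) (unit l)) m = (\<Sum>l<y. if l = m then x l else 0)"
        unfolding sum_vec_apply by (intro sum.cong) (auto simp: fscale_def unit_def)
      also have "\<dots> = x m" using x unfolding hyper_rep_space by (simp add: sum.delta')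
      finally show "x m = (\<Sum>l<y. fscale (x l) (unit l)) m" by simp
    qed
    moreover have "(\<Sum>l<y. fscale (x l) (unit l)) \<in> seqs.span (unit ` {..<y})"
      by (intro seqs.span_sum seqs.span_scale seqs.span_base) auto
    ultimately show "x \<in> seqs.span (unit ` {..<y})" by metis
  qed
  then show "findim (vspace (hyper_rep lam y) i)" unfolding findim_def by blast
next
  fix a show "linear_map_on (vspace (hyper_rep lam y) (source a)) (vspace (hyper_rep lam y) (target a)) (act (hyper_rep lam y) a)"
    unfolding linear_map_on_def
    by (cases a) (auto simp: hyper_rep_space hyper_rep_act fscale_def fun_eq_iff algebra_simps)
qed

text \<open>All levels are supported where p + q lam l = 0, that is, on at most one coordinate,
  since the parameters are distinct; there r + s lam l is nonzero. A vector supported on one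
  coordinate lies in the hyperplane only if it is zero.\<close>

lemma mu_free_hyper_rep:
  assumes "inj lam"
  shows "mu_free n (hyper_rep lam y)"
  unfolding mu_free_def
proof (intro allI impI conjI ballI)
  fix p q r s :: 'a assume det: "p * s \<noteq> q * r"
  let ?X = "hyper_rep lam y"
  have K: "w l = 0" if "w \<in> kset ?X p q r s i" "p + q * lam l \<noteq> 0" for w l i
    using that(1)
  proof (induction i arbitrary: w)
    case (Suc i)
    then obtain u where u: "u \<in> kset ?X p q r s i" "pen ?X p q w = pen ?X r s u" by auto
    have "(p + q * lam l) * w l = (r + s * lam l) * u l" using fun_cong[OF u(2), of l] unfolding hyper_rep_pen .
    then show ?case using Suc.IH[OF u(1)] that(2) by simp
  qed simp
  {
    fix w assume w: "w \<in> kset ?X p q r s (Suc n)" "pen ?X r s w = 0"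
    show "w = 0"
    proof
      fix l
      show "w l = 0 l"
      proof (rule ccontr)
        assume "w l \<noteq> 0 l"
        then have nz: "w l \<noteq> 0" by simp
        then have a: "p + q * lam l = 0" using K[OF w(1)] by blast
        have "(r + s * lam l) * w l = 0" using fun_cong[OF w(2), of l] unfolding hyper_rep_pen by simp
        then have "r + s * lam l = 0" using nz by simp
        then have "p = - (q * lam l)" "r = - (s * lam l)" using a by (simp_all add: eq_neg_iff_add_eq_0)
        then show False using det by simp
      qed
    qed
  next
    fix x assume x: "x \<in> vspace ?X V1" "act ?X A12 x \<in> kset ?X p q r s n"
    have xl: "p + q * lam l = 0" if "x l \<noteq> 0" for l using K[of x n l] x(2) that unfolding hyper_rep_act by blast
    show "x = 0"
    proof (rule ccontr)
      assume "x \<noteq> 0"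
      then obtain l where l: "x l \<noteq> 0" by (auto simp: fun_eq_iff)
      have "x m = 0" if "m \<noteq> l" for m
      proof (rule ccontr)
        assume "x m \<noteq> 0"
        then have "q * lam m = q * lam l" using xl[OF l] xl[of m] by (metis add_left_cancel)
        moreover have "lam m \<noteq> lam l" using assms that by (simp add: inj_eq)
        ultimately have "q = 0" by simp
        then have "p = 0" using xl[OF l] by simp
        then show False using det \<open>q = 0\<close> by simp
      qed
      then have "(\<Sum>m<y. x m) = (\<Sum>m<y. if m = l then x l else 0)" by (intro sum.cong) auto
      also have "\<dots> = x l" using x(1) l unfolding hyper_rep_space by (auto simp: not_less[symmetric])
      finally show False using x(1) l unfolding hyper_rep_space by simp
    qed
  }
qed

text \<open>The left component is the submodule \<open>N\<close>, the right one the quotient. The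
  cocycle sits in one place: b2 adds \<open>z\<close> times the last coordinate, whose index is
  \<open>j\<close>.\<close>

definition ext_rep :: "'k::field rep \<Rightarrow> (nat \<Rightarrow> 'k) \<Rightarrow> nat \<Rightarrow> 'k vec \<Rightarrow> 'k rep" where
  "ext_rep N lam j z = \<lparr>vspace = (\<lambda>i. {v. left v \<in> vspace N i \<and> right v \<in> vspace (hyper_rep lam (Suc j)) i}),
     act = (\<lambda>a v. mix (act N a (left v) + (if a = B23 then fscale (right v j) z else 0))
                      (act (hyper_rep lam (Suc j)) a (right v)))\<rparr>"

lemma ext_rep_space: "v \<in> vspace (ext_rep N lam j z) i \<longleftrightarrow> left v \<in> vspace N i \<and> right v \<in> vspace (hyper_rep lam (Suc j)) i"
  unfolding ext_rep_def by simp

lemma ext_rep_act: "act (ext_rep N lam j z) a v = mix (act N a (left v) + (if a = B23 then fscale (right v j) z else 0))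
    (act (hyper_rep lam (Suc j)) a (right v))"
  unfolding ext_rep_def by simp

lemma ext_rep_pen: "pen (ext_rep N lam j z) p q v =
    mix (pen N p q (left v) + fscale (q * right v j) z) (pen (hyper_rep lam (Suc j)) p q (right v))"
  unfolding pen_def ext_rep_act mix_scale mix_add
  by (simp add: seqs.scale_right_distrib algebra_simps)

lemma quiver_rep_ext_rep:
  assumes N: "quiver_rep N" and z: "z \<in> vspace N V3"
  shows "quiver_rep (ext_rep N lam j z)"
  unfolding quiver_rep_def
proof (intro conjI allI)
  let ?X = "hyper_rep lam (Suc j)" and ?M = "ext_rep N lam j z"
  have X: "quiver_rep ?X" by (rule quiver_rep_hyper_rep)
  fix i
  show "seqs.subspace (vspace ?M i)"
    using rep_subspace[OF N, of i] rep_subspace[OF X, of i]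
    unfolding seqs.subspace_def
    by (simp add: ext_rep_space lin_simps[OF lin_left] lin_simps[OF lin_right])
  obtain F G where F: "finite F" "vspace N i \<subseteq> seqs.span F" and G: "finite G" "vspace ?X i \<subseteq> seqs.span G"
    using rep_findim[OF N, of i] rep_findim[OF X, of i] unfolding findim_def by blast
  let ?B = "(\<lambda>v. mix v 0) ` F \<union> (\<lambda>w. mix 0 w) ` G"
  have "vspace ?M i \<subseteq> seqs.span ?B"
  proof
    fix v assume "v \<in> vspace ?M i"
    then have "left v \<in> seqs.span F" "right v \<in> seqs.span G" using F G unfolding ext_rep_space by auto
    then have "mix (left v) 0 \<in> seqs.span ((\<lambda>v. mix v 0) ` F)" "mix 0 (right v) \<in> seqs.span ((\<lambda>w. mix 0 w) ` G)"
      using seqs_pair.linear_span_image[OF lin_mix(1)] seqs_pair.linear_span_image[OF lin_mix(2)] by blast+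
    then have "mix (left v) 0 + mix 0 (right v) \<in> seqs.span ?B"
      using seqs.span_mono[of _ ?B] by (intro seqs.span_add) blast+
    moreover have "mix (left v) 0 + mix 0 (right v) = v"
      unfolding mix_add add_0_left add_0_right by (rule left_right_mix(3))
    ultimately show "v \<in> seqs.span ?B" by metis
  qed
  moreover have "finite ?B" using F(1) G(1) by simp
  ultimately show "findim (vspace ?M i)" unfolding findim_def by (intro exI[of _ ?B] conjI)
next
  let ?X = "hyper_rep lam (Suc j)" and ?M = "ext_rep N lam j z"
  have X: "quiver_rep ?X" by (rule quiver_rep_hyper_rep)
  fix a
  let ?t = "\<lambda>v :: 'a vec. if a = B23 then fscale (right v j) z else 0"
  have t: "?t (u + v) = ?t u + ?t v" "?t (fscale c v) = fscale c (?t v)" for u v c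
    by (simp_all add: right_def fscale_def fun_eq_iff algebra_simps)
  show "linear_map_on (vspace ?M (source a)) (vspace ?M (target a)) (act ?M a)"
    unfolding linear_map_on_def
  proof (intro conjI ballI allI)
    fix v assume v: "v \<in> vspace ?M (source a)"
    have "?t v \<in> vspace N (target a)"
      using z seqs.subspace_scale[OF rep_subspace[OF N]] seqs.subspace_0[OF rep_subspace[OF N]] by (cases a) auto
    then show "act ?M a v \<in> vspace ?M (target a)"
      using v rep_act[OF N] rep_act[OF X] seqs.subspace_add[OF rep_subspace[OF N]]
      unfolding ext_rep_space ext_rep_act left_right_mix by blast
    fix c
    have "act N a (left (fscale c v)) = fscale c (act N a (left v))"
      "act ?X a (right (fscale c v)) = fscale c (act ?X a (right v))"
      using v lin_on_scale[OF rep_lin[OF N]] lin_on_scale[OF rep_lin[OF X]]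
      unfolding ext_rep_space lin_simps(3)[OF lin_left] lin_simps(3)[OF lin_right] by blast+
    then show "act ?M a (fscale c v) = fscale c (act ?M a v)"
      unfolding ext_rep_act t mix_scale seqs.scale_right_distrib by (simp only:)
  next
    fix u v assume uv: "u \<in> vspace ?M (source a)" "v \<in> vspace ?M (source a)"
    then have "act N a (left (u + v)) = act N a (left u) + act N a (left v)"
      "act ?X a (right (u + v)) = act ?X a (right u) + act ?X a (right v)"
      using lin_on_add[OF rep_lin[OF N]] lin_on_add[OF rep_lin[OF X]]
      unfolding ext_rep_space lin_simps(1)[OF lin_left] lin_simps(1)[OF lin_right] by blast+
    then show "act ?M a (u + v) = act ?M a u + act ?M a v"
      unfolding ext_rep_act mix_add t by (simp only: add.assoc add.left_commute)
  qed
qed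

text \<open>A torsion vector of the extension projects to zero in the quotient, hence lies in
  \<open>N\<close>, and so does the whole Jordan chain below it. As the right components vanish, the
  cocycle does not contribute.\<close>

lemma mu_free_ext_rep:
  assumes N: "quiver_rep N" "mu_free n N" and inj: "inj lam"
  shows "mu_free n (ext_rep N lam j z)"
  unfolding mu_free_def
proof (intro allI impI conjI ballI)
  fix p q r s :: 'a assume det: "p * s \<noteq> q * r"
  let ?X = "hyper_rep lam (Suc j)" and ?M = "ext_rep N lam j z"
  have X: "quiver_rep ?X" "mu_free n ?X" by (rule quiver_rep_hyper_rep, rule mu_free_hyper_rep[OF inj])
  \<comment> \<open>If the right component of \<open>w\<close> vanishes, that of its predecessor
    \<open>u\<close> is killed by d. Freeness of the quotient at level \<open>Suc n\<close> then
    gives zero, which permits levels up to \<open>Suc (Suc n)\<close>.\<close>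
  have K: "right w \<in> kset ?X p q r s i \<and> (right w = 0 \<longrightarrow> left w \<in> kset N p q r s i)"
    if "w \<in> kset ?M p q r s i" "i \<le> Suc (Suc n)" for w i
    using that
  proof (induction i arbitrary: w)
    case 0
    then have "w = 0" by simp
    then have "right w = 0" "left w = 0" using lin_simps(4)[OF lin_right] lin_simps(4)[OF lin_left] by metis+
    then show ?case unfolding kset.simps by blast
  next
    case (Suc i)
    then obtain u where u: "u \<in> kset ?M p q r s i" "pen ?M p q w = pen ?M r s u" "w \<in> vspace ?M V2" by auto
    have eq: "pen N p q (left w) + fscale (q * right w j) z = pen N r s (left u) + fscale (s * right u j) z"
      "pen ?X p q (right w) = pen ?X r s (right u)"
      using u(2) unfolding ext_rep_pen mix_eq_iff by auto
    have IH: "right u \<in> kset ?X p q r s i" "right u = 0 \<Longrightarrow> left u \<in> kset N p q r s i"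
      using Suc.IH[OF u(1)] Suc.prems(2) by linarith+
    have "left w \<in> kset N p q r s (Suc i)" if 0: "right w = 0"
    proof -
      have "pen ?X r s (right u) = 0"
        using eq(2) unfolding 0 using lin_on_0[OF pen_lin[OF X(1)] rep_subspace[OF X(1)]] by metis
      moreover have "kset ?X p q r s i \<subseteq> kset ?X p q r s (Suc n)"
        using Suc.prems(2) by (intro kset_mono[OF X(1)]) simp
      ultimately have u0: "right u = 0" using mu_free_kset[OF X(2) det] IH(1) by blast
      have "pen N p q (left w) = pen N r s (left u)"
        using eq(1) unfolding 0 u0 by simp
      then show ?thesis using IH(2)[OF u0] u(3) unfolding ext_rep_space by auto
    qed
    moreover have "right w \<in> kset ?X p q r s (Suc i)" using u(3) IH(1) eq(2) unfolding ext_rep_space by auto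
    ultimately show ?case by blast
  qed
  {
    fix w assume w: "w \<in> kset ?M p q r s (Suc n)" "pen ?M r s w = 0"
    have "pen ?X r s (right w) = 0" "pen N r s (left w) + fscale (s * right w j) z = 0"
      using w(2) unfolding ext_rep_pen by (metis mix_eq_iff mix_zero)+
    moreover have "right w \<in> kset ?X p q r s (Suc n)" using K[OF w(1)] by (simp del: kset.simps)
    ultimately have r0: "right w = 0" using mu_free_kset[OF X(2) det] by blast
    then have "left w \<in> kset N p q r s (Suc n)" using K[OF w(1)] by (simp del: kset.simps)
    moreover have "pen N r s (left w) = 0"
      using \<open>pen N r s (left w) + fscale (s * right w j) z = 0\<close> unfolding r0 by simp
    ultimately have "left w = 0" using mu_free_kset[OF N(2) det] by blast
    then show "w = 0" using r0 left_right_mix(3)[of w] mix_zero by metis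
  next
    fix x assume x: "x \<in> vspace ?M V1" "act ?M A12 x \<in> kset ?M p q r s n"
    let ?w = "act ?M A12 x"
    have w: "left ?w = act N A12 (left x)" "right ?w = act ?X A12 (right x)"
      unfolding ext_rep_act by simp_all
    have xs: "left x \<in> vspace N V1" "right x \<in> vspace ?X V1" using x(1) unfolding ext_rep_space by auto
    have r0: "right x = 0" using K[OF x(2)] mu_free_alpha_kset[OF X(2) det xs(2)] w(2) by simp
    then have "left ?w \<in> kset N p q r s n" using K[OF x(2)] w(2) unfolding hyper_rep_act by simp
    then have "left x = 0" using mu_free_alpha_kset[OF N(2) det xs(1)] w(1) by simp
    then show "x = 0" using r0 left_right_mix(3)[of x] mix_zero by metis
  }
qed

lemma decreasing_subspaces_stable:
  assumes "\<And>j. seqs.subspace (E j)" "findim (E 0)" "\<And>j. E (Suc j) \<subseteq> E j"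
  shows "\<exists>j. E (Suc j) = E j"
proof (rule ccontr)
  assume neg: "\<not> ?thesis"
  have sub: "E j \<subseteq> E 0" for j using assms(3) by (induction j) auto
  have "seqs.dim (E j) + j \<le> seqs.dim (E 0)" for j
  proof (induction j)
    case (Suc j)
    have "E (Suc j) \<subset> E j" using neg assms(3) by blast
    then have "seqs.dim (E (Suc j)) < seqs.dim (E j)"
      by (rule dim_psubset_findim[OF assms(1) findim_mono[OF assms(2) sub]])
    then show ?case using Suc by simp
  qed simp
  from this[of "Suc (seqs.dim (E 0))"] show False by simp
qed

theorem nonsplit_extension:
  fixes N :: "'k::alg_closed_field rep"
  assumes N: "quiver_rep N" and free: "mu_free n N" and n: "1 \<le> n" and nz: "vspace N V3 \<noteq> {0}"
  shows "\<exists>M f. quiver_rep M \<and> mu_free n M \<and> rep_hom N M f \<and> inj_sub (vspace N) f \<and>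
    (\<forall>K. \<not> splits M (vspace M) (img f (vspace N)) K)"
proof -
  obtain lam :: "nat \<Rightarrow> 'k" where lam: "inj lam" using infinite_countable_subset[OF infinite_alg_closed] by blast
  define D where "D i = pen N (lam i) (-1)" for i
  define A where "A i = (\<lambda>x. D i (act N A12 x)) ` vspace N V1" for i
  \<comment> \<open>The vectors that can be made an eigenvector for each of the parameters
    \<open>lam i\<close>, \<open>i < j\<close>, by adding an element of the image of alpha.\<close>
  define E where "E j = {m \<in> vspace N V2. \<forall>i<j. D i m \<in> A i}" for j
  have al: "linear_map_on (vspace N V1) (vspace N V2) (act N A12)" using rep_lin[OF N, of A12] by simp
  have D: "linear_map_on (vspace N V2) (vspace N V3) (D i)" for i unfolding D_def by (rule pen_lin[OF N])
  have comp: "linear_map_on (vspace N V1) (vspace N V3) (\<lambda>x. D i (act N A12 x))" for i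
    using al D[of i] unfolding linear_map_on_def by simp
  have A: "seqs.subspace (A i)" for i unfolding A_def by (rule lin_on_image[OF comp rep_subspace[OF N]])
  have "seqs.subspace (E j)" for j
    using rep_subspace[OF N, of V2] A lin_on_0[OF D rep_subspace[OF N]] lin_on_add[OF D] lin_on_scale[OF D]
    unfolding seqs.subspace_def E_def by auto
  moreover have "findim (E 0)" using rep_findim[OF N, of V2] unfolding E_def by simp
  moreover have "E (Suc j) \<subseteq> E j" for j unfolding E_def by auto
  ultimately obtain j where j: "E (Suc j) = E j" using decreasing_subspaces_stable by blast
  obtain z where z: "z \<in> vspace N V3" "z \<notin> A j"
    using pencil_not_surjective[OF N free n nz, of "lam j"] unfolding A_def D_def by auto
  let ?M = "ext_rep N lam j z" and ?f = "\<lambda>(i::vertex) v. mix v 0" and ?X = "hyper_rep lam (Suc j)"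
  have M: "quiver_rep ?M" by (rule quiver_rep_ext_rep[OF N z(1)])
  have X: "quiver_rep ?X" by (rule quiver_rep_hyper_rep)
  have f: "rep_hom N ?M ?f"
    unfolding rep_hom_def
  proof (intro conjI allI ballI lin_mix)
    show "(\<lambda>v. mix v 0) ` vspace N i \<subseteq> vspace ?M i" for i
      using seqs.subspace_0[OF rep_subspace[OF X]] unfolding ext_rep_space image_subset_iff left_right_mix by blast
    show "mix (act N a x) 0 = act ?M a (mix x 0)" for a x
      unfolding ext_rep_act left_right_mix mix_eq_iff rep_act_0[OF X] by (simp add: fscale_def fun_eq_iff)
  qed
  have injf: "inj_sub (vspace N) ?f"
    unfolding inj_sub_def using mix_zero mix_eq_iff by metis
  have False if K: "splits ?M (vspace ?M) (img ?f (vspace N)) K" for K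
  proof -
    have sK: "K \<in> submodules ?M" using K unfolding splits_def by blast
    have subK: "seqs.subspace (K i)" for i by (rule sub_subspace[OF sK])
    have KM: "K i \<subseteq> vspace ?M i" for i by (rule sub_le[OF sK])
    \<comment> \<open>The complement \<open>K\<close> is the graph of a section of the quotient map:
      \<open>lift\<close> gives existence and \<open>uniq\<close> uniqueness of the left
      component.\<close>
    have lift: "\<exists>m\<in>vspace N i. mix m x \<in> K i" if x: "x \<in> vspace ?X i" for i x
    proof -
      have "mix 0 x \<in> vspace ?M i"
        using x seqs.subspace_0[OF rep_subspace[OF N]] unfolding ext_rep_space left_right_mix by blast
      then obtain m k where mk: "m \<in> vspace N i" "k \<in> K i" "mix 0 x = mix m 0 + k"
        using K unfolding splits_def img_def by blast
      have "k = mix 0 x - mix m 0" using mk(3) by simp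
      also have "\<dots> = mix (- m) x" unfolding mix_diff by simp
      finally show ?thesis using mk seqs.subspace_neg[OF rep_subspace[OF N]] by metis
    qed
    have uniq: "m = m'" if "mix m x \<in> K i" "mix m' x \<in> K i" for i m m' x
    proof -
      have "mix m x - mix m' x \<in> K i" using that seqs.subspace_diff[OF subK] by blast
      then have k: "mix (m - m') 0 \<in> K i" unfolding mix_diff diff_self .
      then have "mix (m - m') 0 \<in> vspace ?M i" using KM by blast
      then have "m - m' \<in> vspace N i" unfolding ext_rep_space left_right_mix by blast
      then have "mix (m - m') 0 \<in> img ?f (vspace N) i" unfolding img_def by blast
      then have "mix (m - m') 0 = 0" using k K unfolding splits_def by blast
      then have "m - m' = 0" using mix_zero mix_eq_iff by metis
      then show ?thesis by simp
    qed
    have unit: "unit i \<in> vspace ?X V2" if "i \<le> j" for i using that unfolding hyper_rep_space unit_def by auto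
    have "\<forall>i. \<exists>m. i \<le> j \<longrightarrow> m \<in> vspace N V2 \<and> mix m (unit i) \<in> K V2" using lift[OF unit] by blast
    then obtain m where m: "\<And>i. i \<le> j \<Longrightarrow> m i \<in> vspace N V2" "\<And>i. i \<le> j \<Longrightarrow> mix (m i) (unit i) \<in> K V2" by metis
    \<comment> \<open>On the quotient, lam_i b1 - b2 kills the unit vector \<open>i\<close>; so
      \<open>D i (m i)\<close> is exactly the cocycle, which lives in the last coordinate.\<close>
    have Dm: "D i (m i) = (if i = j then z else 0)" if i: "i \<le> j" for i
    proof -
      have "mix (act N A23 (m i)) (unit i) \<in> K V3"
        using sub_act[OF sK, of "mix (m i) (unit i)" A23] m(2)[OF i] by (simp add: ext_rep_act hyper_rep_act)
      then have "mix (fscale (lam i) (act N A23 (m i))) (fscale (lam i) (unit i)) \<in> K V3"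
        unfolding mix_scale[symmetric] by (rule seqs.subspace_scale[OF subK])
      moreover have "mix (act N B23 (m i) + fscale (unit i j) z) (\<lambda>l. lam l * unit i l) \<in> K V3"
        using sub_act[OF sK, of "mix (m i) (unit i)" B23] m(2)[OF i] by (simp add: ext_rep_act hyper_rep_act)
      moreover have "(\<lambda>l. lam l * unit i l) = fscale (lam i) (unit i)"
        unfolding fscale_def unit_def by (auto simp: fun_eq_iff)
      ultimately have "fscale (lam i) (act N A23 (m i)) = act N B23 (m i) + fscale (unit i j) z"
        using uniq by metis
      moreover have "fscale (unit i j) z = (if i = j then z else 0)" unfolding unit_def by simp
      ultimately show ?thesis unfolding D_def pen_def by (simp add: fscale_def fun_eq_iff)
    qed
    have "D i (m j) \<in> A i" if i: "i < j" for i
    proof -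
      \<comment> \<open>Differences of unit vectors lie in the hyperplane; lifting them at the first
        vertex shows that \<open>m i\<close> and \<open>m j\<close> differ by an element of the
        image of alpha.\<close>
      have "unit i - unit j \<in> vspace ?X V1"
        unfolding hyper_rep_space unit_def using i by (auto simp: sum_subtractf)
      then obtain t where t: "t \<in> vspace N V1" "mix t (unit i - unit j) \<in> K V1" using lift by blast
      have "mix (act N A12 t) (unit i - unit j) \<in> K V2"
        using sub_act[OF sK, of "mix t (unit i - unit j)" A12] t(2) by (simp add: ext_rep_act hyper_rep_act)
      moreover have "mix (m i - m j) (unit i - unit j) \<in> K V2"
        unfolding mix_diff[symmetric] using m(2) i seqs.subspace_diff[OF subK] by simp
      ultimately have eq: "act N A12 t = m i - m j" using uniq by blast
      have "D i (act N A12 t) = D i (m i) - D i (m j)"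
        unfolding eq by (rule lin_on_diff[OF D rep_subspace[OF N]]) (use m(1) i in auto)
      then have "D i (m j) = - D i (act N A12 t)" using Dm[of i] i by simp
      then show ?thesis using seqs.subspace_neg[OF A] t(1) unfolding A_def by (metis imageI)
    qed
    then have "m j \<in> E j" unfolding E_def using m(1) by blast
    \<comment> \<open>The chain \<open>E\<close> is stationary at \<open>j\<close>, so the
      conditions for smaller indices imply the one at \<open>j\<close>.\<close>
    then have "D j (m j) \<in> A j" unfolding j[symmetric] unfolding E_def by blast
    then show False using Dm[of j] z(2) by simp
  qed
  then show ?thesis using M f injf mu_free_ext_rep[OF N free lam] by blast
qed

subsection \<open>Larger measures below a given one\<close>

text \<open>The last member of the chain contains all others. This turns a set found in a possibly
  decomposable module into a lower bound for an actual measure.\<close>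

lemma gr_sets_sub_indecomposable:
  assumes M: "quiver_rep M" and I: "I \<in> gr_sets M"
  shows "\<exists>U. U \<in> submodules M \<and> indecomposable (subrep M U) \<and> I \<in> gr_sets (subrep M U)"
proof -
  obtain Us where Us: "Us \<noteq> []" "sorted_wrt (<) Us"
      "\<forall>U\<in>set Us. U \<in> submodules M \<and> indecomposable (subrep M U)"
    and I: "I = (\<lambda>U. rep_length (subrep M U)) ` set Us"
    using I unfolding gr_sets_def by blast
  let ?U = "last Us"
  have U: "?U \<in> submodules M" "indecomposable (subrep M ?U)" using Us by auto
  have "U \<le> ?U" if "U \<in> set Us" for U
  proof -
    have "Us = butlast Us @ [?U]" using Us(1) by simp
    then have "sorted_wrt (<) (butlast Us @ [?U])" "U \<in> set (butlast Us @ [?U])" using Us(2) that by metis+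
    then show ?thesis by (auto simp: sorted_wrt_append)
  qed
  then have "\<forall>U\<in>set Us. U \<in> submodules (subrep M ?U)" using Us(3) submodules_sub[OF U(1)] by blast
  then have "I \<in> gr_sets (subrep M ?U)" unfolding gr_sets_def I using Us by auto
  then show ?thesis using U by blast
qed

lemma gabriel_roiter_ge:
  assumes "indecomposable N" "I \<in> gr_sets N"
  shows "I = gabriel_roiter N \<or> gr_less I (gabriel_roiter N)"
  using gabriel_roiter_is_max(2)[of N I] assms unfolding indecomposable_def by blast

lemma gabriel_roiter_in_gr_sets: "indecomposable N \<Longrightarrow> gabriel_roiter N \<in> gr_sets N"
  using gabriel_roiter_is_max(1)[of N] unfolding indecomposable_def by blast

text \<open>If \<open>V3\<close> carries nothing, both arrows vanish, so the absence of a common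
  kernel empties \<open>V2\<close>, and injectivity of the first map empties
  \<open>V1\<close>.\<close>

lemma mu_free_nonzero:
  assumes N: "quiver_rep N" "mu_free n N" and nz: "vspace N \<noteq> zero_sub"
  shows "vspace N V3 \<noteq> {0}"
proof
  assume z: "vspace N V3 = {0}"
  have 0: "0 \<in> vspace N i" for i using rep_subspace[OF N(1)] seqs.subspace_0 by blast
  have 2: "v = 0" if "v \<in> vspace N V2" for v
    using mu_free_beta[OF N that] rep_act[OF N(1), of v A23] rep_act[OF N(1), of v B23] that z by simp
  have 1: "v = 0" if "v \<in> vspace N V1" for v
    using mu_free_alpha[OF N that] rep_act[OF N(1), of v A12] that 2 by simp
  have "vspace N i = {0}" for i using 0 1 2 z by (cases i) blast+
  then show False using nz unfolding zero_sub_def by blast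
qed

text \<open>The overmodule \<open>M\<close> may decompose. Its larger set is realised inside an
  indecomposable submodule \<open>U\<close>, which inherits torsion-freeness; this keeps the measure
  of \<open>U\<close> below mu^n.\<close>

lemma larger_measure:
  fixes N :: "'k::alg_closed_field rep"
  assumes N: "indecomposable N" "mu_free n N" and n: "1 \<le> n"
  shows "\<exists>I. gr_measure TYPE('k) I \<and> gr_less (gabriel_roiter N) I \<and> gr_less I (mu_set n)"
proof -
  have Nr: "quiver_rep N" "vspace N \<noteq> zero_sub" using N(1) unfolding indecomposable_def by auto
  obtain M f where M: "quiver_rep M" "mu_free n M" "rep_hom N M f" "inj_sub (vspace N) f"
    "\<forall>K. \<not> splits M (vspace M) (img f (vspace N)) K"
    using nonsplit_extension[OF Nr(1) N(2) n mu_free_nonzero[OF Nr(1) N(2) Nr(2)]] by blast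
  obtain J where J: "J \<in> gr_sets M" "gr_less (gabriel_roiter N) J"
    using gr_less_of_nonsplit[OF Nr(1) N(1) M(1,3,4)] M(5) by blast
  obtain U where U: "U \<in> submodules M" "indecomposable (subrep M U)" "J \<in> gr_sets (subrep M U)"
    using gr_sets_sub_indecomposable[OF M(1) J(1)] by blast
  let ?I = "gabriel_roiter (subrep M U)"
  have "gr_less (gabriel_roiter N) ?I"
    using gabriel_roiter_ge[OF U(2,3)] J(2) gr_less_trans by metis
  moreover have "gr_less ?I (mu_set n)"
    by (rule mu_free_gr_sets_less[OF quiver_rep_subrep[OF M(1) U(1)] mu_free_subrep[OF M(2) U(1)] n
          gabriel_roiter_in_gr_sets[OF U(2)]])
  moreover have "gr_measure TYPE('k) ?I" unfolding gr_measure_def using U(2) by blast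
  ultimately show ?thesis by blast
qed

text \<open>For one parameter the hyperplane is zero, and \<open>hyper_rep lam 1\<close> is the
  simple regular module (0, 1, 1). It serves as a torsion-free substitute for the exceptional
  modules of total dimension at most 2.\<close>

lemma ex_mu_free_measure_12:
  "\<exists>N :: 'k::alg_closed_field rep. indecomposable N \<and> mu_free n N \<and>
    (gabriel_roiter N = {1, 2} \<or> gr_less {1, 2} (gabriel_roiter N))"
proof -
  obtain lam :: "nat \<Rightarrow> 'k" where lam: "inj lam" using infinite_countable_subset[OF infinite_alg_closed] by blast
  let ?X = "hyper_rep lam 1" and ?e = "\<lambda>_::nat. unit 0 :: 'k vec"
  have X: "quiver_rep ?X" by (rule quiver_rep_hyper_rep)
  have det: "lam 0 * 0 \<noteq> (-1) * 1" by simp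
  have pen0: "pen ?X (lam 0) (-1) (unit 0) = 0" "pen ?X 1 0 x = x" for x
    unfolding hyper_rep_pen by (simp_all add: unit_def fun_eq_iff)
  have unitX: "unit 0 \<in> vspace ?X V2" unfolding hyper_rep_space unit_def by simp
  have e: "jordan_seq ?X (lam 0) (-1) 1 0 ?e (Suc 0)"
    unfolding jordan_seq_def using pen0(1) unitX by blast
  have unit0: "unit 0 \<noteq> (0 :: 'k vec)" unfolding unit_def by (simp add: fun_eq_iff)
  have "gr_chain ?X (chain_mod ?X 1 0 {0} ?e (Suc 0)) (even_set (Suc 0))"
  proof (rule gr_chain_jordan[OF X det e])
    show "?e l \<notin> seqs.span (?e ` {..<l})" if "l < Suc 0" for l using that unit0 by simp
    show "x = 0" if "pen ?X 1 0 x = 0" for x using that unfolding pen0(2) .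
  qed
  moreover have "even_set (Suc 0) = {1, 2}" unfolding even_set_def by auto
  ultimately have "{1, 2} \<in> gr_sets ?X" unfolding gr_sets_iff[OF X] by auto
  then obtain U where U: "U \<in> submodules ?X" "indecomposable (subrep ?X U)" "{1, 2} \<in> gr_sets (subrep ?X U)"
    using gr_sets_sub_indecomposable[OF X] by blast
  then show ?thesis
    using gabriel_roiter_ge[OF U(2,3)] mu_free_subrep[OF mu_free_hyper_rep[OF lam] U(1)] by metis
qed

text \<open>Both arrows to \<open>V3\<close> vanish on \<open>A2\<close>, so \<open>A1\<close> and
  \<open>A2\<close> form a submodule that is zero at \<open>V3\<close>; the complement takes
  \<open>B1\<close>, \<open>B2\<close> and all of \<open>V3\<close>. Indecomposability makes the
  complement zero.\<close>

lemma split_off_A2: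
  assumes N: "quiver_rep N" "indecomposable N"
    and sub: "seqs.subspace A1" "seqs.subspace B1" "seqs.subspace A2" "seqs.subspace B2"
    and le: "A1 \<subseteq> vspace N V1" "B1 \<subseteq> vspace N V1" "A2 \<subseteq> vspace N V2" "B2 \<subseteq> vspace N V2"
    and act: "\<And>x. x \<in> A1 \<Longrightarrow> act N A12 x \<in> A2" "\<And>x. x \<in> B1 \<Longrightarrow> act N A12 x \<in> B2"
      "\<And>v. v \<in> A2 \<Longrightarrow> act N A23 v = 0" "\<And>v. v \<in> A2 \<Longrightarrow> act N B23 v = 0"
    and dis: "A1 \<inter> B1 = {0}" "A2 \<inter> B2 = {0}"
    and sum: "\<forall>x\<in>vspace N V1. \<exists>a\<in>A1. \<exists>b\<in>B1. x = a + b" "\<forall>x\<in>vspace N V2. \<exists>a\<in>A2. \<exists>b\<in>B2. x = a + b"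
    and nz: "A1 \<noteq> {0} \<or> A2 \<noteq> {0}"
  shows "total_dim (vspace N) = seqs.dim A1 + seqs.dim A2"
proof -
  define A where "A i = (case i of V1 \<Rightarrow> A1 | V2 \<Rightarrow> A2 | V3 \<Rightarrow> {0})" for i
  define B where "B i = (case i of V1 \<Rightarrow> B1 | V2 \<Rightarrow> B2 | V3 \<Rightarrow> vspace N V3)" for i
  have A: "A V1 = A1" "A V2 = A2" "A V3 = {0}" and B: "B V1 = B1" "B V2 = B2" "B V3 = vspace N V3"
    unfolding A_def B_def by simp_all
  have V3: "0 \<in> vspace N V3" using seqs.subspace_0[OF rep_subspace[OF N(1)]] .
  have leA: "A i \<subseteq> vspace N i" for i using le V3 by (cases i) (simp_all add: A)
  have leB: "B i \<subseteq> vspace N i" for i using le by (cases i) (simp_all add: B)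
  have sA: "A \<in> submodules N"
  proof (rule submoduleI[OF _ leA])
    show "seqs.subspace (A i)" for i using sub by (cases i) (simp_all add: A seqs.subspace_single_0)
    fix a x assume "x \<in> A (source a)"
    then show "act N a x \<in> A (target a)" using act by (cases a) (simp_all add: A)
  qed
  have sB: "B \<in> submodules N"
  proof (rule submoduleI[OF _ leB])
    show "seqs.subspace (B i)" for i using sub rep_subspace[OF N(1)] by (cases i) (simp_all add: B)
    fix a x assume x: "x \<in> B (source a)"
    show "act N a x \<in> B (target a)"
    proof (cases "a = A12")
      case True
      then show ?thesis using x act(2) by (simp add: B)
    next
      case False
      then have "target a = V3" by (cases a) simp_all
      moreover have "act N a x \<in> vspace N (target a)" using x leB rep_act[OF N(1)] by blast
      ultimately show ?thesis by (simp add: B)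
    qed
  qed
  have "x = 0" if "x \<in> A i" "x \<in> B i" for i x
    using that dis by (cases i) (auto simp only: A B)
  moreover have "\<exists>a\<in>A i. \<exists>b\<in>B i. x = a + b" if "x \<in> vspace N i" for i x
    using that sum by (cases i) (auto simp: A B)
  ultimately have "splits N (vspace N) A B"
    unfolding splits_def le_fun_def using sA sB leA leB by blast
  moreover have "A \<noteq> zero_sub" using nz A unfolding zero_sub_def by metis
  ultimately have "B = zero_sub" using N indecomposable_iff[OF N(1)] by blast
  then have 0: "B1 = {0}" "B2 = {0}" "vspace N V3 = {0}" using B unfolding zero_sub_def by metis+
  then have "vspace N V1 = A1" "vspace N V2 = A2" using sum le by auto
  then show ?thesis unfolding total_dim_def 0 dim_zero by simp
qed

text \<open>The three exceptions are the indecomposable modules supported on the first two vertices.\<close>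

lemma small_or_basic:
  assumes ind: "indecomposable N"
  shows "total_dim (vspace N) \<le> 2 \<or>
    (\<forall>x\<in>vspace N V1. act N A12 x = 0 \<longrightarrow> x = 0) \<and>
    (\<forall>v\<in>vspace N V2. act N A23 v = 0 \<longrightarrow> act N B23 v = 0 \<longrightarrow> v = 0)"
proof -
  have N: "quiver_rep N" using ind unfolding indecomposable_def by blast
  let ?V1 = "vspace N V1" and ?V2 = "vspace N V2" and ?al = "act N A12"
  have V: "seqs.subspace ?V1" "seqs.subspace ?V2" using rep_subspace[OF N] by auto
  have al: "linear_map_on ?V1 ?V2 ?al" using rep_lin[OF N, of A12] by simp
  have be: "linear_map_on ?V2 (vspace N V3) (act N A23)" "linear_map_on ?V2 (vspace N V3) (act N B23)"
    using rep_lin[OF N, of A23] rep_lin[OF N, of B23] by simp_all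
  have zero: "seqs.subspace {0 :: 'a vec}" by (rule seqs.subspace_single_0)
  have line: "f y = fscale c (f x)" if "linear_map_on W W' f" "x \<in> W" "y = fscale c x" for f W W' x y c
    using that lin_on_scale by metis
  have line_sub: "seqs.span {x} \<subseteq> W" if "x \<in> W" "seqs.subspace W" for x W
    using that by (intro seqs.span_minimal) auto
  have nzl: "seqs.span {x} \<noteq> {0}" if "x \<noteq> 0" for x :: "'a vec"
    using that seqs.span_base[of x "{x}"] by blast
  \<comment> \<open>A line in the kernel of the first map splits off as the simple module at
    \<open>V1\<close>.\<close>
  have 1: "total_dim (vspace N) \<le> 2" if x: "x \<in> ?V1" "?al x = 0" "x \<noteq> 0" for x
  proof -
    obtain H where H: "seqs.subspace H" "H \<subseteq> ?V1" "seqs.span {x} \<inter> H = {0}"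
      "\<forall>b\<in>?V1. \<exists>a\<in>seqs.span {x}. \<exists>h\<in>H. b = a + h"
      using complement_exists[OF seqs.subspace_span V(1) line_sub[OF x(1) V(1)]] by blast
    have "total_dim (vspace N) = seqs.dim (seqs.span {x}) + seqs.dim {0 :: 'a vec}"
    proof (rule split_off_A2[OF N ind seqs.subspace_span H(1) zero V(2) line_sub[OF x(1) V(1)] H(2) _ order_refl])
      show "?al y \<in> {0}" if "y \<in> seqs.span {x}" for y
        using that line[OF al x(1)] x(2) unfolding seqs.span_singleton by auto
    qed (use H V x(3) al be nzl lin_on_mem[OF al] rep_act_0[OF N] seqs.subspace_0 in \<open>auto simp del: seqs.span_insert_0\<close>)
    then show ?thesis unfolding dim_line[OF x(3)] dim_zero by simp
  qed
  have 2: "total_dim (vspace N) \<le> 2"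
    if inj: "\<forall>x\<in>?V1. ?al x = 0 \<longrightarrow> x = 0" and v: "v \<in> ?V2" "act N A23 v = 0" "act N B23 v = 0" "v \<noteq> 0" for v
  proof -
    let ?L = "seqs.span {v}"
    have L: "?L \<subseteq> ?V2" by (rule line_sub[OF v(1) V(2)])
    have bL: "act N A23 y = 0" "act N B23 y = 0" if "y \<in> ?L" for y
      using that line[OF be(1) v(1)] line[OF be(2) v(1)] v(2,3) unfolding seqs.span_singleton by auto
    have disL: "?L \<inter> W = {0}" if W: "v \<notin> W" "seqs.subspace W" for W
    proof -
      have "y = 0" if y: "y \<in> ?L" "y \<in> W" for y
      proof -
        obtain c where "y = fscale c v" using y(1) unfolding seqs.span_singleton by blast
        then show ?thesis using y(2) W span_line_mem[of c v W] by (metis seqs.scale_zero_left)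
      qed
      then show ?thesis using seqs.span_zero seqs.subspace_0[OF W(2)] by blast
    qed
    show ?thesis
    proof (cases "v \<in> ?al ` ?V1")
      \<comment> \<open>A complement of the line of \<open>v\<close> containing the image of the
        first map lets the simple module at \<open>V2\<close> split off.\<close>
      case False
      have im: "seqs.subspace (?al ` ?V1)" "?al ` ?V1 \<subseteq> ?V2" using lin_on_image[OF al V(1)] lin_on_mem[OF al] by auto
      obtain H where H: "seqs.subspace H" "?al ` ?V1 \<subseteq> H" "H \<subseteq> ?V2" "?L \<inter> H = {0}"
        "\<forall>b\<in>?V2. \<exists>a\<in>?L. \<exists>h\<in>H. b = a + h"
        using complement_over[OF seqs.subspace_span V(2) im(1) L im(2) disL[OF False im(1)]] by blast
      have "total_dim (vspace N) = seqs.dim {0 :: 'a vec} + seqs.dim ?L"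
        by (rule split_off_A2[OF N ind zero V(1) seqs.subspace_span H(1) _ order_refl L H(3) _ _ bL _ H(4) _ H(5)])
          (use H V v(4) nzl rep_act_0[OF N] seqs.subspace_0 seqs.span_zero in auto)
      then show ?thesis unfolding dim_line[OF v(4)] dim_zero by simp
    next
      \<comment> \<open>Here the lines of \<open>x\<close> and \<open>v\<close> form a module (1, 1,
        0). The complement at \<open>V2\<close> must contain the image of the complement
        \<open>H1\<close> at \<open>V1\<close>; it exists because injectivity keeps \<open>v\<close>
        out of that image.\<close>
      case True
      then obtain x where x: "x \<in> ?V1" "v = ?al x" by blast
      have x0: "x \<noteq> 0" using v(4) x(2) rep_act_0[OF N] by metis
      let ?K = "seqs.span {x}"
      have K: "?K \<subseteq> ?V1" by (rule line_sub[OF x(1) V(1)])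
      obtain H1 where H1: "seqs.subspace H1" "H1 \<subseteq> ?V1" "?K \<inter> H1 = {0}"
        "\<forall>b\<in>?V1. \<exists>a\<in>?K. \<exists>h\<in>H1. b = a + h"
        using complement_exists[OF seqs.subspace_span V(1) K] by blast
      have im: "seqs.subspace (?al ` H1)" "?al ` H1 \<subseteq> ?V2"
        using lin_on_image[OF lin_on_subset[OF al H1(2)] H1(1)] lin_on_mem[OF al] H1(2) by blast+
      have "v \<notin> ?al ` H1"
      proof
        assume "v \<in> ?al ` H1"
        then obtain h where h: "h \<in> H1" "?al x = ?al h" unfolding x(2) by (rule imageE)
        then have "x = h" using lin_on_inj[OF al V(1)] inj x(1) H1(2) by (meson inj_onD subsetD)
        then show False using h(1) H1(3) x0 seqs.span_base[of x "{x}"] by blast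
      qed
      then have "?L \<inter> ?al ` H1 = {0}" using disL im(1) by blast
      then obtain H2 where H2: "seqs.subspace H2" "?al ` H1 \<subseteq> H2" "H2 \<subseteq> ?V2" "?L \<inter> H2 = {0}"
        "\<forall>b\<in>?V2. \<exists>a\<in>?L. \<exists>h\<in>H2. b = a + h"
        using complement_over[OF seqs.subspace_span V(2) im(1) L im(2)] by blast
      have "total_dim (vspace N) = seqs.dim ?K + seqs.dim ?L"
      proof (rule split_off_A2[OF N ind seqs.subspace_span H1(1) seqs.subspace_span H2(1) K H1(2) L H2(3) _ _ bL H1(3) H2(4) H1(4) H2(5)])
        show "?al y \<in> ?L" if "y \<in> ?K" for y
          using that line[OF al x(1)] x(2) unfolding seqs.span_singleton by auto
      qed (use H2(2) nzl[OF x0] in auto)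
      then show ?thesis unfolding dim_line[OF v(4)] dim_line[OF x0] by simp
    qed
  qed
  show ?thesis using 1 2 by blast
qed

theorem theorem4p1:
  fixes n :: nat
  assumes "n \<ge> 1"
  shows "\<not> (\<exists>\<mu>. direct_predecessor TYPE('k::alg_closed_field) \<mu> (mu_set n))"
proof
  assume "\<exists>\<mu>. direct_predecessor TYPE('k) \<mu> (mu_set n)"
  then obtain J where J: "gr_measure TYPE('k) J" "gr_less J (mu_set n)"
    and none: "\<And>I. gr_measure TYPE('k) I \<Longrightarrow> gr_less J I \<Longrightarrow> \<not> gr_less I (mu_set n)"
    unfolding direct_successor_def by blast
  obtain N :: "'k rep" where N: "indecomposable N" "J = gabriel_roiter N" using J(1) unfolding gr_measure_def by blast
  have Nr: "quiver_rep N" using N(1) unfolding indecomposable_def by blast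
  show False
  proof (cases "mu_free n N")
    case True
    then show False using larger_measure[OF N(1) True assms] none N(2) by blast
  next
    case False
    \<comment> \<open>Otherwise some mu^j with \<open>j \<le> n\<close> is realised in
      \<open>N\<close>, so \<open>J\<close> is at least mu^j and hence at least mu^n.\<close>
    have "total_dim (vspace N) \<le> 2"
    proof (rule ccontr)
      assume "\<not> ?thesis"
      then obtain j where j: "1 \<le> j" "j \<le> n" "mu_set j \<in> gr_sets N"
        using small_or_basic[OF N(1)] mu_set_in_gr_sets[OF Nr False] by blast
      have "mu_set j = mu_set n \<or> gr_less (mu_set n) (mu_set j)"
      proof (cases "j = n")
        case False
        then have "j < n" using j(2) by simp
        \<comment> \<open>The two sets agree below 2j + 1, and this number belongs to mu^j
          only.\<close>
        then have "gr_less (mu_set n) (mu_set j)"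
          unfolding gr_less_iff using j(1) by (intro exI[of _ "2 * j + 1"]) (auto simp: mu_set_def, presburger)
        then show ?thesis by blast
      qed simp
      then have "mu_set n = J \<or> gr_less (mu_set n) J"
        using gabriel_roiter_ge[OF N(1) j(3)] gr_less_trans unfolding N(2) by metis
      then show False using J(2) gr_less_trans gr_less_irrefl by metis
    qed
    obtain U where U: "gr_chain N U J"
      using gabriel_roiter_in_gr_sets[OF N(1)] gr_sets_iff[OF Nr] N(2) by blast
    have "U \<in> submodules N" by (rule gr_chain_sub[OF U Nr])
    then have "U \<le> vspace N" unfolding submodules_def by blast
    then have "total_dim U \<le> total_dim (vspace N)"
      using total_dim_mono[OF Nr \<open>U \<in> submodules N\<close> space_in_submodules[OF Nr]] by (auto simp: order.order_iff_strict)
    then have sub: "i = 1 \<or> i = 2" if "i \<in> J" for i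
      using gr_chain_le[OF U Nr] that \<open>total_dim (vspace N) \<le> 2\<close> by fastforce
    have le: "J = {1, 2} \<or> gr_less J {1, 2}"
    proof (cases "1 \<in> J")
      case True
      show ?thesis
      proof (cases "2 \<in> J")
        case True
        then show ?thesis using sub \<open>1 \<in> J\<close> by blast
      next
        case False
        moreover have "y \<in> J \<longleftrightarrow> y \<in> {1, 2}" if "y < 2" for y using sub[of y] that \<open>1 \<in> J\<close> by auto
        ultimately have "gr_less J {1, 2}" unfolding gr_less_iff by blast
        then show ?thesis ..
      qed
    next
      case False
      moreover have "y \<in> J \<longleftrightarrow> y \<in> {1, 2}" if "y < 1" for y using sub[of y] that by auto
      ultimately have "gr_less J {1, 2}" unfolding gr_less_iff by blast
      then show ?thesis ..
    qed
    \<comment> \<open>As \<open>J\<close> is at most {1, 2}, it is at most the measure of the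
      torsion-free \<open>N'\<close>; a measure strictly between the latter and mu^n also separates
      \<open>J\<close> from mu^n.\<close>
    obtain N' :: "'k rep" where N': "indecomposable N'" "mu_free n N'"
      "gabriel_roiter N' = {1, 2} \<or> gr_less {1, 2} (gabriel_roiter N')"
      using ex_mu_free_measure_12[of n] by blast
    have "J = gabriel_roiter N' \<or> gr_less J (gabriel_roiter N')" using le N'(3) by (auto intro: gr_less_trans)
    moreover obtain I where "gr_measure TYPE('k) I" "gr_less (gabriel_roiter N') I" "gr_less I (mu_set n)"
      using larger_measure[OF N'(1,2) assms] by blast
    ultimately show False using none[of I] gr_less_trans by blast
  qed
qed

end
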